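(* Let $d\ge2$ be even, $0\le r_0<r_1\le\infty$, and let $f:A(r_0,r_1)\to\mathbb{C}$ be polyharmonic of infinite order and type $\tau<1/(2r_1)$. Then there exist analytic functions $$f_1:\{z\in\mathbb{C}^d:L_+(z)<r_1\}\to\mathbb{C},$$ $$f_2:\{z\in\mathbb{C}^d:r_0<L_-(z),\ L_+(z)<1/(2\tau),\ q(z)\notin(-\infty,0]\}\to\mathbb{C}$$ such that $F(z)=f_1(z)+(z_1^2+\dots+z_d^2)^{(2-d)/2}f_2(z)$ is an analytic extension of $f$, i.e. $F$ is analytic on $\widetilde A(r_0,r_1)\setminus q^{-1}((-\infty,0])$ and $F(x)=f(x)$ for all $x\in A(r_0,r_1)$.
   Context: Conventions: $1/(2\tau)=\infty$ if $\tau=0$. $A(r_0,r_1)=\{x\in\mathbb{R}^d: r_0<|x|<r_1\}$. A function $f:G\to\mathbb{C}$ on a domain $G\subset\mathbb{R}^d$ is polyharmonic of infinite order and type $\tau\ge0$ if $f\in C^\infty(G)$ and for every compact $K\subset G$ and every $\varepsilon>0$ there is $C_{K,\varepsilon}>0$ with $\max_{x\in K}|\Delta^p f(x)|\le C_{K,\varepsilon}(2p)!(\tau+\varepsilon)^{2p}$ for all $p\in\mathbb{N}_0$. For $z\in\mathbb{C}^d$: $|z|_{\mathbb{C}^d}^2=|z_1|^2+\dots+|z_d|^2$, $q(z)=z_1^2+\dots+z_d^2$, $L_\pm(z)=\sqrt{|z|_{\mathbb{C}^d}^2\pm\sqrt{|z|_{\mathbb{C}^d}^4-|q(z)|^2}}$,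 and $\widetilde A(r_0,r_1)=\{z\in\mathbb{C}^d: r_0<L_-(z)\text{ and }L_+(z)<r_1\}$. *)

theory Defs
  imports "HOL-Analysis.Analysis"
begin

definition pdiff :: "'n::finite \<Rightarrow> (real^'n \<Rightarrow> complex) \<Rightarrow> real^'n \<Rightarrow> complex" where
  "pdiff i g x = vector_derivative (\<lambda>t::real. g (x + t *\<^sub>R axis i 1)) (at 0)"

fun pdiffs :: "'n::finite list \<Rightarrow> (real^'n \<Rightarrow> complex) \<Rightarrow> real^'n \<Rightarrow> complex" where
  "pdiffs [] g = g"
| "pdiffs (i # is) g = pdiff i (pdiffs is g)"

definition smooth_on :: "(real^'n::finite) set \<Rightarrow> (real^'n \<Rightarrow> complex) \<Rightarrow> bool" where
  "smooth_on G g \<longleftrightarrow> (\<forall>is. continuous_on G (pdiffs is g) \<and>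
     (\<forall>x\<in>G. \<forall>i. (\<lambda>t::real. pdiffs is g (x + t *\<^sub>R axis i 1)) differentiable (at 0)))"

definition laplacian :: "(real^'n::finite \<Rightarrow> complex) \<Rightarrow> real^'n \<Rightarrow> complex" where
  "laplacian g x = (\<Sum>i\<in>UNIV. pdiff i (pdiff i g) x)"

definition polyharmonic_inf :: "(real^'n::finite) set \<Rightarrow> real \<Rightarrow> (real^'n \<Rightarrow> complex) \<Rightarrow> bool" where
  "polyharmonic_inf G \<tau> f \<longleftrightarrow> smooth_on G f \<and>
     (\<forall>K. compact K \<and> K \<subseteq> G \<longrightarrow> (\<forall>\<epsilon>>0. \<exists>C>0. \<forall>p::nat. \<forall>x\<in>K.
        norm ((laplacian ^^ p) f x) \<le> C * fact (2*p) * (\<tau> + \<epsilon>) ^ (2*p)))"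

definition annulus :: "real \<Rightarrow> ereal \<Rightarrow> (real^'n::finite) set" where
  "annulus r0 r1 = {x. r0 < norm x \<and> ereal (norm x) < r1}"

definition qf :: "complex^'n::finite \<Rightarrow> complex" where
  "qf z = (\<Sum>i\<in>UNIV. (z$i)^2)"

definition Lplus :: "complex^'n::finite \<Rightarrow> real" where
  "Lplus z = sqrt ((norm z)^2 + sqrt ((norm z)^4 - (cmod (qf z))^2))"

definition Lminus :: "complex^'n::finite \<Rightarrow> real" where
  "Lminus z = sqrt ((norm z)^2 - sqrt ((norm z)^4 - (cmod (qf z))^2))"

definition cannulus :: "real \<Rightarrow> ereal \<Rightarrow> (complex^'n::finite) set" where
  "cannulus r0 r1 = {z. r0 < Lminus z \<and> ereal (Lplus z) < r1}"

definition holo_on :: "(complex^'n::finite) set \<Rightarrow> (complex^'n \<Rightarrow> complex) \<Rightarrow> bool" where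
  "holo_on S F \<longleftrightarrow> (\<forall>z\<in>S. \<exists>D. (F has_derivative D) (at z) \<and> (\<forall>c w. D (c *s w) = c * D w))"

definition inv2 :: "real \<Rightarrow> ereal" where
  "inv2 \<tau> = (if \<tau> = 0 then \<infinity> else ereal (1 / (2*\<tau>)))"

definition cembed :: "real^'n::finite \<Rightarrow> complex^'n" where
  "cembed x = (\<chi> i. complex_of_real (x$i))"

definition negaxis :: "complex set" where
  "negaxis = {w. Im w = 0 \<and> Re w \<le> 0}"

end

(*
Green's formula with smooth cutoffs. Let G_p(s) = s^(p-m) (A_p log s + B_p), d = 2m + 2, be such
that G_p(|x|^2) is a fundamental solution of the (p+1)-st power of the Laplacian. If psi is a radial
cutoff equal to 1 near x and supported in the annulus, repeated integration by parts gives

  f(x) = const * sum_p  integral of (Laplacian^p f)(y) * [Laplacian, psi] G_p(q(x - y)) dy;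

the coefficients of G_p decay like 1/(2p)!, so the type bound makes the series converge as long as
tau |q(x - y)|^(1/2) < 1. The commutator lives on an inner and an outer shell. On the outer shell
q(z - y) avoids the negative axis for L_+(z) < |y|, and on the inner one q(z - y)/q(z) does so for
|y| < L_-(z); hence both shell integrals extend holomorphically in z, to f1 and to q^(-m) f2.
Moving the shells does not change the values, since Green's formula with a cutoff supported away
from the singularity gives 0, for complex z as well; so the shells can be pushed to the boundary of
the annulus. The singularity at x is handled by replacing |x - y|^2 by |x - y|^2 + e^2.
*)

theory Submission
  imports Defs "HOL-Real_Asymp.Real_Asymp"
begin

subsection \<open>Integrals of compactly supported continuous functions\<close>

text \<open>The factor 2 in the type bound comes from
  \<open>cmod (qf (z - cembed y)) \<le> (norm y + Lplus z)\<^sup>2\<close>: the series needs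
  \<open>\<tau> * (norm y + Lplus z) < 1\<close>, and each summand gets the share 1/2, from
  \<open>2 * \<tau> * R < 1\<close> for y in the annulus and from
  \<open>2 * \<tau> * Lplus z < 1\<close> for z. Even dimension makes the powers in G_p integral, so
  only the logarithm branches; on the inner shell its branch is log q(z) + log (q(z - y)/q(z)),
  whence the slit in the domain of f2. The obstacle is the singularity at y = x. With s = |x - y|^2
  + e^2 the Laplacian of G_p(s) is G_(p-1)(s) - 4 e^2 G_p''(s). For p = 0 the error term is a
  multiple of e^2 / s^(m+2), whose mass is scale invariant in dimension 2m + 2; it concentrates at x
  and returns f(x). Its mass is never computed: only existence and positivity of the limit matter,
  because the constant is divided out at the end.\<close>

definition csupp :: "'a::topological_space set \<Rightarrow> ('a \<Rightarrow> 'b::real_normed_vector) \<Rightarrow> bool" where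
  "csupp S u \<longleftrightarrow> continuous_on UNIV u \<and> (\<forall>y. y \<notin> S \<longrightarrow> u y = 0)"

text \<open>V and -S are open and cover the space, so continuity glues. Kernels with singularities
  outside V enter the integrals through this rule.\<close>

lemma csuppI:
  assumes "open V" "closed S" "S \<subseteq> V" "continuous_on V u" "\<And>y. y \<notin> S \<Longrightarrow> u y = 0"
  shows "csupp S u"
proof -
  have "continuous_on (-S) u"
    using continuous_on_cong[of "-S" "-S" u "\<lambda>_. 0"] assms(5) by simp
  then have "continuous_on (V \<union> -S) u"
    using assms by (intro continuous_on_open_Un) auto
  moreover have "V \<union> -S = UNIV" using assms(3) by auto
  ultimately show ?thesis using assms(5) by (simp add: csupp_def)
qed

lemma integral_UNIV_cbox:
  fixes u :: "'a::euclidean_space \<Rightarrow> 'b::banach"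
  assumes "\<And>y. y \<notin> cbox a b \<Longrightarrow> u y = 0"
  shows "integral UNIV u = integral (cbox a b) u"
proof -
  have "integral UNIV u = integral UNIV (\<lambda>y. if y \<in> cbox a b then u y else 0)"
    using assms by (intro arg_cong[where f="integral UNIV"]) auto
  also have "\<dots> = integral (cbox a b) u" by (rule integral_restrict_UNIV)
  finally show ?thesis .
qed

lemma compact_subset_cbox:
  fixes S :: "'a::euclidean_space set"
  assumes "compact S"
  obtains a where "S \<subseteq> cbox (-a) a"
  using bounded_subset_cbox_symmetric[of S] assms compact_imp_bounded by blast

lemma csupp_cbox_integral:
  fixes u :: "'a::euclidean_space \<Rightarrow> 'b::banach"
  assumes "csupp S u" "S \<subseteq> cbox a b"
  shows "integral UNIV u = integral (cbox a b) u"
  using assms by (intro integral_UNIV_cbox) (auto simp: csupp_def)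

lemma csupp_integrable_cbox:
  fixes u :: "'a::euclidean_space \<Rightarrow> 'b::banach"
  shows "csupp S u \<Longrightarrow> u integrable_on cbox a b"
  by (intro integrable_continuous) (auto simp: csupp_def intro: continuous_on_subset)

lemma csupp_has_integral:
  fixes u :: "'a::euclidean_space \<Rightarrow> 'b::banach"
  assumes "csupp S u" "compact S"
  shows "(u has_integral integral UNIV u) UNIV"
proof -
  obtain a where a: "S \<subseteq> cbox (-a) a" using compact_subset_cbox[OF assms(2)] by blast
  have "u integrable_on cbox (-a) a" by (rule csupp_integrable_cbox[OF assms(1)])
  then have "(u has_integral integral UNIV u) (cbox (-a) a)"
    using csupp_cbox_integral[OF assms(1) a] by (simp add: has_integral_integral)
  then show ?thesis
    by (rule has_integral_on_superset) (use assms(1) a in \<open>auto simp: csupp_def\<close>)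
qed

lemma csupp_integrable:
  fixes u :: "'a::euclidean_space \<Rightarrow> 'b::banach"
  assumes "csupp S u" "compact S"
  shows "u integrable_on UNIV"
  using csupp_has_integral[OF assms] by blast

lemma csupp_continuous_compose: "csupp S u \<Longrightarrow> continuous_on A g \<Longrightarrow> continuous_on A (\<lambda>x. u (g x))"
  using continuous_on_compose2[of UNIV u A g] by (simp add: csupp_def)

lemma csupp_add: "csupp S u \<Longrightarrow> csupp S v \<Longrightarrow> csupp S (\<lambda>y. u y + v y)"
  by (auto simp: csupp_def intro: continuous_intros)

lemma csupp_cmult:
  fixes u :: "'a::topological_space \<Rightarrow> 'b::real_normed_algebra"
  shows "csupp S u \<Longrightarrow> csupp S (\<lambda>y. c * u y)"
  by (auto simp: csupp_def intro: continuous_intros)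

lemma csupp_sum: "(\<And>i. i \<in> I \<Longrightarrow> csupp S (u i)) \<Longrightarrow> csupp S (\<lambda>y. \<Sum>i\<in>I. u i y)"
  by (auto simp: csupp_def intro: continuous_intros)

lemma integral_UNIV_shift:
  fixes u :: "'a::euclidean_space \<Rightarrow> 'b::banach"
  assumes "csupp S u" "compact S"
  shows "integral UNIV (\<lambda>y. u (y + c)) = integral UNIV u"
proof -
  obtain a where a: "S \<subseteq> cbox (-a) a" using compact_subset_cbox[OF assms(2)] by blast
  have "integral UNIV (\<lambda>y. u (y + c)) = integral (cbox (-a - c) (a - c)) (\<lambda>y. u (y + c))"
  proof (rule integral_UNIV_cbox)
    fix y assume "y \<notin> cbox (- a - c) (a - c)"
    then have "y + c \<notin> cbox (-a) a" by (auto simp: mem_box algebra_simps)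
    then show "u (y + c) = 0" using assms a by (auto simp: csupp_def)
  qed
  also have "\<dots> = integral (cbox (-a) a) u"
    using integral_shift_cbox_plus[of "-a - c" "a - c" u c] by (simp add: o_def add.commute)
  also have "\<dots> = integral UNIV u" using csupp_cbox_integral[OF assms(1) a] by simp
  finally show ?thesis .
qed

lemma csupp_uniformly_summable:
  fixes u :: "nat \<Rightarrow> 'a::euclidean_space \<Rightarrow> 'b::banach"
  assumes u: "\<And>p. csupp S (u p)" and S: "compact S"
    and M: "\<And>p y. norm (u p y) \<le> M p" and sM: "summable M"
  shows "(\<lambda>p. integral UNIV (u p)) sums integral UNIV (\<lambda>y. \<Sum>p. u p y)"
    and "csupp S (\<lambda>y. \<Sum>p. u p y)"
proof -
  obtain a where a: "S \<subseteq> cbox (-a) a" using compact_subset_cbox[OF S] by blast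
  have ul: "uniform_limit A (\<lambda>n y. \<Sum>p<n. u p y) (\<lambda>y. \<Sum>p. u p y) sequentially" for A
    by (rule Weierstrass_m_test) (use M sM in auto)
  have cs: "csupp S (\<lambda>y. \<Sum>p<n. u p y)" for n using u by (intro csupp_sum)
  have "continuous_on UNIV (\<lambda>y. \<Sum>p. u p y)"
    by (rule uniform_limit_theorem[OF _ ul]) (use cs in \<open>auto simp: csupp_def\<close>)
  then show cs': "csupp S (\<lambda>y. \<Sum>p. u p y)" using u by (auto simp: csupp_def)
  obtain I J where I: "\<And>n. ((\<lambda>y. \<Sum>p<n. u p y) has_integral I n) (cbox (-a) a)"
    and J: "((\<lambda>y. \<Sum>p. u p y) has_integral J) (cbox (-a) a)" and lim: "I \<longlonglongrightarrow> J"
    by (rule uniform_limit_integral_cbox[OF ul[of "cbox (-a) a"]])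
      (use cs in \<open>auto simp: csupp_def intro: continuous_on_subset\<close>)
  have "I n = (\<Sum>p<n. integral UNIV (u p))" for n
  proof -
    have "integral UNIV (\<lambda>y. \<Sum>p<n. u p y) = I n"
      using csupp_cbox_integral[OF cs a] I[of n] by (simp add: integral_unique)
    moreover have "integral UNIV (\<lambda>y. \<Sum>p<n. u p y) = (\<Sum>p<n. integral UNIV (u p))"
      by (rule integral_sum) (use csupp_integrable[OF u S] in auto)
    ultimately show ?thesis by simp
  qed
  moreover have "J = integral UNIV (\<lambda>y. \<Sum>p. u p y)"
    using csupp_cbox_integral[OF cs' a] J by (simp add: integral_unique)
  ultimately show "(\<lambda>p. integral UNIV (u p)) sums integral UNIV (\<lambda>y. \<Sum>p. u p y)"
    using lim by (simp add: sums_def) (metis (no_types) ext)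
qed

subsection \<open>Directional derivatives and Green's identity\<close>

text \<open>Relational form of \<open>pdiff\<close>: a value of \<open>vector_derivative\<close>
  says nothing where no derivative exists, so existence is kept together with the value.\<close>

definition has_pd :: "'n::finite \<Rightarrow> (real^'n \<Rightarrow> complex) \<Rightarrow> complex \<Rightarrow> real^'n \<Rightarrow> bool" where
  "has_pd i u u' y \<longleftrightarrow> ((\<lambda>t::real. u (y + t *\<^sub>R axis i 1)) has_vector_derivative u') (at 0)"

lemma has_pd_pdiff: "has_pd i u u' y \<Longrightarrow> pdiff i u y = u'"
  by (simp add: has_pd_def pdiff_def vector_derivative_at)

lemma has_pd_const: "has_pd i (\<lambda>_. c) 0 y"
  by (simp add: has_pd_def)

lemma has_pd_add: "has_pd i u u' y \<Longrightarrow> has_pd i v v' y \<Longrightarrow> has_pd i (\<lambda>y. u y + v y) (u' + v') y"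
  by (simp add: has_pd_def has_vector_derivative_add)

lemma has_pd_diff: "has_pd i u u' y \<Longrightarrow> has_pd i v v' y \<Longrightarrow> has_pd i (\<lambda>y. u y - v y) (u' - v') y"
  by (simp add: has_pd_def has_vector_derivative_diff)

lemma has_pd_sum: "(\<And>j. j \<in> J \<Longrightarrow> has_pd i (u j) (u' j) y) \<Longrightarrow>
    has_pd i (\<lambda>y. \<Sum>j\<in>J. u j y) (\<Sum>j\<in>J. u' j) y"
  by (simp add: has_pd_def has_vector_derivative_sum)

lemma has_pd_mult: "has_pd i u u' y \<Longrightarrow> has_pd i v v' y \<Longrightarrow>
    has_pd i (\<lambda>y. u y * v y) (u y * v' + u' * v y) y"
  unfolding has_pd_def by (drule (1) has_vector_derivative_mult) simp

lemma has_pd_cong_open: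
  assumes "open V" "y \<in> V" "\<And>y. y \<in> V \<Longrightarrow> u y = v y" "has_pd i v v' y"
  shows "has_pd i u v' y"
proof -
  have "continuous (at 0) (\<lambda>t::real. y + t *\<^sub>R axis i 1)" by (intro continuous_intros)
  then have "((\<lambda>t::real. y + t *\<^sub>R axis i 1) \<longlongrightarrow> y) (at 0)"
    by (simp add: continuous_at)
  then have ev: "\<forall>\<^sub>F t in at 0. (y + t *\<^sub>R axis i 1) \<in> V"
    using assms(1,2) by (rule topological_tendstoD)
  show ?thesis unfolding has_pd_def
    by (rule has_vector_derivative_transform_within_open[of _ _ 0 "{t. y + t *\<^sub>R axis i 1 \<in> V}"])
      (use assms in \<open>auto simp: has_pd_def vimage_def[symmetric] intro!: open_vimage continuous_intros\<close>)
qed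

lemma has_pd_zero_outside:
  assumes "closed S" "\<And>y. y \<notin> S \<Longrightarrow> u y = 0" "y \<notin> S"
  shows "has_pd i u 0 y"
  by (rule has_pd_cong_open[of "-S" _ _ "\<lambda>_. 0"]) (use assms in \<open>auto intro: has_pd_const\<close>)

text \<open>The integral of u is invariant under translation along the axis; differentiating the
  translated integral under the integral sign gives the integral of u'.\<close>

lemma integral_pd_eq_0:
  fixes u :: "real^'n::finite \<Rightarrow> complex"
  assumes S: "compact S" and u: "csupp S u" and u': "csupp S u'"
    and pd: "\<And>y. has_pd i u (u' y) y"
  shows "integral UNIV u' = 0"
proof -
  define e :: "real^'n" where "e = axis i 1"
  \<comment> \<open>T sweeps S along the axis, so one box contains all translates with |t| < 1 and
    the Leibniz rule works on a fixed domain.\<close>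
  define T where "T = (\<lambda>(t,y). y + t *\<^sub>R e) ` ({-1..1::real} \<times> S)"
  have "compact T" unfolding T_def
    by (intro compact_continuous_image compact_Times S)
      (auto intro!: continuous_intros simp: case_prod_unfold)
  then obtain a where a: "T \<subseteq> cbox (-a) a" using compact_subset_cbox by blast
  have "S \<subseteq> T" unfolding T_def by (force intro: image_eqI[of _ _ "(0, _)"])
  then have aS: "S \<subseteq> cbox (-a) a" using a by auto
  let ?U = "{-1<..<1::real}"
  have out: "u (y + t *\<^sub>R e) = 0" if "t \<in> ?U" "y \<notin> cbox (-a) a" for t y
  proof (rule ccontr)
    assume "u (y + t *\<^sub>R e) \<noteq> 0"
    then have "y + t *\<^sub>R e \<in> S" using u by (auto simp: csupp_def)
    then have "(\<lambda>(t,y). y + t *\<^sub>R e) (-t, y + t *\<^sub>R e) \<in> T"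
      unfolding T_def using that(1) by (intro imageI) auto
    then show False using that(2) a by auto
  qed
  have const: "integral (cbox (-a) a) (\<lambda>y. u (y + t *\<^sub>R e)) = integral UNIV u" if "t \<in> ?U" for t
    using integral_UNIV_cbox[of "-a" a "\<lambda>y. u (y + t *\<^sub>R e)"] out[OF that]
      integral_UNIV_shift[OF u S] by simp
  have "((\<lambda>t. integral (cbox (-a) a) (\<lambda>y. u (y + t *\<^sub>R e))) has_vector_derivative
      integral (cbox (-a) a) (\<lambda>y. u' (y + 0 *\<^sub>R e))) (at 0 within ?U)"
  proof (rule leibniz_rule_vector_derivative)
    fix t y
    have "((\<lambda>s. u ((y + t *\<^sub>R e) + s *\<^sub>R e)) has_vector_derivative u' (y + t *\<^sub>R e)) (at 0)"
      using pd[of "y + t *\<^sub>R e"] by (simp add: has_pd_def e_def)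
    then have "((\<lambda>s. u ((y + t *\<^sub>R e) + (s - t) *\<^sub>R e)) has_vector_derivative u' (y + t *\<^sub>R e)) (at t)"
      using vector_diff_chain_at[of "\<lambda>s. s - t" 1 t "\<lambda>s. u ((y + t *\<^sub>R e) + s *\<^sub>R e)" "u' (y + t *\<^sub>R e)"]
        has_vector_derivative_diff[OF has_vector_derivative_id has_vector_derivative_const[of t "at t"]]
      by (simp add: o_def)
    then show "((\<lambda>t. u (y + t *\<^sub>R e)) has_vector_derivative u' (y + t *\<^sub>R e)) (at t within ?U)"
      by (simp add: algebra_simps has_vector_derivative_at_within)
  next
    fix t show "(\<lambda>y. u (y + t *\<^sub>R e)) integrable_on cbox (-a) a"
      by (intro integrable_continuous csupp_continuous_compose[OF u] continuous_intros)
  next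
    show "continuous_on (?U \<times> cbox (- a) a) (\<lambda>(t, y). u' (y + t *\<^sub>R e))"
      unfolding case_prod_unfold
      by (intro csupp_continuous_compose[OF u'] continuous_intros)
  qed auto
  then have "((\<lambda>t. integral UNIV u) has_vector_derivative
      integral (cbox (-a) a) u') (at 0 within ?U)"
    unfolding scaleR_zero_left add_0_right
    by (rule has_vector_derivative_transform[rotated 2]) (simp_all add: const)
  moreover have "((\<lambda>t. integral UNIV u) has_vector_derivative 0) (at 0 within ?U)"
    by (rule has_vector_derivative_const)
  ultimately have "integral (cbox (-a) a) u' = 0"
    using at_within_open[of 0 ?U] by (metis greaterThanLessThan_iff neg_less_0_iff_less
        open_greaterThanLessThan vector_derivative_at zero_less_one)
  then show ?thesis using csupp_cbox_integral[OF u' aS] by simp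
qed

lemma smooth_on_pdiff: "smooth_on G h \<Longrightarrow> smooth_on G (pdiffs is h)"
proof -
  have "pdiffs js (pdiffs is h) = pdiffs (js @ is) h" for js by (induction js) auto
  then show "smooth_on G h \<Longrightarrow> smooth_on G (pdiffs is h)" by (simp add: smooth_on_def)
qed

lemma smooth_on_has_pd:
  assumes "smooth_on G h" "y \<in> G"
  shows "has_pd i h (pdiff i h y) y"
proof -
  have "(\<lambda>t::real. pdiffs [] h (y + t *\<^sub>R axis i 1)) differentiable (at 0)"
    using assms unfolding smooth_on_def by blast
  then show ?thesis unfolding has_pd_def pdiff_def
    by (simp add: vector_derivative_works[symmetric])
qed

lemma smooth_on_continuous: "smooth_on G h \<Longrightarrow> continuous_on G h"
  unfolding smooth_on_def by (metis pdiffs.simps(1))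

text \<open>Sums pass through \<open>pdiff\<close> where the derivatives exist, so the induction
  stays inside G and uses that derivatives are local.\<close>

lemma pdiffs_laplacian:
  assumes G: "open G" and h: "smooth_on G h" and "y \<in> G"
  shows "pdiffs is (laplacian h) y = (\<Sum>i\<in>UNIV. pdiffs (is @ [i,i]) h y)"
  using \<open>y \<in> G\<close>
proof (induction "is" arbitrary: y)
  case Nil
  then show ?case by (simp add: laplacian_def)
next
  case (Cons j js)
  have "has_pd j (pdiffs js (laplacian h)) (\<Sum>i\<in>UNIV. pdiff j (pdiffs (js @ [i,i]) h) y) y"
    by (rule has_pd_cong_open[OF G Cons.prems, rotated, OF has_pd_sum])
      (use Cons smooth_on_has_pd[OF smooth_on_pdiff[OF h] Cons.prems] in auto)
  then show ?case by (simp add: has_pd_pdiff)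
qed

lemma smooth_on_laplacian:
  assumes G: "open G" and h: "smooth_on G h"
  shows "smooth_on G (laplacian h)"
  unfolding smooth_on_def
proof (intro allI conjI ballI)
  fix "is"
  show "continuous_on G (pdiffs is (laplacian h))"
    by (subst continuous_on_cong[OF refl pdiffs_laplacian[OF G h]])
      (use h in \<open>auto simp: smooth_on_def intro!: continuous_intros\<close>)
next
  fix "is" y i assume y: "y \<in> G"
  have "has_pd i (pdiffs is (laplacian h)) (\<Sum>j\<in>UNIV. pdiff i (pdiffs (is @ [j,j]) h) y) y"
    by (rule has_pd_cong_open[OF G y, rotated, OF has_pd_sum])
      (use pdiffs_laplacian[OF G h] smooth_on_has_pd[OF smooth_on_pdiff[OF h] y] in auto)
  then show "(\<lambda>t::real. pdiffs is (laplacian h) (y + t *\<^sub>R axis i 1)) differentiable at 0"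
    unfolding has_pd_def by (rule differentiableI_vector)
qed

lemma smooth_on_laplacian_funpow:
  assumes "open G" "smooth_on G h"
  shows "smooth_on G ((laplacian ^^ p) h)"
  by (induction p) (use assms smooth_on_laplacian in auto)

text \<open>For each i the function \<open>h y * \<phi>1 i y - pdiff i h y * \<phi> y\<close>
  vanishes off S, so its i-th derivative integrates to 0; the mixed products cancel in that
  derivative. The derivatives of \<phi> are passed as functions given on V only, because \<phi> will
  be singular elsewhere.\<close>

lemma green_identity:
  fixes h \<phi> :: "real^'n::finite \<Rightarrow> complex"
  assumes G: "open G" and h: "smooth_on G h" and V: "open V" "V \<subseteq> G" and S: "compact S" "S \<subseteq> V"
    and pd1: "\<And>i y. y \<in> V \<Longrightarrow> has_pd i \<phi> (\<phi>1 i y) y"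
    and pd2: "\<And>i y. y \<in> V \<Longrightarrow> has_pd i (\<phi>1 i) (\<phi>2 i y) y"
    and c: "continuous_on V \<phi>" "\<And>i. continuous_on V (\<phi>1 i)" "\<And>i. continuous_on V (\<phi>2 i)"
    and z: "\<And>y. y \<notin> S \<Longrightarrow> \<phi> y = 0" "\<And>i y. y \<notin> S \<Longrightarrow> \<phi>1 i y = 0" "\<And>i y. y \<notin> S \<Longrightarrow> \<phi>2 i y = 0"
  shows "integral UNIV (\<lambda>y. h y * (\<Sum>i\<in>UNIV. \<phi>2 i y)) = integral UNIV (\<lambda>y. laplacian h y * \<phi> y)"
proof -
  have Sc: "closed S" using S compact_imp_closed by blast
  have hc: "continuous_on V h" "\<And>i. continuous_on V (pdiff i h)" "\<And>i. continuous_on V (pdiff i (pdiff i h))"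
    using continuous_on_subset[OF smooth_on_continuous[OF h] V(2)]
      continuous_on_subset[OF smooth_on_continuous[OF smooth_on_pdiff[OF h, of "[i]" for i]] V(2)]
      continuous_on_subset[OF smooth_on_continuous[OF smooth_on_pdiff[OF h, of "[i, i]" for i]] V(2)]
    by simp_all
  have "integral UNIV (\<lambda>y. h y * \<phi>2 i y - pdiff i (pdiff i h) y * \<phi> y) = 0" for i
  proof (rule integral_pd_eq_0[OF S(1), where u="\<lambda>y. h y * \<phi>1 i y - pdiff i h y * \<phi> y" and i=i])
    show "csupp S (\<lambda>y. h y * \<phi>1 i y - pdiff i h y * \<phi> y)"
      "csupp S (\<lambda>y. h y * \<phi>2 i y - pdiff i (pdiff i h) y * \<phi> y)"
      by (rule csuppI[OF V(1) Sc S(2)]; use hc c z in \<open>auto intro!: continuous_intros\<close>)+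
    fix y
    show "has_pd i (\<lambda>y. h y * \<phi>1 i y - pdiff i h y * \<phi> y) (h y * \<phi>2 i y - pdiff i (pdiff i h) y * \<phi> y) y"
    proof (cases "y \<in> V")
      case True
      then have yG: "y \<in> G" using V by auto
      have 1: "has_pd i h (pdiff i h y) y" by (rule smooth_on_has_pd[OF h yG])
      have 2: "has_pd i (pdiff i h) (pdiff i (pdiff i h) y) y"
        using smooth_on_has_pd[OF smooth_on_pdiff[OF h, of "[i]"] yG] by simp
      show ?thesis
        using has_pd_diff[OF has_pd_mult[OF 1 pd2[OF True]] has_pd_mult[OF 2 pd1[OF True]]]
        by (simp add: algebra_simps)
    next
      case False
      then have "y \<notin> S" using S by auto
      moreover from this have "has_pd i (\<lambda>y. h y * \<phi>1 i y - pdiff i h y * \<phi> y) 0 y"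
        by (intro has_pd_zero_outside[OF Sc]) (auto simp: z)
      ultimately show ?thesis by (simp add: z)
    qed
  qed
  moreover have "csupp S (\<lambda>y. h y * \<phi>2 i y - pdiff i (pdiff i h) y * \<phi> y)" for i
    by (rule csuppI[OF V(1) Sc S(2)]; use hc c z in \<open>auto intro!: continuous_intros\<close>)
  ultimately have "integral UNIV (\<lambda>y. \<Sum>i\<in>UNIV. h y * \<phi>2 i y - pdiff i (pdiff i h) y * \<phi> y) = 0"
    by (subst integral_sum) (auto intro: csupp_integrable S)
  moreover have "(\<lambda>y. \<Sum>i\<in>UNIV. h y * \<phi>2 i y - pdiff i (pdiff i h) y * \<phi> y)
      = (\<lambda>y. h y * (\<Sum>i\<in>UNIV. \<phi>2 i y) - laplacian h y * \<phi> y)"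
    by (auto simp: laplacian_def sum_subtractf sum_distrib_left sum_distrib_right)
  moreover have "csupp S (\<lambda>y. h y * (\<Sum>i\<in>UNIV. \<phi>2 i y))" "csupp S (\<lambda>y. laplacian h y * \<phi> y)"
    by (rule csuppI[OF V(1) Sc S(2)];
        use hc c z smooth_on_continuous[OF smooth_on_laplacian[OF G h]] V
        in \<open>auto intro!: continuous_intros intro: continuous_on_subset\<close>)+
  ultimately show ?thesis
    by (simp add: integral_diff csupp_integrable[OF _ S(1)])
qed

subsection \<open>Coefficients of the iterated fundamental solutions\<close>

text \<open>With \<^term>\<open>D = 4 * s * d^2 + 4 * (m + 1) * d\<close>, the functions
  \<open>G\<^sub>p s = s\<^sup>p\<^sup>-\<^sup>m (kA m p log s + kB m p)\<close> satisfy \<open>D G\<^sub>0 = 0\<close> and \<open>D G\<^sub>p = G\<^sub>p\<^sub>-\<^sub>1\<close>;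
  \<open>G\<^sub>p (|y|\<^sup>2)\<close> is then a fundamental solution of the \<open>(p+1)\<close>-st power of the Laplacian
  in dimension \<open>2m + 2\<close>.\<close>

primrec kcoef :: "nat \<Rightarrow> nat \<Rightarrow> real \<times> real" where
  "kcoef m 0 = (if m = 0 then (1, 0) else (0, 1))"
| "kcoef m (Suc p) = (let (a, b) = kcoef m p in
     if Suc p = m then (b / (4 * real m), 0)
     else let n = real (Suc p); a' = a / (4 * n * (n - real m)) in
       (a', (b - 4 * (2 * n - real m) * a') / (4 * n * (n - real m))))"

definition kA :: "nat \<Rightarrow> nat \<Rightarrow> real" where "kA m p = fst (kcoef m p)"
definition kB :: "nat \<Rightarrow> nat \<Rightarrow> real" where "kB m p = snd (kcoef m p)"

text \<open>For m > 0 the logarithm enters at p = m: there s^(p-m) = 1 is annihilated by D, so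
  G_(m-1) has to come from A_m log s, while B_m is free and set to 0.\<close>

lemma kA_below: "p < m \<Longrightarrow> kA m p = 0"
  by (induction p) (auto simp: kA_def Let_def case_prod_unfold)

lemma kA_rec: "kA m p = 4 * real (Suc p) * (real (Suc p) - real m) * kA m (Suc p)"
proof (cases "Suc p = m")
  case True then show ?thesis using kA_below[of p m] by auto
next
  case False
  then have "real (Suc p) - real m \<noteq> 0" by (metis of_nat_eq_iff right_minus_eq)
  then show ?thesis using False
    by (simp add: kA_def Let_def case_prod_unfold field_simps del: of_nat_Suc)
qed

lemma kB_rec: "kB m p = 4 * real (Suc p) * (real (Suc p) - real m) * kB m (Suc p)
    + 4 * (2 * real (Suc p) - real m) * kA m (Suc p)"
proof (cases "Suc p = m")
  \<comment> \<open>At the resonance the first summand vanishes and 4 (2m - m) = 4m is the divisor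
    used in \<open>kcoef\<close>.\<close>
  case True
  have "kcoef m (Suc p) = (kB m p / (4 * real m), 0)"
    by (subst kcoef.simps) (use True in \<open>simp add: kB_def case_prod_unfold\<close>)
  then have "kA m (Suc p) = kB m p / (4 * real m)" by (simp add: kA_def)
  moreover have "real (Suc p) = real m" "real m \<noteq> 0" using True by auto
  ultimately show ?thesis by simp
next
  case False
  define n where "n = real (Suc p)"
  have n: "n > 0" by (simp add: n_def)
  have d: "n - real m \<noteq> 0" using False unfolding n_def by (metis of_nat_eq_iff right_minus_eq)
  have "kB m (Suc p) = (kB m p - 4 * (2 * n - real m) * kA m (Suc p)) / (4 * n * (n - real m))"
    using False by (simp add: kA_def kB_def Let_def case_prod_unfold n_def del: of_nat_Suc)
  then show ?thesis unfolding n_def[symmetric] using n d by simp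
qed

text \<open>This is s^(m+2) G_0''(s), a constant since G_0 is s^(-m), or log s for m = 0. Its values
  are m (m + 1) and -1 respectively.\<close>

definition kappa :: "nat \<Rightarrow> real" where
  "kappa m = real m * (real m + 1) * kB m 0 - (2 * real m + 1) * kA m 0"

lemma kappa_nz: "kappa m \<noteq> 0"
  by (auto simp: kappa_def kA_def kB_def)

lemma m_kA_0: "real m * kA m 0 = 0"
  by (simp add: kA_def)

section \<open>Sequences growing slower than every exponential\<close>

definition subexp :: "(nat \<Rightarrow> real) \<Rightarrow> bool" where
  "subexp r \<longleftrightarrow> (\<forall>\<theta>>1. \<exists>K>0. \<forall>p. \<bar>r p\<bar> \<le> K * \<theta> ^ p)"

lemma subexp_of_ratio:
  assumes "\<And>\<theta>. \<theta> > 1 \<Longrightarrow> \<forall>\<^sub>F p in sequentially. \<bar>r (Suc p)\<bar> \<le> \<theta> * \<bar>r p\<bar>"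
  shows "subexp r"
  unfolding subexp_def
proof (intro allI impI)
  fix \<theta> :: real assume \<theta>: "\<theta> > 1"
  then obtain N where N: "\<And>p. p \<ge> N \<Longrightarrow> \<bar>r (Suc p)\<bar> \<le> \<theta> * \<bar>r p\<bar>"
    using assms[OF \<theta>] by (auto simp: eventually_sequentially)
  \<comment> \<open>K dominates the finitely many terms before the ratio bound sets in.\<close>
  define K where "K = 1 + (\<Sum>p\<le>N. \<bar>r p\<bar>)"
  have K: "K > 0" "\<And>p. p \<le> N \<Longrightarrow> \<bar>r p\<bar> \<le> K"
    unfolding K_def using sum_nonneg[of "{..N}" "\<lambda>p. \<bar>r p\<bar>"] member_le_sum[of _ "{..N}" "\<lambda>p. \<bar>r p\<bar>"]
    by (force simp: add_pos_nonneg)+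
  have "\<bar>r p\<bar> \<le> K * \<theta> ^ p" for p
  proof (induction p)
    case 0 show ?case using K(2)[of 0] by simp
  next
    case (Suc p)
    show ?case
    proof (cases "p \<ge> N")
      case True
      have "\<bar>r (Suc p)\<bar> \<le> \<theta> * (K * \<theta> ^ p)"
        by (rule order_trans[OF N[OF True] mult_left_mono[OF Suc]]) (use \<theta> in simp)
      then show ?thesis by (simp add: algebra_simps)
    next
      case False
      then have "\<bar>r (Suc p)\<bar> \<le> K" using K by auto
      also have "\<dots> \<le> K * \<theta> ^ Suc p" using K \<theta> one_le_power[of \<theta> "Suc p"] by simp
      finally show ?thesis .
    qed
  qed
  then show "\<exists>K>0. \<forall>p. \<bar>r p\<bar> \<le> K * \<theta> ^ p" using K by blast
qed

lemma subexp_mono: "subexp r \<Longrightarrow> (\<And>p. \<bar>r' p\<bar> \<le> \<bar>r p\<bar>) \<Longrightarrow> subexp r'"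
  unfolding subexp_def by (meson order_trans)

lemma subexp_const: "subexp (\<lambda>_. c)"
  by (rule subexp_of_ratio) (auto simp: mult_le_cancel_right1)

lemma subexp_real: "subexp real"
proof (rule subexp_of_ratio)
  fix \<theta> :: real assume "\<theta> > 1"
  then have "\<forall>\<^sub>F p in sequentially. real p + 1 \<le> \<theta> * real p" by real_asymp
  then show "\<forall>\<^sub>F p in sequentially. \<bar>real (Suc p)\<bar> \<le> \<theta> * \<bar>real p\<bar>" by (simp add: add.commute)
qed

lemma subexp_add:
  assumes "subexp r" "subexp q"
  shows "subexp (\<lambda>p. r p + q p)"
  unfolding subexp_def
proof (intro allI impI)
  fix \<theta> :: real assume "\<theta> > 1"
  then obtain K L where "K > 0" "L > 0" "\<And>p. \<bar>r p\<bar> \<le> K * \<theta> ^ p" "\<And>p. \<bar>q p\<bar> \<le> L * \<theta> ^ p"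
    using assms unfolding subexp_def by metis
  moreover from this have "\<bar>r p + q p\<bar> \<le> (K + L) * \<theta> ^ p" for p
    unfolding distrib_right by (intro order_trans[OF abs_triangle_ineq] add_mono)
  ultimately show "\<exists>K>0. \<forall>p. \<bar>r p + q p\<bar> \<le> K * \<theta> ^ p" by (intro exI[of _ "K + L"]) auto
qed

text \<open>Each factor is given the rate \<open>sqrt \<theta>\<close>.\<close>

lemma subexp_mult:
  assumes "subexp r" "subexp q"
  shows "subexp (\<lambda>p. r p * q p)"
  unfolding subexp_def
proof (intro allI impI)
  fix \<theta> :: real assume "\<theta> > 1"
  then have s: "sqrt \<theta> > 1" by simp
  then obtain K L where KL: "K > 0" "L > 0" "\<And>p. \<bar>r p\<bar> \<le> K * sqrt \<theta> ^ p" "\<And>p. \<bar>q p\<bar> \<le> L * sqrt \<theta> ^ p"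
    using assms unfolding subexp_def by metis
  have "\<bar>r p * q p\<bar> \<le> (K * L) * \<theta> ^ p" for p
  proof -
    have "\<bar>r p * q p\<bar> \<le> (K * sqrt \<theta> ^ p) * (L * sqrt \<theta> ^ p)"
      unfolding abs_mult using KL by (intro mult_mono) (auto intro: order_trans[OF abs_ge_zero])
    also have "\<dots> = (K * L) * (sqrt \<theta> * sqrt \<theta>) ^ p" unfolding power_mult_distrib by simp
    finally show ?thesis using \<open>\<theta> > 1\<close> by simp
  qed
  then show "\<exists>K>0. \<forall>p. \<bar>r p * q p\<bar> \<le> K * \<theta> ^ p" using KL by (intro exI[of _ "K * L"]) auto
qed

lemma subexp_linear: "subexp (\<lambda>p. a * real p + b)"
  by (intro subexp_add subexp_mult subexp_const subexp_real)

text \<open>By the recurrences one step multiplies |A| + |B| by at most a factor asymptotic to 1 /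
  (4 p^2), which the quotient (2p+2)(2p+1) of the factorials compensates. The sum is estimated as a
  whole because the recurrence for B involves A.\<close>

lemma subexp_kAB: "subexp (\<lambda>p. (\<bar>kA m p\<bar> + \<bar>kB m p\<bar>) * fact (2 * p))"
proof (rule subexp_of_ratio)
  fix \<theta> :: real assume \<theta>: "\<theta> > 1"
  define D where "D p = 4 * (real p + 1) * (real p + 1 - real m)" for p
  define E where "E p = 2 * (real p + 1) * (2 * real p + 1)
    * (1 / D p + 4 * (2 * (real p + 1) - real m) / (D p)\<^sup>2)" for p
  have "E \<longlonglongrightarrow> 1" unfolding E_def D_def by real_asymp
  then have "\<forall>\<^sub>F p in sequentially. E p < \<theta>" using \<theta> by (rule order_tendstoD)
  moreover have "\<forall>\<^sub>F p in sequentially. p \<ge> m" by (rule eventually_ge_at_top)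
  ultimately show "\<forall>\<^sub>F p in sequentially. \<bar>(\<bar>kA m (Suc p)\<bar> + \<bar>kB m (Suc p)\<bar>) * fact (2 * Suc p)\<bar>
      \<le> \<theta> * \<bar>(\<bar>kA m p\<bar> + \<bar>kB m p\<bar>) * fact (2 * p)\<bar>"
  proof eventually_elim
    fix p assume p: "E p < \<theta>" "p \<ge> m"
    define F where "F = 4 * (2 * (real p + 1) - real m)"
    \<comment> \<open>\<open>p \<ge> m\<close> means that the resonance has been passed, which keeps
      the divisor positive.\<close>
    have D: "D p > 0" using p unfolding D_def by simp
    have F: "F \<ge> 0" using p unfolding F_def by simp
    have A: "kA m (Suc p) = kA m p / D p"
      using kA_rec[of m p] D by (simp add: D_def field_simps)
    have B: "kB m (Suc p) = (kB m p - F * kA m (Suc p)) / D p"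
    proof -
      have "kB m p = D p * kB m (Suc p) + F * kA m (Suc p)"
        using kB_rec[of m p] by (simp add: D_def F_def algebra_simps)
      then show ?thesis using D by simp
    qed
    have "\<bar>kB m (Suc p)\<bar> \<le> (\<bar>kB m p\<bar> + F * \<bar>kA m (Suc p)\<bar>) / D p"
      unfolding B using D F abs_triangle_ineq4[of "kB m p" "F * kA m (Suc p)"]
      by (simp add: divide_right_mono abs_mult)
    then have "\<bar>kA m (Suc p)\<bar> + \<bar>kB m (Suc p)\<bar> \<le> \<bar>kA m p\<bar> / D p + (\<bar>kB m p\<bar> + F * (\<bar>kA m p\<bar> / D p)) / D p"
      unfolding A using D by simp
    also have "\<dots> = (\<bar>kA m p\<bar> + \<bar>kB m p\<bar>) * (1 / D p) + \<bar>kA m p\<bar> * (F / (D p)\<^sup>2)"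
      using D by (simp add: field_simps power2_eq_square)
    also have "\<dots> \<le> (\<bar>kA m p\<bar> + \<bar>kB m p\<bar>) * (1 / D p) + (\<bar>kA m p\<bar> + \<bar>kB m p\<bar>) * (F / (D p)\<^sup>2)"
      using F by (intro add_left_mono mult_right_mono) auto
    finally have le: "\<bar>kA m (Suc p)\<bar> + \<bar>kB m (Suc p)\<bar> \<le> (\<bar>kA m p\<bar> + \<bar>kB m p\<bar>) * (1 / D p + F / (D p)\<^sup>2)"
      by (simp add: distrib_left)
    have f: "fact (2 * Suc p) = 2 * (real p + 1) * (2 * real p + 1) * fact (2 * p)"
      by (simp add: algebra_simps)
    have "(\<bar>kA m (Suc p)\<bar> + \<bar>kB m (Suc p)\<bar>) * fact (2 * Suc p)
       \<le> ((\<bar>kA m p\<bar> + \<bar>kB m p\<bar>) * (1 / D p + F / (D p)\<^sup>2)) * fact (2 * Suc p)"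
      using le by (intro mult_right_mono) auto
    also have "\<dots> = E p * ((\<bar>kA m p\<bar> + \<bar>kB m p\<bar>) * fact (2 * p))"
      unfolding f E_def F_def by (simp add: algebra_simps)
    also have "\<dots> \<le> \<theta> * ((\<bar>kA m p\<bar> + \<bar>kB m p\<bar>) * fact (2 * p))"
      using p by (intro mult_right_mono) auto
    finally show "\<bar>(\<bar>kA m (Suc p)\<bar> + \<bar>kB m (Suc p)\<bar>) * fact (2 * Suc p)\<bar>
      \<le> \<theta> * \<bar>(\<bar>kA m p\<bar> + \<bar>kB m p\<bar>) * fact (2 * p)\<bar>"
      by (simp add: abs_mult del: fact_Suc mult_Suc_right)
  qed
qed

lemma subexp_kA: "subexp (\<lambda>p. kA m p * fact (2 * p))"
  and subexp_kB: "subexp (\<lambda>p. kB m p * fact (2 * p))"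
  by (rule subexp_mono[OF subexp_kAB[of m]]; simp add: abs_mult mult_right_mono)+

subsection \<open>Power series with continuous coefficients\<close>

text \<open>Turns a strict inequality at a into room to the right of a; it supplies the slightly
  larger radii and rates in the convergence estimates.\<close>

lemma exists_right_less:
  fixes g :: "real \<Rightarrow> real"
  assumes "(g \<longlongrightarrow> g a) (at_right a)" "g a < b"
  obtains t where "g t < b" "t > a"
proof -
  have "\<forall>\<^sub>F t in at_right a. g t < b \<and> t > a"
    by (intro eventually_conj order_tendstoD(2)[OF assms] eventually_at_right_less)
  then show ?thesis using eventually_happens[of _ "at_right a"] that by auto
qed

text \<open>Says that the power series with coefficients c_p(y) converges for |s| < 1 / \<tau>^2,
  locally uniformly in y. The condition \<open>\<tau>\<^sup>2 * \<rho> < 1\<close> avoids division,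
  so \<tau> = 0 stands for an infinite radius.\<close>

definition tame :: "real \<Rightarrow> 'a::heine_borel set \<Rightarrow> (nat \<Rightarrow> 'a \<Rightarrow> complex) \<Rightarrow> bool" where
  "tame \<tau> V c \<longleftrightarrow> (\<forall>p. continuous_on V (c p)) \<and>
     (\<forall>S \<rho>. compact S \<and> S \<subseteq> V \<and> 0 < \<rho> \<and> \<tau>\<^sup>2 * \<rho> < 1 \<longrightarrow> (\<exists>M. \<forall>p. \<forall>y\<in>S. norm (c p y) * \<rho> ^ p \<le> M))"

definition Ser :: "(nat \<Rightarrow> 'a \<Rightarrow> complex) \<Rightarrow> 'a \<Rightarrow> complex \<Rightarrow> complex" where
  "Ser c y s = (\<Sum>p. c p y * s ^ p)"

lemma tameI:
  assumes "\<And>p. continuous_on V (c p)"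
    "\<And>S \<rho>. compact S \<Longrightarrow> S \<subseteq> V \<Longrightarrow> 0 < \<rho> \<Longrightarrow> \<tau>\<^sup>2 * \<rho> < 1 \<Longrightarrow> \<exists>M. \<forall>p. \<forall>y\<in>S. norm (c p y) * \<rho> ^ p \<le> M"
  shows "tame \<tau> V c"
  using assms unfolding tame_def by blast

lemma tame_continuous: "tame \<tau> V c \<Longrightarrow> continuous_on V (c p)"
  by (simp add: tame_def)

lemma tame_bound:
  assumes "tame \<tau> V c" "compact S" "S \<subseteq> V" "0 < \<rho>" "\<tau>\<^sup>2 * \<rho> < 1"
  obtains M where "M > 0" "\<And>p y. y \<in> S \<Longrightarrow> norm (c p y) * \<rho> ^ p \<le> M"
proof -
  have "\<exists>M. \<forall>p. \<forall>y\<in>S. norm (c p y) * \<rho> ^ p \<le> M"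
    using conjunct2[OF assms(1)[unfolded tame_def], THEN spec, THEN spec, of S \<rho>] assms(2-) by simp
  then obtain M where "\<And>p y. y \<in> S \<Longrightarrow> norm (c p y) * \<rho> ^ p \<le> M" by auto
  then have "norm (c p y) * \<rho> ^ p \<le> \<bar>M\<bar> + 1" if "y \<in> S" for p y
    using that by (meson abs_ge_self add_increasing2 order_trans zero_le_one)
  then show ?thesis using that[of "\<bar>M\<bar> + 1"] by force
qed

lemma tame_subset: "tame \<tau> V c \<Longrightarrow> W \<subseteq> V \<Longrightarrow> tame \<tau> W c"
  unfolding tame_def by (meson continuous_on_subset order_trans)

lemma tame_add:
  assumes "tame \<tau> V c" "tame \<tau> V d"
  shows "tame \<tau> V (\<lambda>p y. c p y + d p y)"
proof (rule tameI)
  show "continuous_on V (\<lambda>y. c p y + d p y)" for p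
    using assms by (auto simp: tame_def intro: continuous_intros)
next
  fix S and \<rho> :: real assume A: "compact S" "S \<subseteq> V" "0 < \<rho>" "\<tau>\<^sup>2 * \<rho> < 1"
  obtain M where M: "\<And>p y. y \<in> S \<Longrightarrow> norm (c p y) * \<rho> ^ p \<le> M"
    using tame_bound[OF assms(1)] A by metis
  obtain N where N: "\<And>p y. y \<in> S \<Longrightarrow> norm (d p y) * \<rho> ^ p \<le> N"
    using tame_bound[OF assms(2)] A by metis
  have "norm (c p y + d p y) * \<rho> ^ p \<le> M + N" if "y \<in> S" for p y
  proof -
    have "norm (c p y + d p y) * \<rho> ^ p \<le> (norm (c p y) + norm (d p y)) * \<rho> ^ p"
      using A by (intro mult_right_mono norm_triangle_ineq) auto
    then show ?thesis using M[OF that, of p] N[OF that, of p] by (simp add: distrib_right)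
  qed
  then show "\<exists>M. \<forall>p. \<forall>y\<in>S. norm (c p y + d p y) * \<rho> ^ p \<le> M" by blast
qed

lemma tame_mult:
  assumes "tame \<tau> V c" "continuous_on V e"
  shows "tame \<tau> V (\<lambda>p y. e y * c p y)"
proof (rule tameI)
  show "continuous_on V (\<lambda>y. e y * c p y)" for p
    using assms by (auto simp: tame_def intro: continuous_intros)
next
  fix S and \<rho> :: real assume A: "compact S" "S \<subseteq> V" "0 < \<rho>" "\<tau>\<^sup>2 * \<rho> < 1"
  obtain M where M: "\<And>p y. y \<in> S \<Longrightarrow> norm (c p y) * \<rho> ^ p \<le> M"
    using tame_bound[OF assms(1)] A by metis
  have "bounded (e ` S)"
    using A assms(2) by (meson compact_continuous_image compact_imp_bounded continuous_on_subset)
  then obtain B where B: "B > 0" "\<And>y. y \<in> S \<Longrightarrow> norm (e y) \<le> B"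
    by (auto simp: bounded_pos)
  have "norm (e y * c p y) * \<rho> ^ p \<le> B * M" if "y \<in> S" for p y
    unfolding norm_mult mult.assoc using B M[OF that, of p] that A
    by (intro mult_mono) auto
  then show "\<exists>M. \<forall>p. \<forall>y\<in>S. norm (e y * c p y) * \<rho> ^ p \<le> M" by blast
qed

text \<open>Choose \<theta> > 1 so close to 1 that \<rho> \<theta> is still an admissible radius; it
  absorbs the growth of r.\<close>

lemma tame_subexp:
  assumes c: "tame \<tau> V c" and r: "subexp r"
  shows "tame \<tau> V (\<lambda>p y. of_real (r p) * c p y)"
proof (rule tameI)
  show "continuous_on V (\<lambda>y. of_real (r p) * c p y)" for p
    using assms by (auto simp: tame_def intro: continuous_intros)
next
  fix S and \<rho> :: real assume A: "compact S" "S \<subseteq> V" "0 < \<rho>" "\<tau>\<^sup>2 * \<rho> < 1"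
  obtain \<theta> where \<theta>: "\<tau>\<^sup>2 * (\<rho> * \<theta>) < 1" "\<theta> > 1"
    by (rule exists_right_less[of "\<lambda>\<theta>. \<tau>\<^sup>2 * (\<rho> * \<theta>)" 1 1]) (use A in \<open>auto intro!: tendsto_eq_intros\<close>)
  obtain M where M: "M > 0" "\<And>p y. y \<in> S \<Longrightarrow> norm (c p y) * (\<rho> * \<theta>) ^ p \<le> M"
    using tame_bound[OF c, of S "\<rho> * \<theta>"] A \<theta> by auto
  obtain K where K: "K > 0" "\<And>p. \<bar>r p\<bar> \<le> K * \<theta> ^ p"
    using r \<theta>(2) unfolding subexp_def by blast
  have "norm (of_real (r p) * c p y) * \<rho> ^ p \<le> K * M" if "y \<in> S" for p y
  proof -
    have "norm (of_real (r p) * c p y) * \<rho> ^ p \<le> (K * \<theta> ^ p) * norm (c p y) * \<rho> ^ p"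
      unfolding norm_mult using K A by (intro mult_right_mono) auto
    also have "\<dots> = K * (norm (c p y) * (\<rho> * \<theta>) ^ p)" by (simp add: power_mult_distrib)
    also have "\<dots> \<le> K * M" using K M(2)[OF that] by (intro mult_left_mono) auto
    finally show ?thesis .
  qed
  then show "\<exists>M. \<forall>p. \<forall>y\<in>S. norm (of_real (r p) * c p y) * \<rho> ^ p \<le> M" by blast
qed

lemma tame_shift:
  assumes c: "tame \<tau> V c"
  shows "tame \<tau> V (\<lambda>p. c (Suc p))"
proof (rule tameI)
  show "continuous_on V (c (Suc p))" for p
    using assms by (auto simp: tame_def)
next
  fix S and \<rho> :: real assume A: "compact S" "S \<subseteq> V" "0 < \<rho>" "\<tau>\<^sup>2 * \<rho> < 1"
  obtain M where M: "\<And>p y. y \<in> S \<Longrightarrow> norm (c p y) * \<rho> ^ p \<le> M"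
    using tame_bound[OF c, of S "\<rho>"] A by metis
  have "norm (c (Suc p) y) * \<rho> ^ p \<le> M / \<rho>" if "y \<in> S" for p y
    using M[OF that, of "Suc p"] A by (simp add: field_simps)
  then show "\<exists>M. \<forall>p. \<forall>y\<in>S. norm (c (Suc p) y) * \<rho> ^ p \<le> M" by blast
qed

definition diffT :: "(nat \<Rightarrow> 'a \<Rightarrow> complex) \<Rightarrow> nat \<Rightarrow> 'a \<Rightarrow> complex" where
  "diffT c p y = of_nat (Suc p) * c (Suc p) y"

lemma tame_diffT:
  assumes "tame \<tau> V c"
  shows "tame \<tau> V (diffT c)"
proof -
  have "diffT c = (\<lambda>p y. of_real (real (Suc p)) * c (Suc p) y)" by (intro ext) (simp add: diffT_def)
  then show ?thesis using tame_shift[OF tame_subexp[OF assms subexp_real]] by simp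
qed

text \<open>An admissible radius t slightly above \<rho> turns the bounds in \<open>tame\<close>
  into a geometric majorant of ratio \<rho> / t. No sign is assumed for \<rho>, hence the
  \<open>max\<close> with 0.\<close>

lemma tame_geometric:
  assumes c: "tame \<tau> V c" and S: "compact S" "S \<subseteq> V" and \<rho>: "\<tau>\<^sup>2 * \<rho> < 1"
  obtains M where "summable M" 
    "\<And>p y s. y \<in> S \<Longrightarrow> cmod s \<le> \<rho> \<Longrightarrow> norm (c p y * s ^ p) \<le> M p"
proof -
  define \<rho>0 where "\<rho>0 = max \<rho> 0"
  have \<rho>0: "\<tau>\<^sup>2 * \<rho>0 < 1" "\<rho>0 \<ge> 0" "\<rho> \<le> \<rho>0" using \<rho> by (auto simp: \<rho>0_def max_def)
  obtain t where t: "\<tau>\<^sup>2 * t < 1" "t > \<rho>0"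
    by (rule exists_right_less[of "\<lambda>t. \<tau>\<^sup>2 * t" \<rho>0 1]) (use \<rho>0 in \<open>auto intro!: tendsto_eq_intros\<close>)
  have t0: "t > 0" using t \<rho>0 by simp
  obtain M where M: "M > 0" "\<And>p y. y \<in> S \<Longrightarrow> norm (c p y) * t ^ p \<le> M"
    using tame_bound[OF c S t0 t(1)] by blast
  have "summable (\<lambda>p. M * (\<rho>0 / t) ^ p)"
    using t \<rho>0 by (intro summable_mult summable_geometric) (simp add: field_simps)
  moreover have "norm (c p y * s ^ p) \<le> M * (\<rho>0 / t) ^ p" if "y \<in> S" "cmod s \<le> \<rho>" for p y s
  proof -
    have "norm (c p y * s ^ p) \<le> norm (c p y) * \<rho>0 ^ p"
      unfolding norm_mult norm_power using that \<rho>0 by (intro mult_left_mono power_mono) auto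
    also have "\<dots> = (norm (c p y) * t ^ p) * (\<rho>0 / t) ^ p" using t0 by (simp add: power_divide)
    also have "\<dots> \<le> M * (\<rho>0 / t) ^ p" using M(2)[OF that(1)] t0 \<rho>0 by (intro mult_right_mono) auto
    finally show ?thesis .
  qed
  ultimately show ?thesis using that by blast
qed

lemma Ser_summable:
  assumes c: "tame \<tau> V c" and y: "y \<in> V" and s: "\<tau>\<^sup>2 * cmod s < 1"
  shows "summable (\<lambda>p. c p y * s ^ p)"
proof -
  obtain M where "summable M" "\<And>p z w. z \<in> {y} \<Longrightarrow> cmod w \<le> cmod s \<Longrightarrow> norm (c p z * w ^ p) \<le> M p"
    by (rule tame_geometric[OF c _ _ s, of "{y}"]) (use y in auto)
  then show ?thesis by (auto intro: summable_comparison_test'[of M 0])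
qed

lemma Ser_add:
  assumes "tame \<tau> V c" "tame \<tau> V d" "y \<in> V" "\<tau>\<^sup>2 * cmod s < 1"
  shows "Ser (\<lambda>p y. c p y + d p y) y s = Ser c y s + Ser d y s"
  using suminf_add[OF Ser_summable[OF assms(1,3,4)] Ser_summable[OF assms(2,3,4)]]
  by (simp add: Ser_def distrib_right)

lemma Ser_mult:
  assumes "tame \<tau> V c" "y \<in> V" "\<tau>\<^sup>2 * cmod s < 1"
  shows "Ser (\<lambda>p y. e y * c p y) y s = e y * Ser c y s"
  using suminf_mult[OF Ser_summable[OF assms], of "e y"]
  by (simp add: Ser_def mult.assoc)

lemma Ser_split_head:
  assumes "tame \<tau> V c" "y \<in> V" "\<tau>\<^sup>2 * cmod s < 1"
  shows "Ser c y s = c 0 y + s * Ser (\<lambda>p. c (Suc p)) y s"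
  using suminf_split_head[OF Ser_summable[OF assms]]
    suminf_mult[OF Ser_summable[OF tame_shift[OF assms(1)] assms(2,3)], of s]
  by (simp add: Ser_def mult.left_commute)

lemma Ser_DERIV:
  assumes c: "tame \<tau> V c" and y: "y \<in> V" and s: "\<tau>\<^sup>2 * cmod s < 1"
  shows "(Ser c y has_field_derivative Ser (diffT c) y s) (at s)"
proof -
  obtain t where t: "\<tau>\<^sup>2 * t < 1" "t > cmod s"
    by (rule exists_right_less[of "\<lambda>t. \<tau>\<^sup>2 * t" "cmod s" 1]) (use s in \<open>auto intro!: tendsto_eq_intros\<close>)
  have t': "cmod (of_real t) = t" using t(2) norm_ge_zero[of s] by (simp del: norm_ge_zero)
  have "DERIV (\<lambda>x. \<Sum>n. c n y * x ^ n) s :> (\<Sum>n. diffs (\<lambda>n. c n y) n * s ^ n)"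
    by (rule termdiffs_strong[where K="of_real t"])
      (use Ser_summable[OF c y, of "of_real t"] t t' in auto)
  then show ?thesis by (simp add: Ser_def[abs_def] diffT_def diffs_def)
qed

lemma Ser_continuous:
  fixes V :: "'a::heine_borel set"
  assumes c: "tame \<tau> V c" and V: "open V"
  shows "continuous_on (V \<times> {s. \<tau>\<^sup>2 * cmod s < 1}) (\<lambda>(y, s). Ser c y s)"
proof -
  have op: "open (V \<times> {s. \<tau>\<^sup>2 * cmod s < 1})"
    by (intro open_Times V open_Collect_less continuous_intros)
  show ?thesis
    unfolding continuous_on_eq_continuous_at[OF op]
  proof clarify
    fix y s assume y: "y \<in> V" and s: "\<tau>\<^sup>2 * cmod s < 1"
    obtain e where e: "e > 0" "cball y e \<subseteq> V" using V y open_contains_cball by blast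
    obtain t where t: "\<tau>\<^sup>2 * t < 1" "t > cmod s"
      by (rule exists_right_less[of "\<lambda>t. \<tau>\<^sup>2 * t" "cmod s" 1]) (use s in \<open>auto intro!: tendsto_eq_intros\<close>)
    define U where "U = ball y e \<times> ball (0::complex) t"
    obtain M where M: "summable M" "\<And>p y' s. y' \<in> cball y e \<Longrightarrow> cmod s \<le> t \<Longrightarrow> norm (c p y' * s ^ p) \<le> M p"
      by (rule tame_geometric[OF c compact_cball e(2) t(1)]) blast
    have "uniform_limit U (\<lambda>n x. \<Sum>p<n. c p (fst x) * snd x ^ p) (\<lambda>x. \<Sum>p. c p (fst x) * snd x ^ p) sequentially"
      by (rule Weierstrass_m_test[OF _ M(1)]) (use M(2) in \<open>auto simp: U_def less_imp_le\<close>)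
    moreover have "continuous_on U (\<lambda>x. \<Sum>p<n. c p (fst x) * snd x ^ p)" for n
      by (intro continuous_intros continuous_on_compose2[OF tame_continuous[OF c]])
        (use e in \<open>auto simp: U_def\<close>)
    ultimately have "continuous_on U (\<lambda>x. \<Sum>p. c p (fst x) * snd x ^ p)"
      by (intro uniform_limit_theorem[where F=sequentially]) auto
    moreover have "open U" "(y,s) \<in> U" using e t by (auto simp: U_def open_Times)
    ultimately show "isCont (\<lambda>(y, s). Ser c y s) (y, s)"
      by (simp add: continuous_on_eq_continuous_at Ser_def case_prod_unfold)
  qed
qed

text \<open>The coefficients vanish off S, so only |s| on S matters. By compactness its maximum is
  attained, hence still strictly inside the disc of convergence, and one majorant serves all
  y.\<close>

lemma Ser_integral_sums:
  fixes V :: "'a::euclidean_space set"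
  assumes c: "tame \<tau> V c" and V: "open V" and S: "compact S" "S \<subseteq> V"
    and z: "\<And>p y. y \<notin> S \<Longrightarrow> c p y = 0"
    and s: "continuous_on V s" "\<And>y. y \<in> V \<Longrightarrow> \<tau>\<^sup>2 * cmod (s y) < 1"
  shows "(\<lambda>p. integral UNIV (\<lambda>y. c p y * s y ^ p)) sums integral UNIV (\<lambda>y. Ser c y (s y))"
    and "csupp S (\<lambda>y. Ser c y (s y))"
proof -
  have cs: "csupp S (\<lambda>y. c p y * s y ^ p)" for p
    by (rule csuppI[OF V compact_imp_closed[OF S(1)] S(2)])
      (use s(1) tame_continuous[OF c] z in \<open>auto intro!: continuous_intros\<close>)
  show csS: "csupp S (\<lambda>y. Ser c y (s y))"
  proof (rule csuppI[OF V compact_imp_closed[OF S(1)] S(2)])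
    show "continuous_on V (\<lambda>y. Ser c y (s y))"
      using continuous_on_compose2[OF Ser_continuous[OF c V], of V "\<lambda>y. (y, s y)"]
        continuous_on_Pair[OF continuous_on_id s(1)] s(2)
      by auto
  qed (simp add: Ser_def z)
  show "(\<lambda>p. integral UNIV (\<lambda>y. c p y * s y ^ p)) sums integral UNIV (\<lambda>y. Ser c y (s y))"
  proof (cases "S = {}")
    case True
    then show ?thesis using z by (simp add: Ser_def)
  next
    case False
    have "continuous_on S (\<lambda>y. cmod (s y))"
      using s S by (auto intro!: continuous_intros intro: continuous_on_subset)
    then obtain y0 where y0: "y0 \<in> S" "\<And>y. y \<in> S \<Longrightarrow> cmod (s y) \<le> cmod (s y0)"
      using continuous_attains_sup[OF S(1) False] by blast
    obtain M where M: "summable M" "\<And>p y w. y \<in> S \<Longrightarrow> cmod w \<le> cmod (s y0) \<Longrightarrow> norm (c p y * w ^ p) \<le> M p"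
      by (rule tame_geometric[OF c S s(2)]) (use y0(1) S(2) in auto)
    have M0: "M p \<ge> 0" for p using order_trans[OF norm_ge_zero M(2)[OF y0(1), of 0 p]] by simp
    have "norm (c p y * s y ^ p) \<le> M p" for p y
      using M(2)[of y "s y" p] y0(2)[of y] z[of y p] M0[of p] by (cases "y \<in> S") auto
    then show ?thesis unfolding Ser_def
      by (intro csupp_uniformly_summable(1)[OF cs S(1) _ M(1)])
  qed
qed

text \<open>The factorials cancel: (2p)! in the growth of the iterated Laplacians against the decay
  1/(2p)! of the coefficients.\<close>

lemma polyharmonic_tame:
  fixes f :: "real^'n::finite \<Rightarrow> complex"
  assumes G: "open G" and f: "polyharmonic_inf G \<tau> f" and \<tau>: "\<tau> \<ge> 0"
    and a: "subexp (\<lambda>p. a p * fact (2 * p))"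
  shows "tame \<tau> G (\<lambda>p y. of_real (a p) * (laplacian ^^ p) f y)"
proof (rule tameI)
  show "continuous_on G (\<lambda>y. of_real (a p) * (laplacian ^^ p) f y)" for p
    using smooth_on_continuous[OF smooth_on_laplacian_funpow[OF G]] f
    by (auto simp: polyharmonic_inf_def intro!: continuous_intros)
next
  fix S and \<rho> :: real assume A: "compact S" "S \<subseteq> G" "0 < \<rho>" "\<tau>\<^sup>2 * \<rho> < 1"
  obtain \<epsilon> where \<epsilon>: "(\<tau> + \<epsilon>)\<^sup>2 * \<rho> < 1" "\<epsilon> > 0"
    by (rule exists_right_less[of "\<lambda>\<epsilon>. (\<tau> + \<epsilon>)\<^sup>2 * \<rho>" 0 1]) (use A in \<open>auto intro!: tendsto_eq_intros\<close>)
  \<comment> \<open>The reciprocal of the rate left over from the type bound; it exceeds 1, and the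
    two exponentials cancel exactly.\<close>
  define \<theta> where "\<theta> = 1 / ((\<tau> + \<epsilon>)\<^sup>2 * \<rho>)"
  have pos: "(\<tau> + \<epsilon>)\<^sup>2 * \<rho> > 0" using \<epsilon> \<tau> A by (intro mult_pos_pos zero_less_power) auto
  have \<theta>: "\<theta> > 1" "\<theta> * ((\<tau> + \<epsilon>)\<^sup>2 * \<rho>) = 1"
    using pos \<epsilon>(1) less_imp_neq[OF pos, symmetric] unfolding \<theta>_def less_divide_eq_1_pos[OF pos]
    by (simp_all only: times_divide_eq_left mult_1 divide_self not_False_eq_True)
  obtain K where K: "K > 0" "\<And>p. \<bar>a p * fact (2 * p)\<bar> \<le> K * \<theta> ^ p"
    using a \<theta>(1) unfolding subexp_def by blast
  obtain C where C: "C > 0" "\<And>p x. x \<in> S \<Longrightarrow> norm ((laplacian ^^ p) f x) \<le> C * fact (2*p) * (\<tau> + \<epsilon>) ^ (2*p)"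
    using conjunct2[OF f[unfolded polyharmonic_inf_def], THEN spec, of S] A \<epsilon>(2) by auto
  have "norm (of_real (a p) * (laplacian ^^ p) f y) * \<rho> ^ p \<le> K * C" if "y \<in> S" for p y
  proof -
    have "norm (of_real (a p) * (laplacian ^^ p) f y) * \<rho> ^ p
        \<le> \<bar>a p\<bar> * (C * fact (2*p) * (\<tau> + \<epsilon>) ^ (2*p)) * \<rho> ^ p"
      unfolding norm_mult norm_of_real by (intro mult_right_mono mult_left_mono C(2)[OF that]) (use A in auto)
    also have "\<dots> = C * \<bar>a p * fact (2*p)\<bar> * ((\<tau> + \<epsilon>)\<^sup>2 * \<rho>) ^ p"
      by (simp add: abs_mult power_mult power_mult_distrib)
    also have "\<dots> \<le> C * (K * \<theta> ^ p) * ((\<tau> + \<epsilon>)\<^sup>2 * \<rho>) ^ p"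
      using K C pos by (intro mult_right_mono mult_left_mono) auto
    also have "\<dots> = K * C * (\<theta> * ((\<tau> + \<epsilon>)\<^sup>2 * \<rho>)) ^ p" unfolding power_mult_distrib[of \<theta>] by simp
    also have "\<dots> = K * C" by (simp only: \<theta>(2)) simp
    finally show ?thesis .
  qed
  then show "\<exists>M. \<forall>p. \<forall>y\<in>S. norm (of_real (a p) * (laplacian ^^ p) f y) * \<rho> ^ p \<le> M" by blast
qed

subsection \<open>Complex quadric geometry\<close>

text \<open>Bilinear rather than sesquilinear: \<open>qf\<close> is its quadratic form, and
  \<open>bil g\<close> is complex linear, so it can serve as the derivative with complex gradient
  g.\<close>

definition bil :: "complex^'n::finite \<Rightarrow> complex^'n \<Rightarrow> complex" where
  "bil z w = (\<Sum>i\<in>UNIV. z$i * w$i)"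

lemma bil_simps:
  "bil (u + v) w = bil u w + bil v w" "bil w (u + v) = bil w u + bil w v"
  "bil (u - v) w = bil u w - bil v w" "bil w (u - v) = bil w u - bil w v"
  "bil (c *s u) w = c * bil u w" "bil w (c *s u) = c * bil w u"
  by (simp_all add: bil_def sum.distrib sum_subtractf sum_distrib_left algebra_simps)

lemma bil_fun:
  "bil (u + v) = (\<lambda>w. bil u w + bil v w)" "bil (c *s u) = (\<lambda>w. c * bil u w)"
  by (simp_all add: bil_simps fun_eq_iff)

lemma bil_commute: "bil z w = bil w z"
  by (simp add: bil_def mult.commute)

lemma qf_bil: "qf z = bil z z"
  by (simp add: qf_def bil_def power2_eq_square)

lemma qf_scale: "qf (c *s z) = c\<^sup>2 * qf z"
  by (simp add: qf_bil bil_simps power2_eq_square)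

lemma bil_cembed: "bil (cembed x) (cembed y) = of_real (x \<bullet> y)"
  by (simp add: bil_def cembed_def inner_vec_def)

lemma qf_cembed: "qf (cembed x) = of_real ((norm x)\<^sup>2)"
  by (simp add: qf_bil bil_cembed power2_norm_eq_inner)

lemma cembed_diff: "cembed (x - y) = cembed x - cembed y"
  by (simp add: cembed_def vec_eq_iff)

lemma cembed_scaleR: "cembed (r *\<^sub>R x) = of_real r *s cembed x"
  by (simp add: cembed_def vec_eq_iff)

lemma continuous_on_cembed [continuous_intros]:
  "continuous_on A g \<Longrightarrow> continuous_on A (\<lambda>x. cembed (g x))"
  unfolding cembed_def by (intro continuous_intros)

lemma norm_sq_vec: "(norm (z :: complex^'n::finite))\<^sup>2 = (\<Sum>i\<in>UNIV. (cmod (z$i))\<^sup>2)"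
  by (simp add: norm_vec_def L2_set_def sum_nonneg)

lemma norm_sq_rvec: "(norm (x :: real^'n::finite))\<^sup>2 = (\<Sum>i\<in>UNIV. (x$i)\<^sup>2)"
  by (simp add: norm_vec_def L2_set_def sum_nonneg)

lemma norm_vscale: "norm (c *s z) = cmod c * norm (z :: complex^'n::finite)"
proof -
  have "(norm (c *s z))\<^sup>2 = (cmod c * norm z)\<^sup>2"
    by (simp add: norm_sq_vec norm_mult power_mult_distrib sum_distrib_left)
  then show ?thesis by (simp add: power2_eq_iff_nonneg)
qed

lemma norm_cembed: "norm (cembed x) = norm x"
proof -
  have "(norm (cembed x))\<^sup>2 = (norm x)\<^sup>2"
    by (simp add: norm_sq_vec norm_sq_rvec cembed_def)
  then show ?thesis by (simp add: power2_eq_iff_nonneg)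
qed

section \<open>Real and imaginary parts, and the radii \<open>Lplus\<close> and
  \<open>Lminus\<close>\<close>

definition rvec :: "complex^'n::finite \<Rightarrow> real^'n" where "rvec z = (\<chi> i. Re (z$i))"
definition ivec :: "complex^'n::finite \<Rightarrow> real^'n" where "ivec z = (\<chi> i. Im (z$i))"

lemma norm_sq_rvec_ivec: "(norm z)\<^sup>2 = (norm (rvec z))\<^sup>2 + (norm (ivec z))\<^sup>2"
  by (simp add: norm_sq_vec norm_sq_rvec rvec_def ivec_def cmod_power2 sum.distrib)

lemma Re_qf: "Re (qf z) = (norm (rvec z))\<^sup>2 - (norm (ivec z))\<^sup>2"
  by (simp add: qf_def rvec_def ivec_def norm_sq_rvec sum_subtractf Re_power2)

lemma Im_qf: "Im (qf z) = 2 * (rvec z \<bullet> ivec z)"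
  by (simp add: qf_def rvec_def ivec_def inner_vec_def power2_eq_square sum_distrib_left mult.commute)

text \<open>The expression under the inner root of \<open>Lplus\<close> and \<open>Lminus\<close> is
  four times the Gram determinant of Re z and Im z; Cauchy-Schwarz then makes it
  nonnegative.\<close>

lemma norm4_minus_qf:
  "(norm z)^4 - (cmod (qf z))\<^sup>2 = 4 * ((norm (rvec z))\<^sup>2 * (norm (ivec z))\<^sup>2 - (rvec z \<bullet> ivec z)\<^sup>2)"
proof -
  have "(norm z)^4 = ((norm (rvec z))\<^sup>2 + (norm (ivec z))\<^sup>2)\<^sup>2"
    by (simp flip: norm_sq_rvec_ivec)
  then show ?thesis
    unfolding cmod_power2 Re_qf Im_qf by (simp add: power2_eq_square algebra_simps)
qed

lemma gram_nonneg: "(x \<bullet> y)\<^sup>2 \<le> (norm x)\<^sup>2 * (norm (y :: 'a::real_inner))\<^sup>2"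
  using Cauchy_Schwarz_ineq2[of x y] by (metis abs_ge_zero power2_abs power_mono power_mult_distrib)

lemma disc_nonneg: "0 \<le> (norm z)^4 - (cmod (qf z))\<^sup>2"
  unfolding norm4_minus_qf using gram_nonneg[of "rvec z" "ivec z"] by simp

lemma disc_le: "sqrt ((norm z)^4 - (cmod (qf z))\<^sup>2) \<le> (norm z)\<^sup>2"
  by (rule real_le_lsqrt[OF _ _]; simp)

lemma Lplus_nonneg: "0 \<le> Lplus z"
  using disc_nonneg[of z] by (simp add: Lplus_def)

lemma Lminus_nonneg: "0 \<le> Lminus z"
  using disc_le[of z] by (simp add: Lminus_def)

lemma Lplus_sq: "(Lplus z)\<^sup>2 = (norm z)\<^sup>2 + sqrt ((norm z)^4 - (cmod (qf z))\<^sup>2)"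
  using disc_nonneg[of z] by (simp add: Lplus_def)

lemma Lminus_sq: "(Lminus z)\<^sup>2 = (norm z)\<^sup>2 - sqrt ((norm z)^4 - (cmod (qf z))\<^sup>2)"
  using disc_le[of z] by (simp add: Lminus_def)

lemma disc_scale: "(norm (c *s z))^4 - (cmod (qf (c *s z)))\<^sup>2
    = (cmod c)^4 * ((norm z)^4 - (cmod (qf z))\<^sup>2)"
  by (simp add: norm_vscale qf_scale norm_mult norm_power power_mult_distrib right_diff_distrib
      flip: power_mult)

lemma sqrt_disc_scale: "sqrt ((cmod c)^4 * X) = (cmod c)\<^sup>2 * sqrt X"
proof -
  have "(cmod c)^4 = ((cmod c)\<^sup>2)\<^sup>2" by simp
  then show ?thesis by (metis real_sqrt_abs2 real_sqrt_mult abs_power2 power2_eq_square)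
qed

lemma Lplus_scale: "Lplus (c *s z) = cmod c * Lplus z"
  unfolding Lplus_def disc_scale sqrt_disc_scale
  unfolding norm_vscale power_mult_distrib
    distrib_left[symmetric] real_sqrt_mult by simp

lemma Lminus_scale: "Lminus (c *s z) = cmod c * Lminus z"
  unfolding Lminus_def disc_scale sqrt_disc_scale
  unfolding norm_vscale power_mult_distrib
    right_diff_distrib[symmetric] real_sqrt_mult by simp

lemma Lplus_cembed: "Lplus (cembed x) = norm x"
  by (simp add: Lplus_def norm_cembed qf_cembed norm_power flip: power_mult)

lemma Lminus_cembed: "Lminus (cembed x) = norm x"
  by (simp add: Lminus_def norm_cembed qf_cembed norm_power flip: power_mult)

lemma continuous_on_qf [continuous_intros]:
  "continuous_on A g \<Longrightarrow> continuous_on A (\<lambda>x. qf (g x))"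
  unfolding qf_def by (intro continuous_intros)

lemma continuous_on_Lplus: "continuous_on UNIV Lplus"
  unfolding Lplus_def[abs_def] by (intro continuous_intros)

lemma continuous_on_Lminus: "continuous_on UNIV Lminus"
  unfolding Lminus_def[abs_def] by (intro continuous_intros)

text \<open>A real sphere centred at 0 meets the isotropic cone with vertex \<open>z\<close> only for radii
  between \<^term>\<open>Lminus z\<close> and \<^term>\<open>Lplus z\<close>.\<close>

lemma isotropic_real_radius:
  assumes "qf (z - cembed y) = 0"
  shows "Lminus z \<le> norm y" "norm y \<le> Lplus z"
proof -
  \<comment> \<open>With c = y - Re z, isotropy of z - y means that c has the length of Im z and is
    orthogonal to it.\<close>
  define a b c where "a = rvec z" and "b = ivec z" and "c = y - a"
  have rc: "rvec (z - cembed y) = - c" and ib: "ivec (z - cembed y) = b"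
    by (simp_all add: rvec_def ivec_def cembed_def c_def a_def b_def vec_eq_iff)
  have cb: "(norm c)\<^sup>2 = (norm b)\<^sup>2" using assms Re_qf[of "z - cembed y"] by (simp add: rc ib)
  have cb0: "c \<bullet> b = 0" using assms Im_qf[of "z - cembed y"] by (simp add: rc ib)
  define D where "D = (norm a)\<^sup>2 * (norm b)\<^sup>2 - (a \<bullet> b)\<^sup>2"
  have "(a \<bullet> c)\<^sup>2 \<le> D"
  proof (cases "b = 0")
    case True
    then have "c = 0" using cb by simp
    then show ?thesis using True by (simp add: D_def)
  next
    case False
    define n where "n = (norm b)\<^sup>2"
    have n: "n > 0" using False by (simp add: n_def)
    have bb: "b \<bullet> b = n" "c \<bullet> c = n" using cb by (simp_all add: n_def power2_norm_eq_inner)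
    \<comment> \<open>n times the component of a orthogonal to b. Since c is orthogonal to b, the
      inner product of u with c is n (a . c), and Cauchy-Schwarz for u and c is sharper than for a
      and c.\<close>
    define u where "u = n *\<^sub>R a - (a \<bullet> b) *\<^sub>R b"
    have uc: "u \<bullet> c = n * (a \<bullet> c)" using cb0 by (simp add: u_def inner_diff_left inner_commute[of b c])
    have "(norm u)\<^sup>2 = n * n * (a \<bullet> a) - n * (a \<bullet> b)\<^sup>2"
      unfolding power2_norm_eq_inner u_def using bb
      by (simp add: inner_diff_left inner_diff_right inner_commute[of b a] power2_eq_square)
        (simp add: algebra_simps)
    also have "\<dots> = n * D" by (simp add: D_def n_def power2_norm_eq_inner algebra_simps)
    finally have uu: "(norm u)\<^sup>2 = n * D" .
    have "(n * (a \<bullet> c))\<^sup>2 \<le> (n * D) * n"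
      using gram_nonneg[of u c] unfolding uc uu cb n_def .
    then have "(n * n) * (a \<bullet> c)\<^sup>2 \<le> (n * n) * D" by (simp add: power2_eq_square algebra_simps)
    then show ?thesis using n by simp
  qed
  then have ac: "\<bar>a \<bullet> c\<bar> \<le> sqrt D" by (metis real_sqrt_abs real_sqrt_le_mono)
  have "(norm y)\<^sup>2 = (norm a)\<^sup>2 + (norm b)\<^sup>2 + 2 * (a \<bullet> c)"
  proof -
    have "(norm y)\<^sup>2 = (a + c) \<bullet> (a + c)" by (simp add: c_def power2_norm_eq_inner)
    then show ?thesis using cb
      by (simp add: power2_norm_eq_inner inner_add_left inner_add_right inner_commute[of c a])
  qed
  then have y: "(norm y)\<^sup>2 = (norm z)\<^sup>2 + 2 * (a \<bullet> c)"
    by (simp add: norm_sq_rvec_ivec[of z] a_def b_def)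
  have "sqrt ((norm z)^4 - (cmod (qf z))\<^sup>2) = sqrt (2\<^sup>2 * D)"
    unfolding norm4_minus_qf D_def a_def b_def by simp
  then have d: "sqrt ((norm z)^4 - (cmod (qf z))\<^sup>2) = 2 * sqrt D" by (simp add: real_sqrt_mult)
  have "(Lminus z)\<^sup>2 \<le> (norm y)\<^sup>2" "(norm y)\<^sup>2 \<le> (Lplus z)\<^sup>2"
    unfolding Lminus_sq Lplus_sq y d using ac by linarith+
  then show "Lminus z \<le> norm y" "norm y \<le> Lplus z"
    using Lplus_nonneg[of z] by (auto intro: power2_le_imp_le)
qed

text \<open>On the complex line spanned by the unit vector u of y, q(z - r u) is a monic quadratic
  in r, and r = 0 shows that the product of its roots is q(z). A nonzero root can be rotated to the
  positive axis by a unimodular factor, which changes neither \<open>Lplus\<close> nor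
  \<open>Lminus\<close>, so the bound for real radii applies to its modulus.\<close>

lemma qf_sphere_factor:
  fixes y :: "real^'n::finite"
  assumes "y \<noteq> 0"
  obtains \<alpha> \<beta> where "qf (z - cembed y) = (of_real (norm y) - \<alpha>) * (of_real (norm y) - \<beta>)" "qf z = \<alpha> * \<beta>"
    "Lminus z \<le> cmod \<alpha>" "cmod \<alpha> \<le> Lplus z" "Lminus z \<le> cmod \<beta>" "cmod \<beta> \<le> Lplus z"
proof -
  define u where "u = (1 / norm y) *\<^sub>R y"
  have u: "norm u = 1" using assms by (simp add: u_def)
  have y: "cembed y = of_real (norm y) *s cembed u" using assms by (simp add: u_def flip: cembed_scaleR)
  define t where "t = bil z (cembed u)"
  define w where "w = csqrt (t\<^sup>2 - qf z)"
  have w: "w\<^sup>2 = t\<^sup>2 - qf z" by (simp add: w_def)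
  have f: "qf (z - r *s cembed u) = (r - (t + w)) * (r - (t - w))" for r
  proof -
    have "qf (z - r *s cembed u) = qf z - 2 * r * t + r\<^sup>2"
      using u by (simp add: qf_bil bil_simps bil_commute[of "cembed u" z] bil_cembed t_def
          power2_eq_square algebra_simps norm_eq_1)
    then show ?thesis using w by (simp add: power2_eq_square algebra_simps)
  qed
  have q: "qf z = (t + w) * (t - w)" using f[of 0] by (simp add: algebra_simps)
  have root: "Lminus z \<le> cmod \<gamma> \<and> cmod \<gamma> \<le> Lplus z" if r: "qf (z - \<gamma> *s cembed u) = 0" for \<gamma>
  proof (cases "\<gamma> = 0")
    case True
    then have "qf (z - cembed 0) = 0" using r by (simp add: cembed_def zero_vec_def[symmetric])
    from isotropic_real_radius[OF this] show ?thesis using True by simp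
  next
    case False
    define e where "e = of_real (cmod \<gamma>) / \<gamma>"
    have e: "cmod e = 1" "e * \<gamma> = of_real (cmod \<gamma>)" using False by (simp_all add: e_def norm_divide)
    have "e *s z - cembed (cmod \<gamma> *\<^sub>R u) = e *s (z - \<gamma> *s cembed u)"
      by (simp add: cembed_scaleR vec_eq_iff algebra_simps flip: e(2))
    then have "qf (e *s z - cembed (cmod \<gamma> *\<^sub>R u)) = 0" by (simp only: qf_scale r mult_zero_right)
    from isotropic_real_radius[OF this] show ?thesis
      using e(1) u by (simp add: Lplus_scale Lminus_scale)
  qed
  show ?thesis
    by (rule that[of "t + w" "t - w"]) (use f[of "of_real (norm y)"] q f root y in auto)
qed

text \<open>Both arguments have modulus below pi/2, so their sum stays strictly between -pi and
  pi.\<close>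

lemma mult_right_half_plane:
  assumes "Re a > 0" "Re b > 0"
  shows "a * b \<notin> \<real>\<^sub>\<le>\<^sub>0"
proof
  assume "a * b \<in> \<real>\<^sub>\<le>\<^sub>0"
  then have le: "Re a * Re b - Im a * Im b \<le> 0" and eq: "Re a * Im b = - (Im a * Re b)"
    by (auto simp: complex_nonpos_Reals_iff)
  have "Re a * (Re a * Re b - Im a * Im b) = Re b * ((Re a)\<^sup>2 + (Im a)\<^sup>2)"
    using eq by (simp add: power2_eq_square algebra_simps)
  moreover have "Re b * ((Re a)\<^sup>2 + (Im a)\<^sup>2) > 0" using assms by (simp add: add_pos_nonneg)
  ultimately show False using le assms(1) by (metis less_eq_real_def mult_nonneg_nonpos not_less)
qed

lemma Re_one_minus_pos: "cmod c < 1 \<Longrightarrow> Re (1 - c) > 0"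
  using abs_Re_le_cmod[of c] by simp

text \<open>Both roots have modulus at most \<open>Lplus z\<close>, so beyond that radius both
  linear factors lie in the right half plane.\<close>

lemma qf_outer:
  assumes "Lplus z < norm y"
  shows "qf (z - cembed y) \<notin> \<real>\<^sub>\<le>\<^sub>0"
proof -
  define r where "r = norm y"
  have r: "r > 0" using assms Lplus_nonneg[of z] unfolding r_def by linarith
  then have y: "y \<noteq> 0" by (auto simp: r_def)
  obtain \<alpha> \<beta> where ab: "qf (z - cembed y) = (of_real r - \<alpha>) * (of_real r - \<beta>)"
    "cmod \<alpha> \<le> Lplus z" "cmod \<beta> \<le> Lplus z" by (rule qf_sphere_factor[of y z]) (use y in \<open>auto simp: r_def\<close>)
  have half: "Re (of_real r - c) > 0" if "cmod c \<le> Lplus z" for c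
    using that assms abs_Re_le_cmod[of c] by (simp add: r_def)
  show ?thesis unfolding ab(1) by (rule mult_right_half_plane; rule half; fact)
qed

text \<open>Here the roots exceed \<open>norm y\<close> in modulus. Dividing by q(z), the product of
  the roots, turns the factors into 1 - r/\<alpha> and 1 - r/\<beta>, which lie in the right half
  plane; q(z - y) itself need not avoid the negative axis.\<close>

lemma qf_inner:
  assumes "norm y < Lminus z" "y \<noteq> 0"
  shows "qf z \<noteq> 0" "qf (z - cembed y) / qf z \<notin> \<real>\<^sub>\<le>\<^sub>0"
proof -
  define r where "r = norm y"
  have r: "r > 0" using assms by (simp add: r_def)
  obtain \<alpha> \<beta> where ab: "qf (z - cembed y) = (of_real r - \<alpha>) * (of_real r - \<beta>)" and q: "qf z = \<alpha> * \<beta>"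
    and L: "Lminus z \<le> cmod \<alpha>" "Lminus z \<le> cmod \<beta>"
    by (rule qf_sphere_factor[of y z]) (use assms in \<open>auto simp: r_def\<close>)
  have gt: "cmod \<alpha> > r" "cmod \<beta> > r" using L assms(1) by (simp_all add: r_def)
  then have nz: "\<alpha> \<noteq> 0" "\<beta> \<noteq> 0" using r by auto
  show "qf z \<noteq> 0" using q nz by simp
  have "qf (z - cembed y) / qf z = (1 - of_real r / \<alpha>) * (1 - of_real r / \<beta>)"
    unfolding ab q using nz by (simp add: field_simps)
  moreover have "Re (1 - of_real r / \<gamma>) > 0" if "cmod \<gamma> > r" for \<gamma>
    by (rule Re_one_minus_pos) (use that r in \<open>auto simp: norm_divide divide_simps\<close>)
  ultimately show "qf (z - cembed y) / qf z \<notin> \<real>\<^sub>\<le>\<^sub>0"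
    using mult_right_half_plane gt by metis
qed

lemma qf_diff_bound:
  assumes "y \<noteq> 0"
  shows "cmod (qf (z - cembed y)) \<le> (norm y + Lplus z)\<^sup>2"
proof -
  define r where "r = norm y"
  have r: "r > 0" using assms by (simp add: r_def)
  obtain \<alpha> \<beta> where ab: "qf (z - cembed y) = (of_real r - \<alpha>) * (of_real r - \<beta>)"
    "cmod \<alpha> \<le> Lplus z" "cmod \<beta> \<le> Lplus z" by (rule qf_sphere_factor[of y z]) (use assms in \<open>auto simp: r_def\<close>)
  have b: "cmod (of_real r - c) \<le> r + Lplus z" if "cmod c \<le> Lplus z" for c
    using norm_triangle_ineq4[of "of_real r" c] that r by simp
  show ?thesis unfolding ab(1) norm_mult power2_eq_square r_def[symmetric]
    using b[OF ab(2)] b[OF ab(3)] r Lplus_nonneg[of z] by (intro mult_mono) auto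
qed

subsection \<open>Kernels depending holomorphically on a parameter\<close>

text \<open>Joint continuity of the complex gradient g is what differentiation under the integral
  uses, and it survives the products and compositions below. Writing the derivative as
  \<open>bil\<close> of g builds in complex linearity.\<close>

definition jholo :: "((complex^'n::finite) \<times> 'b::topological_space) set \<Rightarrow> (complex^'n \<Rightarrow> 'b \<Rightarrow> complex) \<Rightarrow> bool" where
  "jholo W K \<longleftrightarrow> continuous_on W (\<lambda>p. K (fst p) (snd p)) \<and>
     (\<exists>g. continuous_on W (\<lambda>p. g (fst p) (snd p)) \<and>
       (\<forall>p\<in>W. ((\<lambda>z. K z (snd p)) has_derivative bil (g (fst p) (snd p))) (at (fst p))))"

lemma jholoI:
  assumes "continuous_on W (\<lambda>p. K (fst p) (snd p))" "continuous_on W (\<lambda>p. g (fst p) (snd p))"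
    "\<And>z y. (z, y) \<in> W \<Longrightarrow> ((\<lambda>z. K z y) has_derivative bil (g z y)) (at z)"
  shows "jholo W K"
  using assms unfolding jholo_def by (intro conjI exI[of _ g]) auto

lemma jholoE:
  assumes "jholo W K"
  obtains g where "continuous_on W (\<lambda>p. K (fst p) (snd p))" "continuous_on W (\<lambda>p. g (fst p) (snd p))"
    "\<And>z y. (z, y) \<in> W \<Longrightarrow> ((\<lambda>z. K z y) has_derivative bil (g z y)) (at z)"
proof -
  obtain g where "continuous_on W (\<lambda>p. g (fst p) (snd p))"
    "\<forall>p\<in>W. ((\<lambda>z. K z (snd p)) has_derivative bil (g (fst p) (snd p))) (at (fst p))"
    using conjunct2[OF assms[unfolded jholo_def]] by (elim exE conjE)
  then show ?thesis
    using conjunct1[OF assms[unfolded jholo_def]] by (intro that[of g]) force+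
qed

lemma continuous_on_vscale [continuous_intros]:
  fixes v :: "'a::topological_space \<Rightarrow> complex^'n::finite"
  shows "continuous_on A c \<Longrightarrow> continuous_on A v \<Longrightarrow> continuous_on A (\<lambda>x. c x *s v x)"
  unfolding vector_scalar_mult_def by (intro continuous_intros)

lemma jholo_fun:
  assumes "continuous_on (snd ` W) e"
  shows "jholo W (\<lambda>z y. e y)"
proof (rule jholoI[where g="\<lambda>_ _. 0"])
  show "continuous_on W (\<lambda>p. e (snd p))"
    by (rule continuous_on_compose2[OF assms]) (auto intro: continuous_intros)
qed (auto simp: bil_def[abs_def])

lemma jholo_const: "jholo W (\<lambda>z y. c)"
  by (rule jholo_fun) auto

lemma jholo_coord:
  fixes W :: "((complex^'n::finite) \<times> 'b::topological_space) set"
  shows "jholo W (\<lambda>z y. z $ i)"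
proof (rule jholoI[where g="\<lambda>_ _. axis i 1"])
  have "bil (axis i 1) = (\<lambda>w :: complex^'n. w $ i)" by (simp add: bil_def fun_eq_iff axis_def if_distrib if_distribR cong: if_cong)
  then show "((\<lambda>z. z $ i) has_derivative bil (axis i 1)) (at z)" for z :: "complex^'n"
    by (simp add: bounded_linear_imp_has_derivative bounded_linear_vec_nth)
qed (intro continuous_intros)+

lemma jholo_add:
  assumes "jholo W K" "jholo W L"
  shows "jholo W (\<lambda>z y. K z y + L z y)"
proof -
  obtain g where g: "continuous_on W (\<lambda>p. K (fst p) (snd p))" "continuous_on W (\<lambda>p. g (fst p) (snd p))"
    "\<And>z y. (z, y) \<in> W \<Longrightarrow> ((\<lambda>z. K z y) has_derivative bil (g z y)) (at z)" by (rule jholoE[OF assms(1)]) blast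
  obtain h where h: "continuous_on W (\<lambda>p. L (fst p) (snd p))" "continuous_on W (\<lambda>p. h (fst p) (snd p))"
    "\<And>z y. (z, y) \<in> W \<Longrightarrow> ((\<lambda>z. L z y) has_derivative bil (h z y)) (at z)" by (rule jholoE[OF assms(2)]) blast
  show ?thesis
  proof (rule jholoI[where g="\<lambda>z y. g z y + h z y"])
    fix z y assume "(z, y) \<in> W"
    from has_derivative_add[OF g(3)[OF this] h(3)[OF this]]
    show "((\<lambda>z. K z y + L z y) has_derivative bil (g z y + h z y)) (at z)"
      by (simp add: bil_fun)
  qed (intro continuous_intros g h)+
qed

lemma jholo_mult:
  assumes "jholo W K" "jholo W L"
  shows "jholo W (\<lambda>z y. K z y * L z y)"
proof -
  obtain g where g: "continuous_on W (\<lambda>p. K (fst p) (snd p))" "continuous_on W (\<lambda>p. g (fst p) (snd p))"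
    "\<And>z y. (z, y) \<in> W \<Longrightarrow> ((\<lambda>z. K z y) has_derivative bil (g z y)) (at z)" by (rule jholoE[OF assms(1)]) blast
  obtain h where h: "continuous_on W (\<lambda>p. L (fst p) (snd p))" "continuous_on W (\<lambda>p. h (fst p) (snd p))"
    "\<And>z y. (z, y) \<in> W \<Longrightarrow> ((\<lambda>z. L z y) has_derivative bil (h z y)) (at z)" by (rule jholoE[OF assms(2)]) blast
  show ?thesis
  proof (rule jholoI[where g="\<lambda>z y. K z y *s h z y + L z y *s g z y"])
    fix z y assume "(z, y) \<in> W"
    from has_derivative_mult[OF g(3)[OF this] h(3)[OF this]]
    have "((\<lambda>z. K z y * L z y) has_derivative (\<lambda>w. K z y * bil (h z y) w + bil (g z y) w * L z y)) (at z)" .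
    moreover have "(\<lambda>w. K z y * bil (h z y) w + bil (g z y) w * L z y) = bil (K z y *s h z y + L z y *s g z y)"
      by (simp add: bil_simps fun_eq_iff mult.commute)
    ultimately show "((\<lambda>z. K z y * L z y) has_derivative bil (K z y *s h z y + L z y *s g z y)) (at z)"
      by simp
  qed (intro continuous_intros g h)+
qed

lemma jholo_diff:
  assumes "jholo W K" "jholo W L"
  shows "jholo W (\<lambda>z y. K z y - L z y)"
  using jholo_add[OF assms(1) jholo_mult[OF jholo_const[of W "-1"] assms(2)]] by simp

lemma jholo_sum: "(\<And>i. i \<in> I \<Longrightarrow> jholo W (K i)) \<Longrightarrow> jholo W (\<lambda>z y. \<Sum>i\<in>I. K i z y)"
  by (induction I rule: infinite_finite_induct) (auto intro: jholo_const jholo_add)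

text \<open>\<phi> may depend on y too, as for power series with coefficients varying in y; T is the
  region of pairs (y, s) on which \<phi> and its derivative in s are continuous.\<close>

lemma jholo_compose:
  assumes K: "jholo W K"
    and \<phi>: "continuous_on T (\<lambda>(y, s). \<phi> y s)" "continuous_on T (\<lambda>(y, s). \<phi>' y s)"
    and d: "\<And>z y. (z, y) \<in> W \<Longrightarrow> (\<phi> y has_field_derivative \<phi>' y (K z y)) (at (K z y))"
    and T: "\<And>z y. (z, y) \<in> W \<Longrightarrow> (y, K z y) \<in> T"
  shows "jholo W (\<lambda>z y. \<phi> y (K z y))"
proof -
  obtain g where g: "continuous_on W (\<lambda>p. K (fst p) (snd p))" "continuous_on W (\<lambda>p. g (fst p) (snd p))"
    "\<And>z y. (z, y) \<in> W \<Longrightarrow> ((\<lambda>z. K z y) has_derivative bil (g z y)) (at z)" by (rule jholoE[OF K]) blast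
  have c: "continuous_on W (\<lambda>p. (snd p, K (fst p) (snd p)))" by (intro continuous_intros g)
  have c1: "continuous_on W (\<lambda>p. \<phi> (snd p) (K (fst p) (snd p)))"
    using continuous_on_compose2[OF \<phi>(1) c] T by force
  have c2: "continuous_on W (\<lambda>p. \<phi>' (snd p) (K (fst p) (snd p)))"
    using continuous_on_compose2[OF \<phi>(2) c] T by force
  show ?thesis
  proof (rule jholoI[where g="\<lambda>z y. \<phi>' y (K z y) *s g z y"])
    fix z y assume zy: "(z, y) \<in> W"
    have "((\<lambda>z. \<phi> y (K z y)) has_derivative (\<lambda>w. \<phi>' y (K z y) * bil (g z y) w)) (at z)"
      by (rule has_derivative_compose[OF g(3)[OF zy] d[OF zy, unfolded has_field_derivative_def]])
    then show "((\<lambda>z. \<phi> y (K z y)) has_derivative bil (\<phi>' y (K z y) *s g z y)) (at z)"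
      by (simp add: bil_fun)
  qed (intro continuous_intros c1 c2 g)+
qed

lemma jholo_inverse:
  assumes "jholo W K" "\<And>z y. (z, y) \<in> W \<Longrightarrow> K z y \<noteq> 0"
  shows "jholo W (\<lambda>z y. inverse (K z y))"
  by (rule jholo_compose[OF assms(1), where T="UNIV \<times> -{0}" and \<phi>'="\<lambda>_ s. - (inverse s ^ 2)"])
    (use assms(2) in \<open>auto simp: case_prod_unfold power2_eq_square intro!: continuous_intros derivative_eq_intros\<close>)

lemma jholo_Ln:
  assumes "jholo W K" "\<And>z y. (z, y) \<in> W \<Longrightarrow> K z y \<notin> \<real>\<^sub>\<le>\<^sub>0"
  shows "jholo W (\<lambda>z y. Ln (K z y))"
proof (rule jholo_compose[OF assms(1), where T="UNIV \<times> -\<real>\<^sub>\<le>\<^sub>0" and \<phi>'="\<lambda>_ s. inverse s"])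
  show "continuous_on (UNIV \<times> - \<real>\<^sub>\<le>\<^sub>0) (\<lambda>(y, s). Ln s)"
    "continuous_on (UNIV \<times> - \<real>\<^sub>\<le>\<^sub>0) (\<lambda>(y, s). inverse s :: complex)"
    unfolding case_prod_unfold
    by (intro continuous_on_Ln continuous_intros; auto)+
qed (use assms(2) in \<open>auto intro!: has_field_derivative_Ln\<close>)

lemma jholo_power: "jholo W K \<Longrightarrow> jholo W (\<lambda>z y. K z y ^ k)"
  by (induction k) (auto intro: jholo_const jholo_mult)

lemma jholo_Ser:
  assumes K: "jholo W K" and c: "tame \<tau> V c" "open V"
    and W: "\<And>z y. (z, y) \<in> W \<Longrightarrow> y \<in> V \<and> \<tau>\<^sup>2 * cmod (K z y) < 1"
  shows "jholo W (\<lambda>z y. Ser c y (K z y))"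
  by (rule jholo_compose[OF K Ser_continuous[OF c] Ser_continuous[OF tame_diffT[OF c(1)] c(2)]])
    (use W in \<open>auto intro!: Ser_DERIV[OF c(1)]\<close>)

text \<open>\<open>bil v\<close> as a bounded linear map, the form in which the Leibniz rule
  integrates derivatives.\<close>

definition bilL :: "complex^'n::finite \<Rightarrow> (complex^'n) \<Rightarrow>\<^sub>L complex" where
  "bilL v = (\<Sum>i\<in>UNIV. blinfun_mult_right (v$i) o\<^sub>L Blinfun (\<lambda>w. w$i))"

lemma bilL_apply: "blinfun_apply (bilL v) w = bil v w"
  by (simp add: bilL_def bil_def blinfun.sum_left bounded_linear_Blinfun_apply bounded_linear_vec_nth)

lemma continuous_on_bilL: "continuous_on A v \<Longrightarrow> continuous_on A (\<lambda>x. bilL (v x))"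
  unfolding bilL_def
  by (intro continuous_intros bounded_linear.continuous_on[OF bounded_linear_blinfun_mult_right])

lemma jholo_integral:
  fixes K :: "complex^'n::finite \<Rightarrow> real^'n \<Rightarrow> complex"
  assumes U: "open U" and V: "open V" and S: "compact S" "S \<subseteq> V"
    and K: "jholo (U \<times> V) K" and w: "csupp S w"
  shows "holo_on U (\<lambda>z. integral UNIV (\<lambda>y. w y * K z y))"
  unfolding holo_on_def
proof
  fix z0 assume z0: "z0 \<in> U"
  obtain g where g: "continuous_on (U \<times> V) (\<lambda>p. K (fst p) (snd p))" "continuous_on (U \<times> V) (\<lambda>p. g (fst p) (snd p))"
    "\<And>z y. (z, y) \<in> U \<times> V \<Longrightarrow> ((\<lambda>z. K z y) has_derivative bil (g z y)) (at z)" by (rule jholoE[OF K]) blast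
  obtain e where e: "e > 0" "ball z0 e \<subseteq> U" using U z0 open_contains_ball by blast
  obtain a where a: "S \<subseteq> cbox (-a) a" using compact_subset_cbox[OF S(1)] by blast
  \<comment> \<open>K and its gradient are controlled only for y in V. The factor w vanishes off S
    and makes the integrands continuous in all y, so that a box can be used as domain.\<close>
  have glue: "continuous_on (U \<times> UNIV) (\<lambda>p. w (snd p) *s k (fst p) (snd p))"
    if "continuous_on (U \<times> V) (\<lambda>p. k (fst p) (snd p))" for k :: "complex^'n \<Rightarrow> real^'n \<Rightarrow> complex^'n"
  proof -
    have "continuous_on (U \<times> V) (\<lambda>p. w (snd p) *s k (fst p) (snd p))"
      by (intro continuous_intros that csupp_continuous_compose[OF w])
    moreover have "continuous_on (U \<times> (-S)) (\<lambda>p. w (snd p) *s k (fst p) (snd p))"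
      by (subst continuous_on_cong[OF refl, where g="\<lambda>_. 0"]) (use w in \<open>auto simp: csupp_def\<close>)
    ultimately have "continuous_on (U \<times> V \<union> U \<times> (-S)) (\<lambda>p. w (snd p) *s k (fst p) (snd p))"
      using S(1) by (intro continuous_on_open_Un open_Times U V) (auto intro: compact_imp_closed)
    moreover have "U \<times> V \<union> U \<times> (-S) = U \<times> UNIV" using S(2) by auto
    ultimately show ?thesis by simp
  qed
  have cs: "csupp S (\<lambda>y. w y * K z y)" if "z \<in> U" for z
  proof (rule csuppI[OF V compact_imp_closed[OF S(1)] S(2)])
    have "continuous_on V (\<lambda>y. K z y)"
      using continuous_on_compose2[OF g(1), of V "\<lambda>y. (z, y)"] that
        continuous_on_Pair[OF continuous_on_const continuous_on_id, of V z] by auto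
    then show "continuous_on V (\<lambda>y. w y * K z y)"
      by (intro continuous_intros csupp_continuous_compose[OF w])
  qed (use w in \<open>auto simp: csupp_def\<close>)
  define D where "D = integral (cbox (-a) a) (\<lambda>y. bilL (w y *s g z0 y))"
  have contD: "continuous_on (U \<times> UNIV) (\<lambda>p. bilL (w (snd p) *s g (fst p) (snd p)))"
    by (intro continuous_on_bilL glue g)
  have "((\<lambda>z. integral (cbox (-a) a) (\<lambda>y. w y * K z y)) has_derivative D) (at z0 within ball z0 e)"
    unfolding D_def
  proof (rule leibniz_rule)
    fix z y assume z: "z \<in> ball z0 e"
    then have zU: "z \<in> U" using e by auto
    show "((\<lambda>z. w y * K z y) has_derivative blinfun_apply (bilL (w y *s g z y))) (at z within ball z0 e)"
    proof (cases "y \<in> V")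
      case True
      have "((\<lambda>z. w y * K z y) has_derivative (\<lambda>v. w y * bil (g z y) v)) (at z)"
        using g(3)[of z y] zU True by (intro has_derivative_mult_right) auto
      moreover have "(\<lambda>v. w y * bil (g z y) v) = blinfun_apply (bilL (w y *s g z y))"
        by (simp add: fun_eq_iff bilL_apply bil_simps)
      ultimately show ?thesis by (simp add: has_derivative_at_withinI)
    next
      case False
      then have "w y = 0" using w S by (auto simp: csupp_def)
      moreover have "blinfun_apply (bilL (0 *s g z y)) = (\<lambda>_. 0)"
        by (simp only: fun_eq_iff bilL_apply bil_simps mult_zero_left simp_thms)
      ultimately show ?thesis by simp
    qed
    show "(\<lambda>y. w y * K z y) integrable_on cbox (-a) a"
      by (rule csupp_integrable_cbox[OF cs[OF zU]])
  next
    show "continuous_on (ball z0 e \<times> cbox (-a) a) (\<lambda>(z, y). bilL (w y *s g z y))"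
      unfolding case_prod_unfold by (rule continuous_on_subset[OF contD]) (use e in auto)
  qed (use e in auto)
  then have "((\<lambda>z. integral (cbox (-a) a) (\<lambda>y. w y * K z y)) has_derivative D) (at z0)"
    using e(1) by (simp add: at_within_open[OF _ open_ball])
  then have "((\<lambda>z. integral UNIV (\<lambda>y. w y * K z y)) has_derivative D) (at z0)"
    by (rule has_derivative_transform_within_open[OF _ U z0])
      (use csupp_cbox_integral[OF cs a] in simp)
  moreover have "D (c *s v) = c * D v" for c v
  proof -
    have i: "(\<lambda>y. bilL (w y *s g z0 y)) integrable_on cbox (-a) a"
      by (intro integrable_continuous continuous_on_compose2[OF contD, of _ "\<lambda>y. (z0, y)", simplified])
        (use z0 in \<open>auto intro!: continuous_intros\<close>)
    have "D v = integral (cbox (-a) a) (\<lambda>y. bil (w y *s g z0 y) v)" for v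
      unfolding D_def using blinfun_apply_integral[OF i, of v] by (simp add: bilL_apply)
    moreover have "bil (w y *s g z0 y) (c *s v) = c * bil (w y *s g z0 y) v" for y
      by (rule bil_simps)
    ultimately show ?thesis by simp
  qed
  ultimately show "\<exists>D. ((\<lambda>z. integral UNIV (\<lambda>y. w y * K z y)) has_derivative D) (at z0) \<and> (\<forall>c w. D (c *s w) = c * D w)"
    by blast
qed

subsection \<open>Radial cutoff functions\<close>

definition C2_fun :: "(real \<Rightarrow> real) \<Rightarrow> (real \<Rightarrow> real) \<Rightarrow> (real \<Rightarrow> real) \<Rightarrow> bool" where
  "C2_fun u0 u1 u2 \<longleftrightarrow> (\<forall>t. (u0 has_real_derivative u1 t) (at t)) \<and>
     (\<forall>t. (u1 has_real_derivative u2 t) (at t)) \<and> continuous_on UNIV u2"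

lemma C2_fun_const: "C2_fun (\<lambda>_. c) (\<lambda>_. 0) (\<lambda>_. 0)"
  by (auto simp: C2_fun_def)

lemma C2_fun_diff:
  assumes "C2_fun u0 u1 u2" "C2_fun v0 v1 v2"
  shows "C2_fun (\<lambda>t. u0 t - v0 t) (\<lambda>t. u1 t - v1 t) (\<lambda>t. u2 t - v2 t)"
  using assms unfolding C2_fun_def by (auto intro!: derivative_intros continuous_intros)

lemma C2_fun_continuous:
  assumes "C2_fun u0 u1 u2"
  shows "continuous_on UNIV u0" "continuous_on UNIV u1" "continuous_on UNIV u2"
  using assms unfolding C2_fun_def
  by (auto intro!: continuous_at_imp_continuous_on DERIV_isCont)

text \<open>Later evaluated at the squared radius. Two continuous derivatives are as many as Green's
  identity takes of a cutoff; the bounds 0 and 1 will make the bump in the approximate identity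
  nonnegative.\<close>

definition C2_step :: "real \<Rightarrow> real \<Rightarrow> (real \<Rightarrow> real) \<Rightarrow> (real \<Rightarrow> real) \<Rightarrow> (real \<Rightarrow> real) \<Rightarrow> bool" where
  "C2_step \<alpha> \<beta> u0 u1 u2 \<longleftrightarrow> C2_fun u0 u1 u2 \<and>
     (\<forall>t\<le>\<alpha>. u0 t = 0 \<and> u1 t = 0 \<and> u2 t = 0) \<and> (\<forall>t\<ge>\<beta>. u0 t = 1 \<and> u1 t = 0 \<and> u2 t = 0) \<and>
     (\<forall>t. 0 \<le> u0 t \<and> u0 t \<le> 1)"

lemma DERIV_max_0_power:
  "((\<lambda>v::real. max 0 v ^ Suc (Suc n)) has_real_derivative real (n + 2) * max 0 v ^ Suc n) (at v)"
proof (cases v "0::real" rule: linorder_cases)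
  case less
  have "((\<lambda>v::real. 0) has_real_derivative real (n + 2) * max 0 v ^ Suc n) (at v)" using less by simp
  then show ?thesis
    by (rule has_field_derivative_transform_within_open[of _ _ _ "{..<0}"]) (use less in auto)
next
  case greater
  have "((\<lambda>v::real. v ^ Suc (Suc n)) has_real_derivative real (n + 2) * max 0 v ^ Suc n) (at v)"
    using greater DERIV_pow[of "Suc (Suc n)" v] by simp
  then show ?thesis
    by (rule has_field_derivative_transform_within_open[of _ _ _ "{0<..}"]) (use greater in auto)
next
  case equal
  have "((\<lambda>h::real. max 0 h ^ Suc (Suc n) / h) \<longlongrightarrow> 0) (at 0)"
  proof (rule Lim_null_comparison)
    show "\<forall>\<^sub>F h::real in at 0. norm (max 0 h ^ Suc (Suc n) / h) \<le> \<bar>h\<bar> ^ Suc n"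
      by (rule always_eventually) (auto simp: max_def intro: mult_nonpos_nonneg)
    show "((\<lambda>h::real. \<bar>h\<bar> ^ Suc n) \<longlongrightarrow> 0) (at 0)" by (auto intro!: tendsto_eq_intros)
  qed
  then show ?thesis using equal by (simp add: DERIV_def)
qed

lemma C2_step_exists:
  assumes "\<alpha> < \<beta>"
  obtains u0 u1 u2 where "C2_step \<alpha> \<beta> u0 u1 u2"
proof -
  define p q where "p t = max 0 (t - \<alpha>)" and "q t = max 0 (\<beta> - t)" for t
  \<comment> \<open>The step is a0 / (a0 + b0) with truncated cubes; 3 is the least integer power
    whose truncation has two continuous derivatives.\<close>
  define a0 a1 a2 where "a0 t = p t ^ 3" and "a1 t = 3 * p t ^ 2" and "a2 t = 6 * p t" for t
  define b0 b1 b2 where "b0 t = q t ^ 3" and "b1 t = - 3 * q t ^ 2" and "b2 t = 6 * q t" for t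
  have p: "((\<lambda>t. p t ^ Suc (Suc n)) has_real_derivative real (n + 2) * p t ^ Suc n) (at t)" for n t
    unfolding p_def
    by (rule DERIV_cong[OF DERIV_chain2[OF DERIV_max_0_power]]) (auto intro!: derivative_eq_intros)
  have q: "((\<lambda>t. q t ^ Suc (Suc n)) has_real_derivative - real (n + 2) * q t ^ Suc n) (at t)" for n t
    unfolding q_def
    by (rule DERIV_cong[OF DERIV_chain2[OF DERIV_max_0_power, where Db="-1"]]) (auto intro!: derivative_eq_intros simp: algebra_simps)
  have d: "(a0 has_real_derivative a1 t) (at t)" "(a1 has_real_derivative a2 t) (at t)"
    "(b0 has_real_derivative b1 t) (at t)" "(b1 has_real_derivative b2 t) (at t)" for t
    using p[of 1 t] DERIV_cmult[OF p[of 0 t], of 3] q[of 1 t] DERIV_cmult[OF q[of 0 t], of "-3"]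
    by (simp_all add: a0_def[abs_def] a1_def[abs_def] a2_def b0_def[abs_def] b1_def[abs_def] b2_def numeral_3_eq_3 numeral_2_eq_2)
  have "p t > 0 \<or> q t > 0" "p t \<ge> 0" "q t \<ge> 0" for t using assms by (auto simp: p_def q_def max_def)
  then have N: "a0 t + b0 t > 0" "a0 t \<ge> 0" "b0 t \<ge> 0" for t
    unfolding a0_def b0_def by (metis add_pos_nonneg add_nonneg_pos zero_less_power zero_le_power, simp_all)
  have nz: "a0 t + b0 t \<noteq> 0" for t using N(1)[of t] by simp
  have c: "continuous_on UNIV a0" "continuous_on UNIV a1" "continuous_on UNIV a2"
    "continuous_on UNIV b0" "continuous_on UNIV b1" "continuous_on UNIV b2"
    unfolding a0_def[abs_def] a1_def[abs_def] a2_def[abs_def] b0_def[abs_def] b1_def[abs_def] b2_def[abs_def] p_def q_def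
    by (intro continuous_intros)+
  \<comment> \<open>Numerator in the quotient rule: the first derivative of the step is N0 / (a0 +
    b0)^2.\<close>
  define N0 where "N0 t = a1 t * b0 t - a0 t * b1 t" for t
  have dN: "(N0 has_real_derivative a2 t * b0 t - a0 t * b2 t) (at t)" for t
    unfolding N0_def[abs_def] by (rule derivative_eq_intros d refl)+ (simp add: algebra_simps)
  define r where "r t = inverse (a0 t + b0 t)" for t
  have dr: "(r has_real_derivative - ((a1 t + b1 t) * r t ^ 2)) (at t)" for t
    unfolding r_def[abs_def] using DERIV_inverse'[OF DERIV_add[OF d(1,3)] nz, of t] by (simp add: power2_eq_square mult_ac)
  have "C2_step \<alpha> \<beta> (\<lambda>t. a0 t * r t) (\<lambda>t. N0 t * r t ^ 2)
    (\<lambda>t. (a2 t * b0 t - a0 t * b2 t) * r t ^ 2 - 2 * N0 t * (a1 t + b1 t) * r t ^ 3)"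
    unfolding C2_step_def C2_fun_def
  proof (intro conjI allI impI)
    fix t
    have "a1 t * r t = a1 t * (r t ^ 2 * (a0 t + b0 t))" using nz[of t] by (simp add: r_def power2_eq_square)
    then show "((\<lambda>t. a0 t * r t) has_real_derivative N0 t * r t ^ 2) (at t)"
      using DERIV_mult[OF d(1) dr, of t] by (simp add: N0_def algebra_simps)
    show "((\<lambda>t. N0 t * r t ^ 2) has_real_derivative
        (a2 t * b0 t - a0 t * b2 t) * r t ^ 2 - 2 * N0 t * (a1 t + b1 t) * r t ^ 3) (at t)"
      by (rule DERIV_cong[OF DERIV_mult[OF dN DERIV_power[OF dr]]]) (simp add: power2_eq_square power3_eq_cube)
    show "a0 t * r t \<ge> 0" "a0 t * r t \<le> 1" using N[of t] by (simp_all add: r_def flip: divide_inverse)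
    show "continuous_on UNIV (\<lambda>t. (a2 t * b0 t - a0 t * b2 t) * r t ^ 2 - 2 * N0 t * (a1 t + b1 t) * r t ^ 3)"
      unfolding N0_def r_def using nz by (intro continuous_intros c) auto
  next
    fix t assume "\<beta> \<le> t"
    then have "b0 t = 0" "b1 t = 0" "b2 t = 0" by (simp_all add: b0_def b1_def b2_def q_def)
    then show "a0 t * r t = 1" "N0 t * r t ^ 2 = 0"
      "(a2 t * b0 t - a0 t * b2 t) * r t ^ 2 - 2 * N0 t * (a1 t + b1 t) * r t ^ 3 = 0"
      using nz[of t] by (simp_all add: N0_def r_def)
  qed (auto simp: N0_def a0_def a1_def a2_def p_def)
  then show ?thesis by (rule that)
qed

subsection \<open>Directional derivatives of radial functions and of the quadric\<close>

lemma has_pd_chain: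
  assumes "has_pd i u u' y" "(\<phi> has_field_derivative \<phi>') (at (u y))"
  shows "has_pd i (\<lambda>y. \<phi> (u y)) (u' * \<phi>') y"
  using field_vector_diff_chain_at[of "\<lambda>t. u (y + t *\<^sub>R axis i 1)" u' 0 \<phi> \<phi>'] assms
  by (simp add: has_pd_def o_def)

lemma has_pd_coord: "has_pd i (\<lambda>y. of_real (y $ j)) (if i = j then 1 else 0) y"
proof -
  have "((\<lambda>t::real. complex_of_real (y $ j + t * (if i = j then 1 else 0))) has_vector_derivative
      of_real (if i = j then 1 else 0)) (at 0)"
    by (rule has_vector_derivative_of_real) (auto intro!: derivative_eq_intros)
  moreover have "(\<lambda>t::real. complex_of_real (y $ j + t * (if i = j then 1 else 0)))
    = (\<lambda>t. of_real ((y + t *\<^sub>R axis i 1) $ j))"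
    by (auto simp: axis_def fun_eq_iff)
  ultimately have "((\<lambda>t. complex_of_real ((y + t *\<^sub>R axis i 1) $ j)) has_vector_derivative
      of_real (if i = j then 1 else 0)) (at 0)" by (simp only:)
  then show ?thesis unfolding has_pd_def by (cases "i = j") simp_all
qed

lemma has_pd_radial:
  fixes y :: "real^'n::finite"
  assumes "(\<sigma> has_real_derivative d) (at (y \<bullet> y))"
  shows "has_pd i (\<lambda>y. of_real (\<sigma> (y \<bullet> y))) (of_real (2 * y $ i * d)) y"
proof -
  have eq: "(y + t *\<^sub>R axis i 1) \<bullet> (y + t *\<^sub>R axis i 1) = y \<bullet> y + (2 * y $ i) * t + t\<^sup>2" for t
    by (simp add: inner_add_left inner_add_right inner_axis inner_axis' inner_axis_axis power2_eq_square algebra_simps)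
  have "((\<lambda>t. \<sigma> (y \<bullet> y + (2 * y $ i) * t + t\<^sup>2)) has_real_derivative d * (2 * y $ i)) (at 0)"
    by (rule DERIV_chain2[of \<sigma>]) (use assms in \<open>auto intro!: derivative_eq_intros\<close>)
  then have "((\<lambda>t. complex_of_real (\<sigma> ((y + t *\<^sub>R axis i 1) \<bullet> (y + t *\<^sub>R axis i 1)))) has_vector_derivative
      of_real (d * (2 * y $ i))) (at 0)"
    unfolding eq by (intro has_vector_derivative_of_real) (simp add: has_real_derivative_iff_has_vector_derivative)
  then show ?thesis by (simp add: has_pd_def mult.commute)
qed

lemma has_pd_qf:
  "has_pd i (\<lambda>y. qf (z - cembed y) + c) (- 2 * (z $ i - of_real (y $ i))) y"
proof -
  have "has_pd i (\<lambda>y. (z $ j - of_real (y $ j)) * (z $ j - of_real (y $ j)))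
     ((z $ j - of_real (y $ j)) * (0 - (if i = j then 1 else 0)) + (0 - (if i = j then 1 else 0)) * (z $ j - of_real (y $ j))) y" for j
    by (intro has_pd_mult has_pd_diff has_pd_const has_pd_coord)
  then have "has_pd i (\<lambda>y. (\<Sum>j\<in>UNIV. (z $ j - of_real (y $ j)) * (z $ j - of_real (y $ j))) + c)
     ((\<Sum>j\<in>UNIV. ((z $ j - of_real (y $ j)) * (0 - (if i = j then 1 else 0)) + (0 - (if i = j then 1 else 0)) * (z $ j - of_real (y $ j)))) + 0) y"
    by (intro has_pd_add has_pd_const has_pd_sum)
  moreover have "(\<Sum>j\<in>UNIV. ((z $ j - of_real (y $ j)) * (0 - (if i = j then 1 else 0)) + (0 - (if i = j then 1 else 0)) * (z $ j - of_real (y $ j)))) + 0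
     = (\<Sum>j\<in>UNIV. if i = j then - 2 * (z $ j - of_real (y $ j)) else 0)"
    by (intro trans[OF add_0_right] sum.cong) auto
  ultimately show ?thesis
    by (simp add: qf_def cembed_def power2_eq_square)
qed

text \<open>Here \<open>l\<close> stands for a logarithm of \<open>s\<close>. It is a separate argument because the inner and
  the outer shell need different branches.\<close>

definition ee :: "nat \<Rightarrow> nat \<Rightarrow> complex \<Rightarrow> complex \<Rightarrow> complex \<Rightarrow> complex \<Rightarrow> complex" where
  "ee p k a b s l = s ^ p / s ^ k * (a * l + b)"

text \<open>The family s^(p-k) (a l + b) is closed under differentiation, with (a, b) replaced by
  ((p-k) a, (p-k) b + a). All that is used of l is that its derivative is s'/s, so any branch of the
  logarithm qualifies.\<close>

lemma has_pd_ee: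
  assumes s: "has_pd i s s' y" "s y \<noteq> 0" and l: "has_pd i l (s' / s y) y"
  shows "has_pd i (\<lambda>y. ee p k a b (s y) (l y))
    (s' * ee p (Suc k) ((of_nat p - of_nat k) * a) ((of_nat p - of_nat k) * b + a) (s y) (l y)) y"
proof -
  have "((\<lambda>s. s ^ p / s ^ k) has_field_derivative (of_nat p - of_nat k) * (s y ^ p / s y ^ Suc k)) (at (s y))"
  proof -
    have "((\<lambda>x. x powi (int p - int k)) has_field_derivative
       of_int (int p - int k) * s y powi (int p - int k - 1)) (at (s y))"
      using s(2) by (auto intro!: derivative_eq_intros)
    then have "((\<lambda>s. s ^ p / s ^ k) has_field_derivative
       of_int (int p - int k) * s y powi (int p - int k - 1)) (at (s y))"
      by (rule has_field_derivative_transform_within_open[of _ _ _ "-{0}"])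
        (use s(2) in \<open>auto simp: power_int_diff\<close>)
    moreover have "s y powi (int p - int k - 1) = s y ^ p / s y ^ Suc k"
      using s(2) by (simp add: power_int_diff)
    ultimately show ?thesis by simp
  qed
  from has_pd_chain[OF s(1) this]
  have 1: "has_pd i (\<lambda>y. s y ^ p / s y ^ k) (s' * ((of_nat p - of_nat k) * (s y ^ p / s y ^ Suc k))) y" .
  have 2: "has_pd i (\<lambda>y. a * l y + b) ((a * (s' / s y) + 0 * l y) + 0) y"
    by (intro has_pd_add has_pd_mult has_pd_const l)
  show ?thesis using has_pd_mult[OF 1 2] s(2) unfolding ee_def
    by (simp add: field_simps)
qed

lemma ee_continuous:
  assumes "continuous_on V s" "continuous_on V l" "\<And>y. y \<in> V \<Longrightarrow> s y \<noteq> 0"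
  shows "continuous_on V (\<lambda>y. ee p k a b (s y) (l y))"
  unfolding ee_def using assms by (intro continuous_intros) auto

text \<open>With \<psi>(y) = u0(|y|^2) and s = q(z - y) + c, \<open>W1\<close> is 2 grad \<psi> .
  grad s and \<open>W2\<close> is the Laplacian of \<psi>: the coefficients of G'(s) and G(s) in the
  commutator of the Laplacian with \<psi>.\<close>

definition W1 :: "(real \<Rightarrow> real) \<Rightarrow> complex^'n::finite \<Rightarrow> real^'n \<Rightarrow> complex" where
  "W1 u1 z y = of_real (- 8 * u1 (y \<bullet> y)) * bil (cembed y) (z - cembed y)"

definition W2 :: "(real \<Rightarrow> real) \<Rightarrow> (real \<Rightarrow> real) \<Rightarrow> real^'n::finite \<Rightarrow> complex" where
  "W2 u1 u2 y = of_real (4 * (y \<bullet> y) * u2 (y \<bullet> y) + 2 * real CARD('n) * u1 (y \<bullet> y))"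

text \<open>The Laplacian of a product \<open>u0 (|y|\<^sup>2) G (s y)\<close> with \<open>s y = q (z - y) + c\<close>, tested against \<open>h\<close>.
  The first and zeroth order terms \<^const>\<open>W1\<close>, \<^const>\<open>W2\<close> live on the support of the
  derivatives of the cutoff.\<close>

lemma green_term:
  fixes h :: "real^'n::finite \<Rightarrow> complex" and z :: "complex^'n"
  assumes G: "open G" and h: "smooth_on G h" and V: "open V" "V \<subseteq> G" and S: "compact S" "S \<subseteq> V"
    and \<sigma>: "C2_fun u0 u1 u2"
    and z: "\<And>y. y \<notin> S \<Longrightarrow> u0 (y \<bullet> y) = 0 \<and> u1 (y \<bullet> y) = 0 \<and> u2 (y \<bullet> y) = 0"
    and s: "\<And>y. s y = qf (z - cembed y) + c" "\<And>y. y \<in> V \<Longrightarrow> s y \<noteq> 0"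
    and l: "continuous_on V l" "\<And>i y. y \<in> V \<Longrightarrow> has_pd i l (- 2 * (z $ i - of_real (y $ i)) / s y) y"
    and m: "CARD('n) = 2 * m + 2"
    and a: "a1 = (of_nat p - of_nat m) * a" "b1 = (of_nat p - of_nat m) * b + a"
      "a2 = (of_nat p - of_nat (Suc m)) * a1" "b2 = (of_nat p - of_nat (Suc m)) * b1 + a1"
      "a3 = 4 * of_nat p * (of_nat p - of_nat m) * a"
      "b3 = 4 * of_nat p * (of_nat p - of_nat m) * b + 4 * (2 * of_nat p - of_nat m) * a"
  shows "integral UNIV (\<lambda>y. h y * (W1 u1 z y * ee p (Suc m) a1 b1 (s y) (l y) + W2 u1 u2 y * ee p m a b (s y) (l y)))
    = integral UNIV (\<lambda>y. laplacian h y * (of_real (u0 (y \<bullet> y)) * ee p m a b (s y) (l y)))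
    - integral UNIV (\<lambda>y. h y * (of_real (u0 (y \<bullet> y)) *
        ee p (Suc m) a3 b3 (s y) (l y)))
    + 4 * c * integral UNIV (\<lambda>y. h y * (of_real (u0 (y \<bullet> y)) * ee p (Suc (Suc m)) a2 b2 (s y) (l y)))"
proof -
  define e0 where "e0 y = ee p m a b (s y) (l y)" for y
  define e1 where "e1 y = ee p (Suc m) a1 b1 (s y) (l y)" for y
  define e2 where "e2 y = ee p (Suc (Suc m)) a2 b2 (s y) (l y)" for y
  define e3 where "e3 y = ee p (Suc m) a3 b3 (s y) (l y)" for y
  define si where "si i y = - 2 * (z $ i - of_real (y $ i))" for i y
  define \<psi> where "\<psi> y = complex_of_real (u0 (y \<bullet> y))" for y :: "real^'n"
  define \<psi>1 where "\<psi>1 i y = complex_of_real (2 * y $ i * u1 (y \<bullet> y))" for i and y :: "real^'n"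
  define \<psi>2 where "\<psi>2 i y = complex_of_real (4 * (y $ i)\<^sup>2 * u2 (y \<bullet> y) + 2 * u1 (y \<bullet> y))" for i and y :: "real^'n"
  have seq: "s = (\<lambda>y. qf (z - cembed y) + c)" using s(1) by auto
  have sc: "continuous_on V s" unfolding seq by (intro continuous_intros)
  have pds: "has_pd i s (si i y) y" for i y unfolding seq si_def by (rule has_pd_qf)
  have pdl: "has_pd i l (si i y / s y) y" if "y \<in> V" for i y using l(2)[OF that] by (simp add: si_def)
  have ec: "continuous_on V e0" "continuous_on V e1" "continuous_on V e2" "continuous_on V e3"
    unfolding e0_def[abs_def] e1_def[abs_def] e2_def[abs_def] e3_def[abs_def]
    by (intro ee_continuous sc l(1) s(2); assumption)+
  have pde0: "has_pd i e0 (si i y * e1 y) y" if "y \<in> V" for i y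
    using has_pd_ee[OF pds s(2)[OF that] pdl[OF that], of i p m a b] unfolding e0_def[abs_def] e1_def a .
  have pde1: "has_pd i e1 (si i y * e2 y) y" if "y \<in> V" for i y
    using has_pd_ee[OF pds s(2)[OF that] pdl[OF that], of i p "Suc m" a1 b1] unfolding e1_def[abs_def] e2_def a(3,4) .
  have pdsi: "has_pd i (si i) 2 y" for i y
  proof -
    have "has_pd i (\<lambda>y. (-2) * (z $ i - of_real (y $ i))) ((-2) * (0 - (if i = i then 1 else 0)) + 0 * (z $ i - of_real (y $ i))) y"
      by (intro has_pd_mult has_pd_diff has_pd_const has_pd_coord)
    then show ?thesis by (simp add: si_def[abs_def])
  qed
  have d0: "(u0 has_real_derivative u1 t) (at t)" and d1: "(u1 has_real_derivative u2 t) (at t)" for t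
    using \<sigma> by (auto simp: C2_fun_def)
  have pd\<psi>: "has_pd i \<psi> (\<psi>1 i y) y" for i y
    unfolding \<psi>_def[abs_def] \<psi>1_def by (rule has_pd_radial[OF d0])
  have pd\<psi>1: "has_pd i (\<psi>1 i) (\<psi>2 i y) y" for i y
  proof -
    have "has_pd i (\<lambda>y. (2 * of_real (y $ i)) * of_real (u1 (y \<bullet> y)))
      ((2 * of_real (y $ i)) * of_real (2 * y $ i * u2 (y \<bullet> y)) + (2 * (if i = i then 1 else 0) + 0 * of_real (y $ i)) * of_real (u1 (y \<bullet> y))) y"
      by (intro has_pd_mult has_pd_const has_pd_coord has_pd_radial d1)
    then show ?thesis by (simp add: \<psi>1_def[abs_def] \<psi>2_def power2_eq_square mult_ac)
  qed
  note cc = C2_fun_continuous[OF \<sigma>, THEN continuous_on_compose2]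
  have c\<psi>: "continuous_on V \<psi>" "continuous_on V (\<psi>1 i)" "continuous_on V (\<psi>2 i)" "continuous_on V (si i)" for i
    unfolding \<psi>_def[abs_def] \<psi>1_def[abs_def] \<psi>2_def[abs_def] si_def[abs_def]
    by (intro continuous_intros cc subset_UNIV)+
  define \<phi>1 where "\<phi>1 i y = \<psi> y * (si i y * e1 y) + \<psi>1 i y * e0 y" for i y
  define \<phi>2 where "\<phi>2 i y = (\<psi> y * (si i y * (si i y * e2 y) + 2 * e1 y) + \<psi>1 i y * (si i y * e1 y))
      + (\<psi>1 i y * (si i y * e1 y) + \<psi>2 i y * e0 y)" for i y
  have zz: "\<psi> y = 0" "\<psi>1 i y = 0" "\<psi>2 i y = 0" if "y \<notin> S" for i y
    using z[OF that] by (simp_all add: \<psi>_def \<psi>1_def \<psi>2_def)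
  have green: "integral UNIV (\<lambda>y. h y * (\<Sum>i\<in>UNIV. \<phi>2 i y)) = integral UNIV (\<lambda>y. laplacian h y * (\<psi> y * e0 y))"
  proof (rule green_identity[OF G h V S, where ?\<phi>1.0=\<phi>1])
    fix i y assume y: "y \<in> V"
    show "has_pd i (\<lambda>y. \<psi> y * e0 y) (\<phi>1 i y) y"
      unfolding \<phi>1_def by (intro has_pd_mult pd\<psi> pde0 y)
    show "has_pd i (\<phi>1 i) (\<phi>2 i y) y"
      unfolding \<phi>1_def[abs_def] \<phi>2_def by (intro has_pd_add has_pd_mult pd\<psi> pd\<psi>1 pde0 pde1 pdsi y)
  qed (auto simp: \<phi>1_def[abs_def] \<phi>2_def[abs_def] zz intro!: continuous_intros ec c\<psi>)
  have sum: "(\<Sum>i\<in>UNIV. \<phi>2 i y) = (W1 u1 z y * e1 y + W2 u1 u2 y * e0 y) + \<psi> y * e3 y - 4 * c * (\<psi> y * e2 y)"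
    if y: "y \<in> V" for y
  proof -
    \<comment> \<open>This is where c enters: grad s . grad s = 4 q(z - y) = 4 (s - c), so the
      Laplacian of G(s) is D G - 4 c G'' taken at s.\<close>
    have s2: "(\<Sum>i\<in>UNIV. si i y * si i y) = 4 * (s y - c)"
      by (simp add: s(1) si_def qf_def cembed_def power2_eq_square sum_distrib_left algebra_simps)
    have s1: "(\<Sum>i\<in>UNIV. 2 * (\<psi>1 i y * si i y)) = W1 u1 z y"
      by (simp add: W1_def \<psi>1_def si_def bil_def cembed_def sum_distrib_left algebra_simps)
    have s0: "(\<Sum>i\<in>UNIV. \<psi>2 i y) = W2 u1 u2 y"
      by (simp add: W2_def \<psi>2_def inner_vec_def sum_distrib_left sum_distrib_right sum.distrib power2_eq_square algebra_simps)
    have n: "(\<Sum>i\<in>(UNIV::'n set). 2 * e1 y) = 2 * (2 * of_nat m + 2) * e1 y"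
      using m by simp
    have "(\<Sum>i\<in>UNIV. \<phi>2 i y) = \<psi> y * ((\<Sum>i\<in>UNIV. si i y * si i y) * e2 y + (\<Sum>i\<in>(UNIV::'n set). 2 * e1 y))
       + (\<Sum>i\<in>UNIV. 2 * (\<psi>1 i y * si i y)) * e1 y + (\<Sum>i\<in>UNIV. \<psi>2 i y) * e0 y"
      by (simp add: \<phi>2_def sum.distrib sum_distrib_left sum_distrib_right algebra_simps)
    also have "\<dots> = (W1 u1 z y * e1 y + W2 u1 u2 y * e0 y) + \<psi> y * (4 * (s y * e2 y) + 2 * (2 * of_nat m + 2) * e1 y) - 4 * c * (\<psi> y * e2 y)"
      unfolding s0 s1 s2 n by (simp add: algebra_simps)
    also have "4 * (s y * e2 y) + 2 * (2 * of_nat m + 2) * e1 y = e3 y"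
    proof -
      define E where "E = s y ^ p / s y ^ Suc m"
      have sE: "s y * e2 y = E * (a2 * l y + b2)"
        using s(2)[OF y] by (simp add: e2_def ee_def E_def)
      show ?thesis unfolding sE unfolding e1_def e3_def a ee_def E_def[symmetric]
        by (simp add: algebra_simps)
    qed
    finally show ?thesis .
  qed
  have eq: "(\<lambda>y. h y * (\<Sum>i\<in>UNIV. \<phi>2 i y)) =
    (\<lambda>y. (h y * (W1 u1 z y * e1 y + W2 u1 u2 y * e0 y) + h y * (\<psi> y * e3 y)) - 4 * c * (h y * (\<psi> y * e2 y)))"
  proof
    fix y show "h y * (\<Sum>i\<in>UNIV. \<phi>2 i y) =
      (h y * (W1 u1 z y * e1 y + W2 u1 u2 y * e0 y) + h y * (\<psi> y * e3 y)) - 4 * c * (h y * (\<psi> y * e2 y))"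
    proof (cases "y \<in> S")
      case True
      then have "y \<in> V" using S by auto
      show ?thesis unfolding sum[OF \<open>y \<in> V\<close>] by (simp add: algebra_simps)
    next
      case False
      then show ?thesis using z[OF False] by (simp add: \<phi>2_def zz W1_def W2_def)
    qed
  qed
  have hV: "continuous_on V h" using continuous_on_subset[OF smooth_on_continuous[OF h] V(2)] .
  have cs1: "csupp S (\<lambda>y. h y * (W1 u1 z y * e1 y + W2 u1 u2 y * e0 y))"
    by (rule csuppI[OF V(1) compact_imp_closed[OF S(1)] S(2)])
      (use z in \<open>auto simp: W1_def[abs_def] W2_def[abs_def] bil_def intro!: continuous_intros hV ec cc\<close>)
  have cs2: "csupp S (\<lambda>y. h y * (\<psi> y * e3 y))"
    by (rule csuppI[OF V(1) compact_imp_closed[OF S(1)] S(2)])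
      (auto simp: zz intro!: continuous_intros hV ec c\<psi>)
  have cs3: "csupp S (\<lambda>y. h y * (\<psi> y * e2 y))"
    by (rule csuppI[OF V(1) compact_imp_closed[OF S(1)] S(2)])
      (auto simp: zz intro!: continuous_intros hV ec c\<psi>)
  have "integral UNIV (\<lambda>y. (h y * (W1 u1 z y * e1 y + W2 u1 u2 y * e0 y) + h y * (\<psi> y * e3 y)) - 4 * c * (h y * (\<psi> y * e2 y)))
    = integral UNIV (\<lambda>y. h y * (W1 u1 z y * e1 y + W2 u1 u2 y * e0 y)) + integral UNIV (\<lambda>y. h y * (\<psi> y * e3 y))
     - 4 * c * integral UNIV (\<lambda>y. h y * (\<psi> y * e2 y))"
    using csupp_integrable[OF cs1 S(1)] csupp_integrable[OF cs2 S(1)]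
      csupp_integrable[OF csupp_cmult[OF cs3] S(1)] csupp_integrable[OF csupp_add[OF cs1 cs2] S(1)]
    by (simp add: integral_diff integral_add)
  with green show ?thesis unfolding eq
    unfolding e0_def[symmetric] e1_def[symmetric] e2_def[symmetric] e3_def[symmetric] \<psi>_def[symmetric]
    by (simp add: algebra_simps)
qed

subsection \<open>The summed Green identity\<close>

text \<open>\<open>kA1\<close>, \<open>kB1\<close> are the coefficients of G_p' and
  \<open>kA2\<close>, \<open>kB2\<close> those of G_p'', next to the powers s^(p-m-1) and
  s^(p-m-2).\<close>

definition kA1 :: "nat \<Rightarrow> nat \<Rightarrow> real" where "kA1 m p = (real p - real m) * kA m p"
definition kB1 :: "nat \<Rightarrow> nat \<Rightarrow> real" where "kB1 m p = (real p - real m) * kB m p + kA m p"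
definition kA2 :: "nat \<Rightarrow> nat \<Rightarrow> real" where "kA2 m p = (real p - real (Suc m)) * kA1 m p"
definition kB2 :: "nat \<Rightarrow> nat \<Rightarrow> real" where "kB2 m p = (real p - real (Suc m)) * kB1 m p + kA1 m p"

lemma subexp_linear_mult:
  assumes "subexp (\<lambda>p. a p * fact (2 * p))"
  shows "subexp (\<lambda>p. ((real p - r) * a p) * fact (2 * p))"
  using subexp_mult[OF subexp_linear[of 1 "- r"] assms] by (simp add: mult.assoc)

lemma subexp_add_mult:
  assumes "subexp (\<lambda>p. a p * fact (2 * p))" "subexp (\<lambda>p. b p * fact (2 * p))"
  shows "subexp (\<lambda>p. (a p + b p) * fact (2 * p))"
  using subexp_add[OF assms] by (simp add: distrib_right)

lemma subexp_k12:
  "subexp (\<lambda>p. kA1 m p * fact (2 * p))" "subexp (\<lambda>p. kB1 m p * fact (2 * p))"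
  "subexp (\<lambda>p. kA2 m p * fact (2 * p))" "subexp (\<lambda>p. kB2 m p * fact (2 * p))"
  unfolding kA2_def kB2_def kA1_def kB1_def
  by (intro subexp_linear_mult subexp_add_mult subexp_kA subexp_kB)+

lemma kA2_0: "kA2 m 0 = 0"
  using m_kA_0[of m] by (simp add: kA2_def kA1_def)

lemma kB2_0: "kB2 m 0 = kappa m"
  by (simp add: kB2_def kB1_def kA1_def kappa_def algebra_simps)

locale polyharmonic =
  fixes G :: "(real^'n::finite) set" and f :: "real^'n \<Rightarrow> complex" and \<tau> :: real and m :: nat
  assumes open_G: "open G" and poly: "polyharmonic_inf G \<tau> f" and \<tau>_nonneg: "\<tau> \<ge> 0"
    and dim: "CARD('n) = 2 * m + 2"
begin

definition cf :: "(nat \<Rightarrow> real) \<Rightarrow> nat \<Rightarrow> real^'n \<Rightarrow> complex" where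
  "cf a p y = of_real (a p) * (laplacian ^^ p) f y"

lemma tame_cf: "subexp (\<lambda>p. a p * fact (2 * p)) \<Longrightarrow> tame \<tau> G (cf a)"
  using polyharmonic_tame[OF open_G poly \<tau>_nonneg] unfolding cf_def[abs_def] by blast

lemmas tame_k =
  tame_cf[OF subexp_kA] tame_cf[OF subexp_kB] tame_cf[OF subexp_k12(1)] tame_cf[OF subexp_k12(2)]
  tame_cf[OF subexp_k12(3)] tame_cf[OF subexp_k12(4)]

text \<open>The sum over p of (Laplacian^p f)(y) times the commutator [Laplacian, \<psi>] applied to
  G_p(s), with the negative powers of s taken out of the series. s and l are free arguments, so the
  formula serves the regularised s and both branches of the logarithm.\<close>

definition Ker :: "(real \<Rightarrow> real) \<Rightarrow> (real \<Rightarrow> real) \<Rightarrow> complex^'n \<Rightarrow> real^'n \<Rightarrow> complex \<Rightarrow> complex \<Rightarrow> complex" where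
  "Ker u1 u2 z y s l =
     W1 u1 z y * (inverse s ^ Suc m * (l * Ser (cf (kA1 m)) y s + Ser (cf (kB1 m)) y s))
   + W2 u1 u2 y * (inverse s ^ m * (l * Ser (cf (kA m)) y s + Ser (cf (kB m)) y s))"

lemma Ser_comb:
  assumes "tame \<tau> G c" "tame \<tau> G d" "V \<subseteq> G" "y \<in> V" "\<tau>\<^sup>2 * cmod s < 1"
    "continuous_on V e" "continuous_on V l"
  shows "Ser (\<lambda>p y. e y * (l y * c p y + d p y)) y s = e y * (l y * Ser c y s + Ser d y s)"
proof -
  have c: "tame \<tau> V c" "tame \<tau> V d" using assms(1-3) tame_subset by blast+
  show ?thesis
    by (subst Ser_mult[of \<tau> V] Ser_add[of \<tau> V] Ser_mult[of \<tau> V];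
        (intro tame_add tame_mult c assms(4-7))?)+
      (rule refl)
qed

lemma tame_comb:
  assumes "tame \<tau> G c" "tame \<tau> G d" "V \<subseteq> G" "continuous_on V e" "continuous_on V l"
  shows "tame \<tau> V (\<lambda>p y. e y * (l y * c p y + d p y))"
  using assms by (intro tame_mult tame_add) (auto intro: tame_subset)

lemma Ser_cf_continuous:
  assumes "tame \<tau> G c" "continuous_on T u" "continuous_on T s"
    "\<And>x. x \<in> T \<Longrightarrow> u x \<in> G \<and> \<tau>\<^sup>2 * cmod (s x) < 1"
  shows "continuous_on T (\<lambda>x. Ser c (u x) (s x))"
  using continuous_on_compose2[OF Ser_continuous[OF assms(1) open_G] continuous_on_Pair[OF assms(2,3)]] assms(4)
  by force

lemma continuous_on_W12:
  assumes "C2_fun u0 u1 u2" "continuous_on T u"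
  shows "continuous_on T (\<lambda>x. W1 u1 z (u x))" "continuous_on T (\<lambda>x. W2 u1 u2 (u x))"
  unfolding W1_def W2_def bil_def
  by (intro continuous_intros C2_fun_continuous[OF assms(1), THEN continuous_on_compose2] assms(2) subset_UNIV)+

lemma Ker_continuous:
  assumes "C2_fun u0 u1 u2" "continuous_on T u" "continuous_on T s" "continuous_on T l"
    "\<And>x. x \<in> T \<Longrightarrow> u x \<in> G \<and> \<tau>\<^sup>2 * cmod (s x) < 1 \<and> s x \<noteq> 0"
  shows "continuous_on T (\<lambda>x. Ker u1 u2 z (u x) (s x) (l x))"
  unfolding Ker_def
  by (intro continuous_intros continuous_on_W12[OF assms(1,2)] Ser_cf_continuous tame_k assms(2-4))
    (use assms(5) in auto)

lemma Ker_zero: "u1 (y \<bullet> y) = 0 \<Longrightarrow> u2 (y \<bullet> y) = 0 \<Longrightarrow> Ker u1 u2 z y s l = 0"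
  by (simp add: Ker_def W1_def W2_def)

lemma Ker_csupp:
  assumes "C2_fun u0 u1 u2" "open V" "V \<subseteq> G" "compact S" "S \<subseteq> V"
    "\<And>y. y \<notin> S \<Longrightarrow> u1 (y \<bullet> y) = 0 \<and> u2 (y \<bullet> y) = 0"
    "continuous_on V s" "continuous_on V l" "\<And>y. y \<in> V \<Longrightarrow> \<tau>\<^sup>2 * cmod (s y) < 1 \<and> s y \<noteq> 0"
  shows "csupp S (\<lambda>y. Ker u1 u2 z y (s y) (l y))"
proof (rule csuppI[OF assms(2) compact_imp_closed[OF assms(4)] assms(5)])
  show "continuous_on V (\<lambda>y. Ker u1 u2 z y (s y) (l y))"
    by (rule Ker_continuous[OF assms(1) continuous_on_id assms(7,8)]) (use assms(3,9) in auto)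
qed (use assms(6) Ker_zero in blast)

lemma Ker_diff:
  "Ker (\<lambda>t. u1 t - v1 t) (\<lambda>t. u2 t - v2 t) z y s l = Ker u1 u2 z y s l - Ker v1 v2 z y s l"
  by (simp add: Ker_def W1_def W2_def algebra_simps)

text \<open>Applying \<open>green_term\<close> to the successive Laplacians of \<open>f\<close> makes the volume terms
  telescope; the type bound forces the last one to tend to 0.\<close>

theorem Ker_integral:
  assumes V: "open V" "V \<subseteq> G" and S: "compact S" "S \<subseteq> V"
    and \<sigma>: "C2_fun u0 u1 u2"
    and z: "\<And>y. y \<notin> S \<Longrightarrow> u0 (y \<bullet> y) = 0 \<and> u1 (y \<bullet> y) = 0 \<and> u2 (y \<bullet> y) = 0"
    and s: "\<And>y. s y = qf (z - cembed y) + c" "\<And>y. y \<in> V \<Longrightarrow> s y \<noteq> 0"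
      "\<And>y. y \<in> V \<Longrightarrow> \<tau>\<^sup>2 * cmod (s y) < 1"
    and l: "continuous_on V l" "\<And>i y. y \<in> V \<Longrightarrow> has_pd i l (- 2 * (z $ i - of_real (y $ i)) / s y) y"
  shows "integral UNIV (\<lambda>y. Ker u1 u2 z y (s y) (l y)) = 4 * c * integral UNIV (\<lambda>y.
    (of_real (u0 (y \<bullet> y)) * inverse (s y) ^ (m + 2)) * (l y * Ser (cf (kA2 m)) y (s y) + Ser (cf (kB2 m)) y (s y)))"
proof -
  define h where "h p = (laplacian ^^ p) f" for p
  have hs: "smooth_on G (h p)" for p
    using smooth_on_laplacian_funpow[OF open_G] poly by (simp add: h_def polyharmonic_inf_def)
  define \<psi> where "\<psi> y = complex_of_real (u0 (y \<bullet> y))" for y :: "real^'n"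
  have seq: "s = (\<lambda>y. qf (z - cembed y) + c)" using s(1) by auto
  have sc: "continuous_on V s" unfolding seq by (intro continuous_intros)
  have isc: "continuous_on V (\<lambda>y. inverse (s y) ^ k)" for k
    using s(2) by (intro continuous_intros sc) auto
  have \<psi>c: "continuous_on V \<psi>" unfolding \<psi>_def[abs_def]
    by (intro continuous_intros C2_fun_continuous[OF \<sigma>, THEN continuous_on_compose2] subset_UNIV)
  \<comment> \<open>\<open>rA p\<close> and \<open>rB p\<close> are the coefficients of D G_p, that
    is of G_(p-1); both vanish at p = 0.\<close>
  define rA where "rA p = 4 * real p * (real p - real m) * kA m p" for p
  define rB where "rB p = 4 * real p * (real p - real m) * kB m p + 4 * (2 * real p - real m) * kA m p" for p
  have r: "rA (Suc p) = kA m p" "rB (Suc p) = kB m p" for p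
    using kA_rec[of m p] kB_rec[of m p] by (simp_all add: rA_def rB_def)
  have r0: "rA 0 = 0" "rB 0 = 0" using m_kA_0[of m] by (simp_all add: rA_def rB_def)
  have "subexp (\<lambda>p. ((real p - 0) * ((real p - real m) * (4 * (kA m p * fact (2*p))))))"
    and "subexp (\<lambda>p. ((real p - 0) * ((real p - real m) * (4 * (kB m p * fact (2*p))))) + (8 * real p + (- 4 * real m)) * (kA m p * fact (2*p)))"
    using subexp_linear[of 1 0] subexp_linear[of 1 "- real m"]
    by (intro subexp_add subexp_mult subexp_const subexp_kA subexp_kB subexp_linear; simp)+
  then have tr: "tame \<tau> G (cf rA)" "tame \<tau> G (cf rB)"
    by (auto intro!: tame_cf simp: rA_def rB_def algebra_simps)
  define kc where "kc p y = W1 u1 z y * inverse (s y) ^ Suc m * (l y * cf (kA1 m) p y + cf (kB1 m) p y)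
      + W2 u1 u2 y * inverse (s y) ^ m * (l y * cf (kA m) p y + cf (kB m) p y)" for p y
  define qc where "qc p y = (\<psi> y * inverse (s y) ^ (m + 2)) * (l y * cf (kA2 m) p y + cf (kB2 m) p y)" for p y
  \<comment> \<open>\<open>cf rA (Suc p)\<close> is \<open>kA m p\<close> times the (p+1)-st
    Laplacian of f. Indexing the coefficient by the order of the Laplacian makes tameness an
    instance of \<open>tame_shift\<close>.\<close>
  define tc where "tc p y = (\<psi> y * inverse (s y) ^ m) * (l y * cf rA (Suc p) y + cf rB (Suc p) y)" for p y
  note cW = continuous_on_W12[OF \<sigma> continuous_on_id]
  have tk: "tame \<tau> V kc" unfolding kc_def[abs_def]
    by (intro tame_add tame_comb tame_k V(2) l(1) continuous_on_mult cW isc)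
  have tq: "tame \<tau> V qc" unfolding qc_def[abs_def]
    by (intro tame_comb tame_k V(2) l(1) continuous_on_mult \<psi>c isc)
  have tt: "tame \<tau> V tc" unfolding tc_def[abs_def]
    by (intro tame_comb tame_shift[OF tr(1)] tame_shift[OF tr(2)] V(2) l(1) continuous_on_mult \<psi>c isc)
  have z0: "kc p y = 0" "qc p y = 0" "tc p y = 0" if "y \<notin> S" for p y
    using z[OF that] by (simp_all add: kc_def qc_def tc_def W1_def W2_def \<psi>_def)
  have Sk: "(\<lambda>p. integral UNIV (\<lambda>y. kc p y * s y ^ p)) sums integral UNIV (\<lambda>y. Ser kc y (s y))"
    and Sq: "(\<lambda>p. integral UNIV (\<lambda>y. qc p y * s y ^ p)) sums integral UNIV (\<lambda>y. Ser qc y (s y))"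
    and St: "(\<lambda>p. integral UNIV (\<lambda>y. tc p y * s y ^ p)) sums integral UNIV (\<lambda>y. Ser tc y (s y))"
    by (rule Ser_integral_sums(1)[OF tk V(1) S z0(1) sc s(3)] Ser_integral_sums(1)[OF tq V(1) S z0(2) sc s(3)]
        Ser_integral_sums(1)[OF tt V(1) S z0(3) sc s(3)]; assumption)+
  define K where "K p = integral UNIV (\<lambda>y. kc p y * s y ^ p)" for p
  define Q where "Q p = integral UNIV (\<lambda>y. qc p y * s y ^ p)" for p
  define T where "T p = integral UNIV (\<lambda>y. tc p y * s y ^ p)" for p
  \<comment> \<open>Green's identity for Laplacian^p f: T p pairs Laplacian^(p+1) f with G_p, and
    the subtracted term pairs Laplacian^p f with D G_p = G_(p-1), which is T (p-1), or 0 for p =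
    0.\<close>
  have step: "K p = T p - (case p of 0 \<Rightarrow> 0 | Suc q \<Rightarrow> T q) + 4 * c * Q p" for p
  proof -
    have e1: "(\<lambda>y. h p y * (W1 u1 z y * ee p (Suc m) (of_real (kA1 m p)) (of_real (kB1 m p)) (s y) (l y)
        + W2 u1 u2 y * ee p m (of_real (kA m p)) (of_real (kB m p)) (s y) (l y))) = (\<lambda>y. kc p y * s y ^ p)"
      by (simp add: fun_eq_iff kc_def ee_def cf_def h_def divide_inverse power_inverse algebra_simps)
    have e2: "(\<lambda>y. laplacian (h p) y * (of_real (u0 (y \<bullet> y)) * ee p m (of_real (kA m p)) (of_real (kB m p)) (s y) (l y)))
        = (\<lambda>y. tc p y * s y ^ p)"
      by (simp add: fun_eq_iff tc_def ee_def cf_def h_def r \<psi>_def divide_inverse power_inverse algebra_simps)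
    have e3: "(\<lambda>y. h p y * (of_real (u0 (y \<bullet> y)) * ee p (Suc (Suc m)) (of_real (kA2 m p)) (of_real (kB2 m p)) (s y) (l y)))
        = (\<lambda>y. qc p y * s y ^ p)"
      by (simp add: fun_eq_iff qc_def ee_def cf_def h_def \<psi>_def divide_inverse power_inverse algebra_simps)
    have "(\<lambda>y. h p y * (of_real (u0 (y \<bullet> y)) * ee p (Suc m) (of_real (rA p)) (of_real (rB p)) (s y) (l y)))
      = (\<lambda>y. case p of 0 \<Rightarrow> 0 | Suc q \<Rightarrow> tc q y * s y ^ q)"
    proof
      fix y
      show "h p y * (of_real (u0 (y \<bullet> y)) * ee p (Suc m) (of_real (rA p)) (of_real (rB p)) (s y) (l y))
        = (case p of 0 \<Rightarrow> 0 | Suc q \<Rightarrow> tc q y * s y ^ q)"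
      proof (cases "y \<in> S")
        case True
        then have "s y \<noteq> 0" using s(2) S by auto
        then show ?thesis
          by (cases p) (simp_all add: r0 ee_def tc_def cf_def h_def \<psi>_def field_simps)
      next
        case False
        then show ?thesis using z[OF False] z0(3)[OF False] by (simp split: nat.split)
      qed
    qed
    then have e4: "integral UNIV (\<lambda>y. h p y * (of_real (u0 (y \<bullet> y)) * ee p (Suc m) (of_real (rA p)) (of_real (rB p)) (s y) (l y)))
      = (case p of 0 \<Rightarrow> 0 | Suc q \<Rightarrow> T q)" by (simp only:) (simp add: T_def split: nat.split)
    have *: "complex_of_real (kA1 m p) = (of_nat p - of_nat m) * of_real (kA m p)"
      "complex_of_real (kB1 m p) = (of_nat p - of_nat m) * of_real (kB m p) + of_real (kA m p)"
      "complex_of_real (kA2 m p) = (of_nat p - of_nat (Suc m)) * of_real (kA1 m p)"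
      "complex_of_real (kB2 m p) = (of_nat p - of_nat (Suc m)) * of_real (kB1 m p) + of_real (kA1 m p)"
      "complex_of_real (rA p) = 4 * of_nat p * (of_nat p - of_nat m) * of_real (kA m p)"
      "complex_of_real (rB p) = 4 * of_nat p * (of_nat p - of_nat m) * of_real (kB m p)
        + 4 * (2 * of_nat p - of_nat m) * of_real (kA m p)"
      by (simp_all add: kA1_def kB1_def kA2_def kB2_def rA_def rB_def)
    show ?thesis
      using green_term[OF open_G hs[of p] V S \<sigma> z s(1,2) l dim *]
      unfolding e1 e2 e3 e4 K_def Q_def T_def by simp
  qed
  have "(\<Sum>p<Suc N. K p) = T N + 4 * c * (\<Sum>p<Suc N. Q p)" for N
    by (induction N) (simp_all add: step algebra_simps)
  then have eq: "(\<lambda>N. \<Sum>p<Suc N. K p) = (\<lambda>N. T N + 4 * c * (\<Sum>p<Suc N. Q p))" by auto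
  have "(\<lambda>N. \<Sum>p<Suc N. K p) \<longlonglongrightarrow> integral UNIV (\<lambda>y. Ser kc y (s y))"
    using Sk unfolding sums_def K_def by (rule LIMSEQ_Suc)
  moreover have "(\<lambda>N. T N + 4 * c * (\<Sum>p<Suc N. Q p)) \<longlonglongrightarrow> 0 + 4 * c * integral UNIV (\<lambda>y. Ser qc y (s y))"
    using Sq St unfolding sums_def Q_def T_def
    by (intro tendsto_intros LIMSEQ_Suc summable_LIMSEQ_zero[OF sums_summable]) (auto simp: sums_def)
  ultimately have main: "integral UNIV (\<lambda>y. Ser kc y (s y)) = 4 * c * integral UNIV (\<lambda>y. Ser qc y (s y))"
    unfolding eq using LIMSEQ_unique by fastforce
  have "Ser kc y (s y) = Ker u1 u2 z y (s y) (l y)" for y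
  proof (cases "y \<in> S")
    case True
    then have y: "y \<in> V" using S by auto
    show ?thesis unfolding kc_def[abs_def] Ker_def mult.assoc[symmetric]
      by (subst Ser_add[OF tame_comb[OF tame_k(3,4) V(2) _ l(1)] tame_comb[OF tame_k(1,2) V(2) _ l(1)] y s(3)[OF y]]
          Ser_comb[OF tame_k(3,4) V(2) y s(3)[OF y] _ l(1)] Ser_comb[OF tame_k(1,2) V(2) y s(3)[OF y] _ l(1)];
          (intro continuous_on_mult cW isc)?)+ (simp add: algebra_simps)
  next
    case False
    then show ?thesis using z[OF False] z0(1)[OF False] by (simp add: Ser_def Ker_zero)
  qed
  moreover have "Ser qc y (s y) = (\<psi> y * inverse (s y) ^ (m + 2)) * (l y * Ser (cf (kA2 m)) y (s y) + Ser (cf (kB2 m)) y (s y))" for y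
  proof (cases "y \<in> S")
    case True
    then have y: "y \<in> V" using S by auto
    show ?thesis unfolding qc_def[abs_def]
      by (rule Ser_comb[OF tame_k(5,6) V(2) y s(3)[OF y] _ l(1)]) (intro continuous_on_mult \<psi>c isc)
  next
    case False
    then show ?thesis using z[OF False] z0(2)[OF False] by (simp add: Ser_def \<psi>_def)
  qed
  ultimately show ?thesis using main by (simp add: \<psi>_def)
qed

end

subsection \<open>An approximate identity\<close>

lemma csupp_prod:
  fixes k :: "'a::topological_space \<Rightarrow> 'b::euclidean_space \<Rightarrow> 'c::real_normed_vector"
  assumes "open T" "open V" "compact S" "S \<subseteq> V" "continuous_on (T \<times> V) (\<lambda>(t, y). k t y)"
    "\<And>t y. y \<notin> S \<Longrightarrow> k t y = 0"
  shows "continuous_on (T \<times> UNIV) (\<lambda>(t, y). k t y)"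
proof -
  have "continuous_on (T \<times> (-S)) (\<lambda>(t, y). k t y)"
    by (subst continuous_on_cong[OF refl, where g="\<lambda>_. 0"]) (use assms(6) in auto)
  then have "continuous_on (T \<times> V \<union> T \<times> (-S)) (\<lambda>(t, y). k t y)"
    using assms by (intro continuous_on_open_Un open_Times) (auto intro: compact_imp_closed)
  moreover have "T \<times> V \<union> T \<times> (-S) = T \<times> UNIV" using assms(4) by auto
  ultimately show ?thesis by simp
qed

lemma csupp_integral_continuous:
  fixes k :: "'a::topological_space \<Rightarrow> 'b::euclidean_space \<Rightarrow> 'c::banach"
  assumes "open T" "open V" "compact S" "S \<subseteq> V" "continuous_on (T \<times> V) (\<lambda>(t, y). k t y)"
    "\<And>t y. y \<notin> S \<Longrightarrow> k t y = 0"
  shows "continuous_on T (\<lambda>t. integral UNIV (k t))"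
proof -
  obtain a where a: "S \<subseteq> cbox (-a) a" using compact_subset_cbox[OF assms(3)] by blast
  have "continuous_on T (\<lambda>t. integral (cbox (-a) a) (k t))"
    by (rule integral_continuous_on_param[OF continuous_on_subset[OF csupp_prod[OF assms]]]) auto
  moreover have "integral UNIV (k t) = integral (cbox (-a) a) (k t)" for t
    by (rule integral_UNIV_cbox) (use a assms(6) in blast)
  ultimately show ?thesis by simp
qed

text \<open>A constant multiple of t^2 G_0''(|u|^2 + t^2). Substituting u = t v produces the power
  t^(2 + (2m+2) - 2(m+2)) = 1, so in dimension 2m + 2 the total mass does not depend on t.\<close>

definition wgt :: "nat \<Rightarrow> real \<Rightarrow> real^'n::finite \<Rightarrow> real" where
  "wgt m t u = t\<^sup>2 / (u \<bullet> u + t\<^sup>2) ^ (m + 2)"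

lemma wgt_nonneg: "wgt m t u \<ge> 0"
  by (simp add: wgt_def)

lemma wgt_continuous:
  assumes "t \<noteq> 0"
  shows "continuous_on A (wgt m t)"
proof -
  have "u \<bullet> u + t\<^sup>2 \<noteq> 0" for u :: "real^'n" using assms
    by (metis add_nonneg_eq_0_iff inner_ge_zero power_eq_0_iff zero_le_power2)
  then show ?thesis unfolding wgt_def[abs_def] by (intro continuous_intros) auto
qed

lemma wgt_mass_lower:
  fixes b :: "real^'n::finite \<Rightarrow> real"
  assumes dim: "CARD('n) = 2 * m + 2" and b: "csupp S b" "compact S" "\<And>u. b u \<ge> 0" "\<And>u. norm u \<le> 1 \<Longrightarrow> b u = 1"
    and t: "0 < t" "t < 1"
  shows "(2 / real CARD('n)) ^ CARD('n) / 2 ^ (m + 2) \<le> integral UNIV (\<lambda>u. wgt m t u * b u)"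
proof -
  define d where "d = real CARD('n)"
  have d: "d > 0" using dim by (simp add: d_def)
  define a :: "real^'n" where "a = (\<chi> i. t / d)"
  have cs: "csupp S (\<lambda>u. wgt m t u * b u)"
    using b(1) wgt_continuous[of t UNIV m] t unfolding csupp_def by (auto intro!: continuous_intros)
  have ne: "cbox (-a) a \<noteq> {}" using t d by (auto simp: interval_ne_empty_cart a_def)
  have "measure lborel (cbox (-a) a) = (\<Prod>i\<in>(UNIV::'n set). 2 * t / d)"
    unfolding content_cbox_cart[OF ne] by (simp add: a_def)
  then have cont: "measure lborel (cbox (-a) a) = (2 * t / d) ^ CARD('n)" by simp
  have lower: "t\<^sup>2 / (2 * t\<^sup>2) ^ (m + 2) \<le> wgt m t u * b u" if "u \<in> cbox (-a) a" for u
  proof -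
    have "\<bar>u $ i\<bar> \<le> t / d" for i using that by (auto simp: mem_box_cart a_def abs_le_iff minus_le_iff)
    then have "norm u \<le> (\<Sum>i\<in>(UNIV::'n set). t / d)"
      by (intro order_trans[OF norm_le_l1_cart] sum_mono)
    then have n: "norm u \<le> t" using d by (simp add: d_def)
    then have "u \<bullet> u \<le> t\<^sup>2" unfolding power2_norm_eq_inner[symmetric] by (intro power_mono) auto
    then have "(u \<bullet> u + t\<^sup>2) ^ (m + 2) \<le> (2 * t\<^sup>2) ^ (m + 2)" by (intro power_mono) auto
    moreover have "(u \<bullet> u + t\<^sup>2) ^ (m + 2) > 0" using t by (intro zero_less_power add_nonneg_pos) auto
    ultimately show ?thesis using b(4)[of u] n t by (simp add: wgt_def frac_le del: power_Suc power_add)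
  qed
  have "(2 / real CARD('n)) ^ CARD('n) / 2 ^ (m + 2) = measure lborel (cbox (-a) a) * (t\<^sup>2 / (2 * t\<^sup>2) ^ (m + 2))"
  proof -
    have "(2 * t / d) ^ CARD('n) = (2 / d) ^ CARD('n) * (t\<^sup>2) ^ (m + 1)"
      by (simp add: dim power_divide power_mult_distrib flip: power_mult power_add)
    moreover have "t\<^sup>2 / (2 * t\<^sup>2) ^ (m + 2) = 1 / (2 ^ (m + 2) * (t\<^sup>2) ^ (m + 1))"
      using t by (simp add: power_mult_distrib field_simps)
    ultimately show ?thesis unfolding cont using t by (simp add: d_def)
  qed
  also have "\<dots> = integral (cbox (-a) a) (\<lambda>_. t\<^sup>2 / (2 * t\<^sup>2) ^ (m + 2))" by simp
  also have "\<dots> \<le> integral (cbox (-a) a) (\<lambda>u. wgt m t u * b u)"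
    using lower by (intro integral_le csupp_integrable_cbox[OF cs]) auto
  also have "\<dots> \<le> integral UNIV (\<lambda>u. wgt m t u * b u)"
    using cs b(3)
    by (intro integral_subset_le csupp_integrable[OF cs b(2)] csupp_integrable_cbox[OF cs]) (auto simp: wgt_nonneg)
  finally show ?thesis .
qed

section \<open>The constant function 1 as test case, and logarithms of the regularised
  distance\<close>

lemma laplacian_const: "laplacian (\<lambda>_. c) = (\<lambda>_. 0)"
  by (simp add: laplacian_def fun_eq_iff has_pd_pdiff[OF has_pd_const] has_pd_pdiff[OF has_pd_const, abs_def])

lemma pdiffs_const: "\<exists>d. pdiffs is (\<lambda>_. c) = (\<lambda>_. d)"
  by (induction "is") (auto simp: has_pd_pdiff[OF has_pd_const, abs_def])

lemma laplacian_funpow_const: "(laplacian ^^ Suc p) (\<lambda>_. c) = (\<lambda>_. 0)"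
  by (induction p) (simp_all add: laplacian_const)

lemma polyharmonic_inf_const: "polyharmonic_inf UNIV 0 (\<lambda>_. 1)"
  unfolding polyharmonic_inf_def smooth_on_def
proof (intro conjI allI impI ballI)
  fix "is" and x :: "real^'n" and i
  obtain d where d: "pdiffs is (\<lambda>_::real^'n. 1) = (\<lambda>_. d)" using pdiffs_const by blast
  show "continuous_on UNIV (pdiffs is (\<lambda>_::real^'n. 1))"
    "(\<lambda>t. pdiffs is (\<lambda>_. 1) (x + t *\<^sub>R axis i 1)) differentiable at 0" by (simp_all add: d)
next
  fix K :: "(real^'n) set" and \<epsilon> :: real assume "0 < \<epsilon>"
  then have "cmod ((laplacian ^^ p) (\<lambda>_. 1) x) \<le> 1 * fact (2 * p) * (0 + \<epsilon>) ^ (2 * p)" for p and x :: "real^'n"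
    by (cases p) (simp_all add: laplacian_funpow_const del: funpow.simps)
  then show "\<exists>C>0. \<forall>p. \<forall>x\<in>K. cmod ((laplacian ^^ p) (\<lambda>_. 1) x) \<le> C * fact (2 * p) * (0 + \<epsilon>) ^ (2 * p)"
    by (intro exI[of _ 1]) auto
qed

lemma qf_cembed_diff: "qf (cembed x - cembed y) = of_real ((x - y) \<bullet> (x - y))"
  by (simp add: qf_cembed power2_norm_eq_inner flip: cembed_diff)

lemma has_pd_Ln_qf:
  assumes "qf (z - cembed y) + c \<notin> \<real>\<^sub>\<le>\<^sub>0"
  shows "has_pd i (\<lambda>y. Ln (qf (z - cembed y) + c)) (- 2 * (z $ i - of_real (y $ i)) / (qf (z - cembed y) + c)) y"
  using has_pd_chain[OF has_pd_qf has_field_derivative_Ln[OF assms], of i]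
  by (simp add: divide_inverse)

lemma has_pd_ln_dist:
  fixes x y :: "real^'n::finite"
  assumes "c > 0"
  shows "has_pd i (\<lambda>y. of_real (ln ((x - y) \<bullet> (x - y) + c)))
    (- 2 * (cembed x $ i - of_real (y $ i)) / of_real ((x - y) \<bullet> (x - y) + c)) y"
proof -
  have pos: "(x - y) \<bullet> (x - y) + c > 0" for y using assms by (simp add: add_nonneg_pos)
  have e: "qf (cembed x - cembed y) + of_real c = of_real ((x - y) \<bullet> (x - y) + c)" for y
    by (simp add: qf_cembed_diff)
  show ?thesis
    using has_pd_Ln_qf[of "cembed x" y "of_real c" i] pos[of y] Ln_of_real[OF pos]
    unfolding e by (simp add: complex_nonpos_Reals_iff del: of_real_add)
qed

subsection \<open>Reproduction of the function from the kernel\<close>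

text \<open>Covers the point y = x, t = 0, where the logarithm in \<open>dens\<close> is tamed by a
  factor r.\<close>

lemma continuous_on_x_ln_x: "continuous_on {0::real..} (\<lambda>r. r * ln r)"
  unfolding continuous_on_eq_continuous_within
proof
  fix r :: real assume r: "r \<in> {0..}"
  show "continuous (at r within {0..}) (\<lambda>r. r * ln r)"
  proof (cases "r = 0")
    case True
    have "((\<lambda>r::real. r * ln r) \<longlongrightarrow> 0) (at_right 0)" by real_asymp
    then show ?thesis using True by (simp add: continuous_within at_within_Ici_at_right)
  next
    case False
    then show ?thesis by (intro continuous_intros) auto
  qed
qed

text \<open>This is r^(m+2) \<psi>(y) times the sum of (Laplacian^p f)(y) G_p''(r). By
  \<open>kA2_0\<close> the logarithmic series starts at p = 1, so a factor r can be moved to the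
  logarithm and the result is continuous even at y = x, t = 0; there it equals kappa f(x) when
  \<psi>(x) = 1.\<close>

definition (in polyharmonic) dens :: "(real \<Rightarrow> real) \<Rightarrow> real^'n \<Rightarrow> real \<Rightarrow> real^'n \<Rightarrow> complex" where
  "dens u0 x t y = (let r = (x - y) \<bullet> (x - y) + t\<^sup>2 in of_real (u0 (y \<bullet> y)) *
     (of_real (r * ln r) * Ser (\<lambda>p. cf (kA2 m) (Suc p)) y (of_real r) + Ser (cf (kB2 m)) y (of_real r)))"

text \<open>\<open>Ker_integral\<close> with c = t^2. The integrand on its right side factors into
  \<open>wgt\<close>, which concentrates at x, and \<open>dens\<close>, which stays continuous as t
  tends to 0.\<close>

lemma (in polyharmonic) Ker_integral_dens:
  fixes x :: "real^'n" and t :: real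
  defines "r \<equiv> \<lambda>y. (x - y) \<bullet> (x - y) + t\<^sup>2"
  assumes V: "open V" "V \<subseteq> G" and S: "compact S" "S \<subseteq> V"
    and \<sigma>: "C2_fun u0 u1 u2"
    and z: "\<And>y. y \<notin> S \<Longrightarrow> u0 (y \<bullet> y) = 0 \<and> u1 (y \<bullet> y) = 0 \<and> u2 (y \<bullet> y) = 0"
    and t: "t \<noteq> 0" and type: "\<And>y. y \<in> V \<Longrightarrow> \<tau>\<^sup>2 * r y < 1"
  shows "integral UNIV (\<lambda>y. Ker u1 u2 (cembed x) y (of_real (r y)) (of_real (ln (r y))))
    = 4 * integral UNIV (\<lambda>y. of_real (wgt m t (x - y)) * dens u0 x t y)"
proof -
  have pos: "r y > 0" for y using t by (simp add: r_def add_nonneg_pos)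
  have b: "\<tau>\<^sup>2 * cmod (of_real (r y)) < 1" if "y \<in> V" for y
    using type[OF that] pos[of y] by simp
  define k where "k y = (of_real (u0 (y \<bullet> y)) * inverse (of_real (r y)) ^ (m + 2)) *
    (of_real (ln (r y)) * Ser (cf (kA2 m)) y (of_real (r y)) + Ser (cf (kB2 m)) y (of_real (r y)))" for y
  have eq: "of_real (t\<^sup>2) * k y = of_real (wgt m t (x - y)) * dens u0 x t y" for y
  proof (cases "y \<in> S")
    case True
    then have y: "y \<in> V" "y \<in> G" using S V by auto
    have A: "Ser (cf (kA2 m)) y (of_real (r y)) = of_real (r y) * Ser (\<lambda>p. cf (kA2 m) (Suc p)) y (of_real (r y))"
      using Ser_split_head[OF tame_k(5) y(2) b[OF y(1)]] by (simp add: cf_def kA2_0)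
    have w: "wgt m t (x - y) = t\<^sup>2 * inverse (r y) ^ (m + 2)"
      by (simp only: wgt_def r_def divide_inverse power_inverse)
    have d: "dens u0 x t y = of_real (u0 (y \<bullet> y)) * (of_real (r y * ln (r y)) *
        Ser (\<lambda>p. cf (kA2 m) (Suc p)) y (of_real (r y)) + Ser (cf (kB2 m)) y (of_real (r y)))"
      by (simp add: dens_def r_def Let_def)
    show ?thesis unfolding k_def A d w by (simp add: mult_ac del: power_Suc power_add)
  next
    case False
    then show ?thesis using z by (simp add: k_def dens_def)
  qed
  have "integral UNIV (\<lambda>y. Ker u1 u2 (cembed x) y (of_real (r y)) (of_real (ln (r y))))
    = 4 * of_real (t\<^sup>2) * integral UNIV k"
    unfolding k_def
  proof (rule Ker_integral[OF V S \<sigma> z])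
    show "of_real (r y) = qf (cembed x - cembed y) + of_real (t\<^sup>2)" for y
      by (simp add: r_def qf_cembed_diff)
    show "continuous_on V (\<lambda>y. of_real (ln (r y)) :: complex)"
      using less_imp_neq[OF pos, symmetric] unfolding r_def by (intro continuous_intros) auto
    show "complex_of_real (r y) \<noteq> 0" for y using pos[of y] by simp
    show "has_pd i (\<lambda>y. of_real (ln (r y))) (- 2 * (cembed x $ i - of_real (y $ i)) / of_real (r y)) y" for i y
      unfolding r_def by (rule has_pd_ln_dist) (use t in simp)
  qed (use b in auto)
  also have "\<dots> = 4 * integral UNIV (\<lambda>y. of_real (t\<^sup>2) * k y)" by (simp only: mult.assoc integral_mult_right)
  finally show ?thesis unfolding eq .
qed

text \<open>Green's identity is applied with t > 0, where s has no zero. The kernel side lives on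
  S1, away from x, and is therefore continuous in t up to t = 0.\<close>

lemma (in polyharmonic) dens_integral_limit:
  assumes S: "compact S" "S \<subseteq> G"
    and \<sigma>: "C2_fun u0 u1 u2"
    and z: "\<And>y. y \<notin> S \<Longrightarrow> u0 (y \<bullet> y) = 0 \<and> u1 (y \<bullet> y) = 0 \<and> u2 (y \<bullet> y) = 0"
    and xS: "x \<in> S"
    and S1: "compact S1" "S1 \<subseteq> S - {x}" "\<And>y. y \<notin> S1 \<Longrightarrow> u1 (y \<bullet> y) = 0 \<and> u2 (y \<bullet> y) = 0"
    and type: "\<And>y. y \<in> S \<Longrightarrow> \<tau>\<^sup>2 * ((x - y) \<bullet> (x - y)) < 1"
  obtains e0 V where "e0 > 0" "open V" "S \<subseteq> V"
    "continuous_on ({-e0<..<e0} \<times> V) (\<lambda>(t, y). dens u0 x t y)"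
    "((\<lambda>t. 4 * integral UNIV (\<lambda>y. of_real (wgt m t (x - y)) * dens u0 x t y)) \<longlongrightarrow>
      integral UNIV (\<lambda>y. Ker u1 u2 (cembed x) y (of_real ((x - y) \<bullet> (x - y))) (of_real (ln ((x - y) \<bullet> (x - y)))))) (at_right 0)"
proof -
  obtain y0 where y0: "y0 \<in> S" "\<And>y. y \<in> S \<Longrightarrow> \<tau>\<^sup>2 * ((x - y) \<bullet> (x - y)) \<le> \<tau>\<^sup>2 * ((x - y0) \<bullet> (x - y0))"
  proof -
    have "continuous_on S (\<lambda>y. \<tau>\<^sup>2 * ((x - y) \<bullet> (x - y)))" by (intro continuous_intros)
    then show ?thesis using continuous_attains_sup[OF S(1)] xS that by blast
  qed
  \<comment> \<open>By compactness the type bound holds on S with a margin, part of which is spent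
    on the additional e0^2.\<close>
  define M where "M = \<tau>\<^sup>2 * ((x - y0) \<bullet> (x - y0))"
  have M: "M < 1" "\<And>y. y \<in> S \<Longrightarrow> \<tau>\<^sup>2 * ((x - y) \<bullet> (x - y)) \<le> M"
    using type[OF y0(1)] y0(2) by (simp_all add: M_def)
  obtain e0 where e0: "M + \<tau>\<^sup>2 * e0\<^sup>2 < 1" "e0 > 0"
    by (rule exists_right_less[of "\<lambda>e. M + \<tau>\<^sup>2 * e\<^sup>2" 0 1]) (use M in \<open>auto intro!: tendsto_eq_intros\<close>)
  define V where "V = {y \<in> G. \<tau>\<^sup>2 * ((x - y) \<bullet> (x - y) + e0\<^sup>2) < 1}"
  have V: "open V" "V \<subseteq> G" unfolding V_def
    by (auto intro!: open_Collect_conj open_Collect_less continuous_intros open_G simp: open_G[unfolded Collect_mem_eq])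
  have SV: "S \<subseteq> V"
  proof
    fix y assume y: "y \<in> S"
    show "y \<in> V" using M(2)[OF y] e0(1) S(2) y by (auto simp: V_def distrib_left)
  qed
  define r where "r t y = (x - y) \<bullet> (x - y) + t\<^sup>2" for t :: real and y
  let ?T = "{-e0<..<e0}"
  have rb: "\<tau>\<^sup>2 * r t y < 1" "r t y \<ge> 0" if "t \<in> ?T" "y \<in> V" for t y
  proof -
    have "t\<^sup>2 \<le> e0\<^sup>2" using that(1) by (intro power2_le_iff_abs_le[THEN iffD2]) (auto simp: e0(2) less_imp_le abs_le_iff)
    then have "\<tau>\<^sup>2 * r t y \<le> \<tau>\<^sup>2 * ((x - y) \<bullet> (x - y) + e0\<^sup>2)" unfolding r_def by (intro mult_left_mono) auto
    then show "\<tau>\<^sup>2 * r t y < 1" using that(2) by (auto simp: V_def)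
    show "r t y \<ge> 0" by (simp add: r_def)
  qed
  define J where "J t = integral UNIV (\<lambda>y. Ker u1 u2 (cembed x) y (of_real (r t y)) (of_real (ln (r t y))))" for t
  have dens: "dens u0 x t y = of_real (u0 (y \<bullet> y)) *
     (of_real (r t y * ln (r t y)) * Ser (\<lambda>p. cf (kA2 m) (Suc p)) y (of_real (r t y))
      + Ser (cf (kB2 m)) y (of_real (r t y)))" for t y
    by (simp add: dens_def r_def Let_def)
  have rc: "continuous_on A (\<lambda>p. r (fst p) (snd p))" for A
    unfolding r_def by (intro continuous_intros)
  have Jc: "continuous_on ?T J" unfolding J_def[abs_def]
  proof (rule csupp_integral_continuous[where V="V - {x}" and S=S1])
    show "open (V - {x})" using V(1) by auto
    show "compact S1" "S1 \<subseteq> V - {x}" using S1 SV by auto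
    have p: "r t y > 0" if "y \<noteq> x" for t y using that by (simp add: r_def add_pos_nonneg)
    show "continuous_on (?T \<times> (V - {x})) (\<lambda>(t, y). Ker u1 u2 (cembed x) y (of_real (r t y)) (of_real (ln (r t y))))"
      unfolding case_prod_unfold
    proof (rule Ker_continuous[OF \<sigma> continuous_on_snd[OF continuous_on_id]])
      show "continuous_on (?T \<times> (V - {x})) (\<lambda>p. complex_of_real (r (fst p) (snd p)))"
        by (intro continuous_intros rc)
      show "continuous_on (?T \<times> (V - {x})) (\<lambda>p. complex_of_real (ln (r (fst p) (snd p))))"
        using less_imp_neq[OF p, symmetric] by (intro continuous_intros rc) auto
      fix p assume "p \<in> ?T \<times> (V - {x})"
      then show "snd p \<in> G \<and> \<tau>\<^sup>2 * cmod (of_real (r (fst p) (snd p))) < 1 \<and> complex_of_real (r (fst p) (snd p)) \<noteq> 0"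
        using V(2) rb[of "fst p" "snd p"] less_imp_neq[OF p, symmetric, of "snd p" "fst p"] by auto
    qed
    show "Ker u1 u2 (cembed x) y (of_real (r t y)) (of_real (ln (r t y))) = 0" if "y \<notin> S1" for t y
      using S1(3)[OF that] by (intro Ker_zero) auto
  qed auto
  have Hc: "continuous_on (?T \<times> V) (\<lambda>(t, y). dens u0 x t y)"
    unfolding case_prod_unfold dens
  proof (intro continuous_on_mult continuous_on_add Ser_cf_continuous tame_k tame_shift continuous_on_snd continuous_on_id)
    show "continuous_on (?T \<times> V) (\<lambda>p. complex_of_real (u0 (snd p \<bullet> snd p)))"
      by (intro continuous_intros C2_fun_continuous(1)[OF \<sigma>, THEN continuous_on_compose2] subset_UNIV)
    have "continuous_on (?T \<times> V) (\<lambda>p. r (fst p) (snd p) * ln (r (fst p) (snd p)))"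
      by (rule continuous_on_compose2[OF continuous_on_x_ln_x rc]) (use rb in auto)
    then show "continuous_on (?T \<times> V) (\<lambda>p. complex_of_real (r (fst p) (snd p) * ln (r (fst p) (snd p))))"
      by (rule continuous_on_of_real)
    show "continuous_on (?T \<times> V) (\<lambda>p. complex_of_real (r (fst p) (snd p)))"
      "continuous_on (?T \<times> V) (\<lambda>p. complex_of_real (r (fst p) (snd p)))"
      by (intro continuous_on_of_real rc)+
  qed (use V(2) rb in auto)
  have J: "J t = 4 * integral UNIV (\<lambda>y. of_real (wgt m t (x - y)) * dens u0 x t y)" if "t \<in> {0<..<e0}" for t
    unfolding J_def r_def
    by (rule Ker_integral_dens[OF V S(1) SV \<sigma> z]) (use rb that e0(2) in \<open>auto simp: r_def\<close>)
  have "isCont J 0" using Jc e0(2) by (simp add: continuous_on_eq_continuous_at)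
  then have "(J \<longlongrightarrow> J 0) (at_right 0)" unfolding isCont_def by (rule filterlim_mono) (auto simp: at_le)
  then have "((\<lambda>t. 4 * integral UNIV (\<lambda>y. of_real (wgt m t (x - y)) * dens u0 x t y)) \<longlongrightarrow> J 0) (at_right 0)"
    by (rule Lim_transform_eventually)
      (use eventually_at_right_real[OF e0(2)] J in \<open>auto elim!: eventually_mono\<close>)
  then show ?thesis by (intro that[OF e0(2) V(1) SV Hc]) (simp add: J_def r_def)
qed

definition bump_limit :: "nat \<Rightarrow> real \<Rightarrow> (real^'n::finite \<Rightarrow> real) \<Rightarrow> bool" where
  "bump_limit m C b \<longleftrightarrow> C > 0 \<and> csupp (cball 0 2) b \<and> (\<forall>u. b u \<ge> 0) \<and> (\<forall>u. norm u \<le> 1 \<longrightarrow> b u = 1) \<and>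
     ((\<lambda>t. integral UNIV (\<lambda>u. wgt m t u * b u)) \<longlongrightarrow> C) (at_right 0)"

text \<open>The limit mass exists, because the summed Green identity for the constant function 1
  rewrites it as an integral over the support of the derivative of the bump.\<close>

lemma (in polyharmonic) bump_limit_exists:
  assumes one: "G = UNIV" "f = (\<lambda>_. 1)" "\<tau> = 0"
  obtains C and b :: "real^'n \<Rightarrow> real" where "bump_limit m C b"
proof -
  obtain v0 v1 v2 where \<rho>: "C2_step 1 4 v0 v1 v2" using C2_step_exists[of 1 4] by auto
  define u0 u1 u2 where "u0 t = 1 - v0 t" and "u1 t = 0 - v1 t" and "u2 t = 0 - v2 t" for t
  have \<sigma>: "C2_fun u0 u1 u2"
    using C2_fun_diff[OF C2_fun_const] \<rho> by (simp add: C2_step_def u0_def[abs_def] u1_def[abs_def] u2_def[abs_def])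
  have far: "u0 (u \<bullet> u) = 0 \<and> u1 (u \<bullet> u) = 0 \<and> u2 (u \<bullet> u) = 0" if "u \<notin> cball 0 2" for u :: "real^'n"
  proof -
    have "2\<^sup>2 \<le> (norm u)\<^sup>2" using that by (intro power_mono) auto
    then have "u \<bullet> u \<ge> 4" by (simp add: power2_norm_eq_inner)
    then show ?thesis using \<rho> by (simp add: C2_step_def u0_def u1_def u2_def)
  qed
  have le1: "u \<bullet> u \<le> 1" if "norm u \<le> 1" for u :: "real^'n"
    using power_mono[OF that, of 2] by (simp add: power2_norm_eq_inner)
  define b where "b u = u0 (u \<bullet> u)" for u :: "real^'n"
  have b1: "b u = 1" if "norm u \<le> 1" for u using le1[OF that] \<rho> by (simp add: b_def u0_def C2_step_def)
  have b0: "b u \<ge> 0" for u using \<rho> by (simp add: b_def u0_def C2_step_def)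
  have bc: "csupp (cball 0 2) b"
    using far unfolding csupp_def b_def[abs_def]
    by (auto intro!: continuous_intros C2_fun_continuous(1)[OF \<sigma>, THEN continuous_on_compose2])
  have cf: "cf a p y = of_real (a p) * (laplacian ^^ p) (\<lambda>_. 1) y" for a p y
    unfolding cf_def by (simp add: one)
  \<comment> \<open>All Laplacians of 1 vanish, so only the term p = 0 survives; the offset k = 1 is
    the shifted logarithmic series of \<open>dens\<close>, which drops out.\<close>
  have Ser: "Ser (\<lambda>p. cf a (k + p)) y s = (if k = 0 then of_real (a 0) else 0)" for a k y s
  proof -
    have "cf a (k + p) y * s ^ p = 0" if "p \<notin> {0}" for p
      using that by (cases p) (simp_all add: cf laplacian_funpow_const del: funpow.simps)
    then have "Ser (\<lambda>p. cf a (k + p)) y s = (\<Sum>p\<in>{0}. cf a (k + p) y * s ^ p)"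
      unfolding Ser_def by (intro suminf_finite) auto
    then show ?thesis by (cases k) (simp_all add: cf laplacian_funpow_const del: funpow.simps)
  qed
  have dens: "dens u0 0 t y = of_real (kappa m * b y)" for t y
    using Ser[of "kA2 m" 1] Ser[of "kB2 m" 0] by (simp add: dens_def b_def kB2_0)
  define S1 where "S1 = cball 0 2 - ball (0::real^'n) 1"
  define J where "J = integral UNIV (\<lambda>y. Ker u1 u2 (cembed 0) y (of_real ((0 - y) \<bullet> (0 - y))) (of_real (ln ((0 - y) \<bullet> (0 - y)))))"
  have S1: "compact S1" unfolding S1_def by (intro compact_diff) auto
  have S1': "S1 \<subseteq> cball 0 2 - {0}" by (auto simp: S1_def)
  have z1: "u1 (y \<bullet> y) = 0 \<and> u2 (y \<bullet> y) = 0" if "y \<notin> S1" for y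
    using that far[of y] le1[of y] \<rho> by (cases "norm y < 1") (auto simp: S1_def u1_def u2_def C2_step_def)
  have lim4: "((\<lambda>t. 4 * integral UNIV (\<lambda>y. of_real (wgt m t (0 - y)) * dens u0 0 t y)) \<longlongrightarrow> J) (at_right 0)"
    unfolding J_def by (rule dens_integral_limit[OF compact_cball _ \<sigma> far _ S1 S1' z1]) (auto simp: one)
  have J: "4 * integral UNIV (\<lambda>y. of_real (wgt m t (0 - y)) * dens u0 0 t y)
    = of_real (4 * kappa m * integral UNIV (\<lambda>u. wgt m t u * b u))" if "t > 0" for t
  proof -
    have cs: "csupp (cball 0 2) (\<lambda>u. wgt m t u * b u)"
      using bc wgt_continuous[of t UNIV m] that unfolding csupp_def by (auto intro!: continuous_intros)
    have "(\<lambda>y. of_real (wgt m t (0 - y)) * dens u0 0 t y) = (\<lambda>y. of_real (kappa m) * complex_of_real (wgt m t y * b y))"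
      by (simp add: dens wgt_def fun_eq_iff)
    moreover have "((\<lambda>u. complex_of_real (wgt m t u * b u)) has_integral of_real (integral UNIV (\<lambda>u. wgt m t u * b u))) UNIV"
      by (rule has_integral_of_real[OF csupp_has_integral[OF cs compact_cball]])
    ultimately show ?thesis by (simp add: integral_unique)
  qed
  have "((\<lambda>t. of_real (4 * kappa m * integral UNIV (\<lambda>u. wgt m t u * b u)) :: complex) \<longlongrightarrow> J) (at_right 0)"
    by (rule Lim_transform_eventually[OF lim4 eventually_mono[OF eventually_at_right_less[of 0] J]])
  then have "((\<lambda>t. Re (of_real (4 * kappa m * integral UNIV (\<lambda>u. wgt m t u * b u))) / (4 * kappa m))
      \<longlongrightarrow> Re J / (4 * kappa m)) (at_right 0)"
    by (intro tendsto_intros) (use kappa_nz in auto)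
  then have lim: "((\<lambda>t. integral UNIV (\<lambda>u. wgt m t u * b u)) \<longlongrightarrow> Re J / (4 * kappa m)) (at_right 0)"
    using kappa_nz[of m] by simp
  have "(2 / real CARD('n)) ^ CARD('n) / 2 ^ (m + 2) \<le> Re J / (4 * kappa m)"
  proof (rule tendsto_lowerbound[OF lim])
    have "\<forall>\<^sub>F t::real in at_right 0. t \<in> {0<..<1}" by (rule eventually_at_right_real) simp
    then show "\<forall>\<^sub>F t in at_right 0. (2 / real CARD('n)) ^ CARD('n) / 2 ^ (m + 2) \<le> integral UNIV (\<lambda>u. wgt m t u * b u)"
      by eventually_elim (rule wgt_mass_lower[OF dim bc compact_cball b0 b1], auto)
  qed auto
  moreover have "(2 / real CARD('n)) ^ CARD('n) / 2 ^ (m + 2) > 0" using dim by simp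
  ultimately have "Re J / (4 * kappa m) > 0" by linarith
  then show ?thesis using that bc b0 b1 lim unfolding bump_limit_def by blast
qed

lemma bump_mass:
  assumes "CARD('n::finite) = 2 * m + 2"
  obtains C and b :: "real^'n \<Rightarrow> real" where "bump_limit m C b"
proof -
  have "polyharmonic (UNIV :: (real^'n) set) (\<lambda>_. 1) 0 m"
    by unfold_locales (use assms polyharmonic_inf_const in auto)
  from polyharmonic.bump_limit_exists[OF this refl refl refl] show ?thesis using that by blast
qed

text \<open>H may vary with t, hence the joint continuity. After subtracting b(u) H(0, x) the
  remainder D is small near t = 0, u = 0, where the weight has bounded mass; elsewhere D is bounded
  and the weight is O(t^2). The bump makes the subtracted term compactly supported.\<close>

lemma approx_identity:
  fixes x :: "real^'n::finite" and b :: "real^'n \<Rightarrow> real" and H :: "real \<Rightarrow> real^'n \<Rightarrow> complex"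
  assumes bump: "bump_limit m C b"
    and e0: "t0 > 0" and V: "open V" and S: "compact S" "S \<subseteq> V"
    and H: "continuous_on ({-t0<..<t0} \<times> V) (\<lambda>(t, y). H t y)" "\<And>t y. y \<notin> S \<Longrightarrow> H t y = 0"
  shows "((\<lambda>t. integral UNIV (\<lambda>y. of_real (wgt m t (x - y)) * H t y)) \<longlongrightarrow> of_real C * H 0 x) (at_right 0)"
proof -
  have C: "C > 0" and b: "csupp (cball 0 2) b" "\<And>u. b u \<ge> 0" "\<And>u. norm u \<le> 1 \<Longrightarrow> b u = 1"
    and lim: "((\<lambda>t. integral UNIV (\<lambda>u. wgt m t u * b u)) \<longlongrightarrow> C) (at_right 0)"
    using bump by (auto simp: bump_limit_def)
  let ?T = "{-t0<..<t0}"
  have Hc: "continuous_on (?T \<times> UNIV) (\<lambda>(t, y). H t y)"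
    by (rule csupp_prod[OF _ V S H]) auto
  have Hc1: "continuous_on A (\<lambda>p. H (g p) (k p))" if "continuous_on A g" "continuous_on A k" "g ` A \<subseteq> ?T"
    for A :: "'z::topological_space set" and g k
    using continuous_on_compose2[OF Hc continuous_on_Pair[OF that(1,2)]] that(3) by force
  define D where "D t u = H t (u + x) - of_real (b u) * H 0 x" for t u
  define S' where "S' = (\<lambda>y. y - x) ` S \<union> cball 0 2"
  have S': "compact S'" unfolding S'_def
    by (intro compact_Un compact_continuous_image S continuous_intros compact_cball)
  have inS: "u + x \<in> S \<Longrightarrow> u \<in> S'" for u unfolding S'_def by (force intro: image_eqI[of _ _ "u + x"])
  have D0: "D t u = 0" if "u \<notin> S'" for t u
    using that inS[of u] H(2) b(1) by (auto simp: D_def S'_def csupp_def)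
  have Dc: "continuous_on (?T \<times> UNIV) (\<lambda>(t, u). D t u)"
    unfolding case_prod_unfold D_def
    by (intro continuous_intros Hc1 csupp_continuous_compose[OF b(1)]) auto
  obtain M where M: "M > 0" "\<And>t u. \<bar>t\<bar> \<le> t0 / 2 \<Longrightarrow> norm (D t u) \<le> M"
  proof -
    have "compact ((\<lambda>(t, u). D t u) ` ({-t0/2..t0/2} \<times> S'))"
      by (intro compact_continuous_image compact_Times S' continuous_on_subset[OF Dc]) (use e0 in auto)
    then obtain M where M: "M > 0" "\<And>z. z \<in> (\<lambda>(t, u). D t u) ` ({-t0/2..t0/2} \<times> S') \<Longrightarrow> norm z \<le> M"
      using compact_imp_bounded bounded_pos by metis
    have "norm (D t u) \<le> M" if "\<bar>t\<bar> \<le> t0 / 2" for t u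
    proof (cases "u \<in> S'")
      case True
      then have "(\<lambda>(t, u). D t u) (t, u) \<in> (\<lambda>(t, u). D t u) ` ({-t0/2..t0/2} \<times> S')"
        using that by (intro imageI) auto
      then show ?thesis using M(2) by force
    qed (use D0 M(1) in simp)
    then show ?thesis using that M(1) by blast
  qed
  obtain a where a: "S' \<subseteq> cbox (-a) a" using compact_subset_cbox[OF S'] by blast
  define L where "L = measure lborel (cbox (-a) a)"
  have L: "L \<ge> 0" by (simp add: L_def)
  have csb: "csupp (cball 0 2) (\<lambda>u. wgt m t u * b u)" if "t \<noteq> 0" for t
    using b(1) wgt_continuous[OF that, of UNIV m] unfolding csupp_def by (auto intro!: continuous_intros)
  have csD: "csupp S' (\<lambda>u. of_real (wgt m t u) * D t u)" if "t \<noteq> 0" "\<bar>t\<bar> < t0" for t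
    unfolding csupp_def
  proof (intro conjI allI impI)
    have c: "continuous_on UNIV (\<lambda>u. (t, u))" by (intro continuous_intros)
    have "continuous_on UNIV (\<lambda>u. (\<lambda>(t, u). D t u) (t, u))"
      by (rule continuous_on_compose2[OF Dc c]) (use that(2) in \<open>auto simp: abs_less_iff\<close>)
    then have "continuous_on UNIV (\<lambda>u. D t u)" by simp
    then show "continuous_on UNIV (\<lambda>u. of_real (wgt m t u) * D t u)"
      by (intro continuous_intros wgt_continuous[OF that(1)])
  qed (simp add: D0)
  have I0: "((\<lambda>t. integral UNIV (\<lambda>u. of_real (wgt m t u) * D t u)) \<longlongrightarrow> 0) (at_right 0)"
  proof (rule tendstoI)
    fix e :: real assume e: "e > 0"
    \<comment> \<open>For small t the mass is below C + 1, so the part near the origin contributes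
      at most e/2.\<close>
    define \<eta> where "\<eta> = e / (2 * (C + 1))"
    have \<eta>: "\<eta> > 0" "\<eta> * (C + 1) = e / 2" using e C less_imp_neq[of 0 "C + 1"] by (simp_all add: \<eta>_def divide_simps)
    have "open (?T \<times> (UNIV :: (real^'n) set))" by (intro open_Times) auto
    then have "isCont (\<lambda>(t, u). D t u) (0, 0)"
      using Dc e0 by (auto simp: continuous_on_eq_continuous_at)
    moreover have "D 0 0 = 0" using b(3)[of 0] by (simp add: D_def)
    ultimately obtain d where d: "d > 0" "\<And>p. dist p (0, 0) < d \<Longrightarrow> norm ((\<lambda>(t, u). D t u) p) < \<eta>"
      using \<eta>(1) unfolding continuous_at_eps_delta by (auto simp: dist_norm)
    define \<delta> where "\<delta> = Min {d / 2, 1, t0 / 2}"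
    have \<delta>: "\<delta> > 0" "\<delta> \<le> d / 2" "\<delta> \<le> 1" "\<delta> \<le> t0 / 2" using d e0 by (auto simp: \<delta>_def)
    have small: "norm (D t u) \<le> \<eta>" if "\<bar>t\<bar> < \<delta>" "norm u < \<delta>" for t u
    proof -
      have "dist (t, u) (0, 0) \<le> \<bar>t\<bar> + norm u"
        using norm_Pair_le[of t u] by (simp add: dist_norm)
      also have "\<dots> < d" using that \<delta> by linarith
      finally show ?thesis using d(2) by fastforce
    qed
    have "((\<lambda>t. M * (t\<^sup>2 / (\<delta>\<^sup>2) ^ (m + 2)) * L) \<longlongrightarrow> M * (0\<^sup>2 / (\<delta>\<^sup>2) ^ (m + 2)) * L) (at_right 0)"
      using \<delta>(1) by (intro tendsto_intros) auto
    then have ev1: "\<forall>\<^sub>F t in at_right 0. M * (t\<^sup>2 / (\<delta>\<^sup>2) ^ (m + 2)) * L < e / 2"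
      by (rule order_tendstoD) (use e in simp)
    have ev2: "\<forall>\<^sub>F t in at_right 0. integral UNIV (\<lambda>u. wgt m t u * b u) < C + 1"
      by (rule order_tendstoD(2)[OF lim]) simp
    have ev3: "\<forall>\<^sub>F t in at_right 0. t \<in> {0<..<\<delta>}" by (rule eventually_at_right_real[OF \<delta>(1)])
    show "\<forall>\<^sub>F t in at_right 0. dist (integral UNIV (\<lambda>u. of_real (wgt m t u) * D t u)) 0 < e"
      using ev1 ev2 ev3
    proof eventually_elim
      case (elim t)
      then have eps: "t \<noteq> 0" "\<bar>t\<bar> < \<delta>" "\<bar>t\<bar> < t0" "\<bar>t\<bar> \<le> t0 / 2" "t > 0" using \<delta> by auto
      note cD = csD[OF eps(1,3)]
      have bnd: "norm (of_real (wgt m t u) * D t u) \<le> \<eta> * (wgt m t u * b u) + M * (t\<^sup>2 / (\<delta>\<^sup>2) ^ (m + 2))" for u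
      proof (cases "norm u < \<delta>")
        case True
        then have "b u = 1" using b(3) \<delta> by auto
        moreover have "norm (of_real (wgt m t u) * D t u) \<le> wgt m t u * \<eta>"
          unfolding norm_mult norm_of_real using small[OF eps(2) True] wgt_nonneg[of m t u]
          by (simp add: mult_left_mono)
        moreover have "M * (t\<^sup>2 / (\<delta>\<^sup>2) ^ (m + 2)) \<ge> 0" using M(1) by simp
        ultimately show ?thesis by (simp add: mult.commute)
      next
        case False
        then have "\<delta>\<^sup>2 \<le> u \<bullet> u" unfolding power2_norm_eq_inner[symmetric] using \<delta> by (intro power_mono) auto
        then have "(\<delta>\<^sup>2) ^ (m + 2) \<le> (u \<bullet> u + t\<^sup>2) ^ (m + 2)" by (intro power_mono) (auto intro: add_increasing2)
        then have "wgt m t u \<le> t\<^sup>2 / (\<delta>\<^sup>2) ^ (m + 2)"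
          unfolding wgt_def using \<delta>(1) by (intro divide_left_mono mult_pos_pos zero_less_power) (auto intro!: add_nonneg_pos simp: eps(1))
        then have "norm (of_real (wgt m t u) * D t u) \<le> (t\<^sup>2 / (\<delta>\<^sup>2) ^ (m + 2)) * M"
          unfolding norm_mult norm_of_real abs_of_nonneg[OF wgt_nonneg] using M(2)[OF eps(4), of u]
          by (intro mult_mono) auto
        moreover have "\<eta> * (wgt m t u * b u) \<ge> 0" using \<eta>(1) b(2) wgt_nonneg[of m t u] by simp
        ultimately show ?thesis by (simp add: mult.commute)
      qed
      have ib: "(\<lambda>u. wgt m t u * b u) integrable_on cbox (-a) a"
        by (rule csupp_integrable_cbox[OF csb[OF eps(1)]])
      have ig: "(\<lambda>u. \<eta> * (wgt m t u * b u) + M * (t\<^sup>2 / (\<delta>\<^sup>2) ^ (m + 2))) integrable_on cbox (-a) a"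
        by (intro integrable_add integrable_on_mult_right ib integrable_const)
      have "norm (integral UNIV (\<lambda>u. of_real (wgt m t u) * D t u))
        = norm (integral (cbox (-a) a) (\<lambda>u. of_real (wgt m t u) * D t u))"
        by (simp only: csupp_cbox_integral[OF cD a])
      also have "\<dots> \<le> integral (cbox (-a) a) (\<lambda>u. \<eta> * (wgt m t u * b u) + M * (t\<^sup>2 / (\<delta>\<^sup>2) ^ (m + 2)))"
        by (intro integral_norm_bound_integral ig bnd csupp_integrable_cbox[OF cD])
      also have "\<dots> = \<eta> * integral (cbox (-a) a) (\<lambda>u. wgt m t u * b u) + M * (t\<^sup>2 / (\<delta>\<^sup>2) ^ (m + 2)) * L"
        by (subst integral_add) (auto simp: L_def intro!: integrable_on_mult_right ib)
      also have "integral (cbox (-a) a) (\<lambda>u. wgt m t u * b u) = integral UNIV (\<lambda>u. wgt m t u * b u)"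
        by (rule csupp_cbox_integral[OF csb[OF eps(1)], symmetric]) (use a in \<open>auto simp: S'_def\<close>)
      also have "\<eta> * integral UNIV (\<lambda>u. wgt m t u * b u) + M * (t\<^sup>2 / (\<delta>\<^sup>2) ^ (m + 2)) * L < \<eta> * (C + 1) + e / 2"
        using elim \<eta>(1) by (intro add_strict_mono mult_strict_left_mono) auto
      finally show ?case using \<eta>(2) by simp
    qed
  qed
  have "((\<lambda>t. integral UNIV (\<lambda>u. of_real (wgt m t u) * D t u)
      + of_real (integral UNIV (\<lambda>u. wgt m t u * b u)) * H 0 x) \<longlongrightarrow> 0 + of_real C * H 0 x) (at_right 0)"
    by (intro tendsto_intros I0 lim)
  moreover have "\<forall>\<^sub>F t in at_right 0. integral UNIV (\<lambda>u. of_real (wgt m t u) * D t u)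
      + of_real (integral UNIV (\<lambda>u. wgt m t u * b u)) * H 0 x
    = integral UNIV (\<lambda>y. of_real (wgt m t (x - y)) * H t y)"
    using eventually_at_right_real[OF e0]
  proof eventually_elim
    case (elim t)
    then have eps: "t \<noteq> 0" "\<bar>t\<bar> < t0" by auto
    have csH: "csupp S (\<lambda>y. of_real (wgt m t (x - y)) * H t y)"
      unfolding csupp_def
      by (intro conjI allI impI continuous_intros continuous_on_compose2[OF wgt_continuous[OF eps(1), of UNIV]] Hc1)
        (use eps H(2) in \<open>auto simp: abs_less_iff\<close>)
    have hb: "((\<lambda>u. complex_of_real (wgt m t u * b u)) has_integral of_real (integral UNIV (\<lambda>u. wgt m t u * b u))) UNIV"
      by (rule has_integral_of_real[OF csupp_has_integral[OF csb[OF eps(1)] compact_cball]])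
    have "integral UNIV (\<lambda>y. of_real (wgt m t (x - y)) * H t y)
      = integral UNIV (\<lambda>u. of_real (wgt m t (x - (u + x))) * H t (u + x))"
      by (rule integral_UNIV_shift[OF csH S(1), symmetric])
    also have "\<dots> = integral UNIV (\<lambda>u. of_real (wgt m t u) * D t u + of_real (wgt m t u * b u) * H 0 x)"
    proof (intro arg_cong[where f="integral UNIV"] ext)
      fix u :: "real^'n"
      have "wgt m t (x - (u + x)) = wgt m t u" by (simp add: wgt_def)
      then show "of_real (wgt m t (x - (u + x))) * H t (u + x)
        = of_real (wgt m t u) * D t u + of_real (wgt m t u * b u) * H 0 x"
        by (simp add: D_def algebra_simps)
    qed
    also have "\<dots> = integral UNIV (\<lambda>u. of_real (wgt m t u) * D t u)
      + of_real (integral UNIV (\<lambda>u. wgt m t u * b u)) * H 0 x"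
      using has_integral_add[OF csupp_has_integral[OF csD[OF eps] S'] has_integral_mult_left[OF hb, of "H 0 x"]]
      by (simp add: integral_unique)
    finally show ?case by simp
  qed
  ultimately show ?thesis by (auto elim: Lim_transform_eventually)
qed

text \<open>Two evaluations of one limit as t decreases to 0: continuity of the kernel away from x,
  and concentration of the weight at x.\<close>

lemma (in polyharmonic) Ker_representation:
  assumes bump: "bump_limit m C (b :: real^'n \<Rightarrow> real)"
    and S: "compact S" "S \<subseteq> G"
    and \<sigma>: "C2_fun u0 u1 u2"
    and z: "\<And>y. y \<notin> S \<Longrightarrow> u0 (y \<bullet> y) = 0 \<and> u1 (y \<bullet> y) = 0 \<and> u2 (y \<bullet> y) = 0"
    and x: "u0 (x \<bullet> x) = 1"
    and S1: "compact S1" "S1 \<subseteq> S - {x}" "\<And>y. y \<notin> S1 \<Longrightarrow> u1 (y \<bullet> y) = 0 \<and> u2 (y \<bullet> y) = 0"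
    and type: "\<And>y. y \<in> S \<Longrightarrow> \<tau>\<^sup>2 * ((x - y) \<bullet> (x - y)) < 1"
  shows "integral UNIV (\<lambda>y. Ker u1 u2 (cembed x) y (of_real ((x - y) \<bullet> (x - y))) (of_real (ln ((x - y) \<bullet> (x - y)))))
    = of_real (4 * kappa m * C) * f x" (is "?J = _")
proof -
  have xS: "x \<in> S" using z[of x] x by auto
  obtain e0 V where V: "e0 > 0" "open V" "S \<subseteq> V"
    "continuous_on ({-e0<..<e0} \<times> V) (\<lambda>(t, y). dens u0 x t y)"
    and J: "((\<lambda>t. 4 * integral UNIV (\<lambda>y. of_real (wgt m t (x - y)) * dens u0 x t y)) \<longlongrightarrow> ?J) (at_right 0)"
    by (rule dens_integral_limit[OF S \<sigma> z xS S1 type])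
  have "((\<lambda>t. 4 * integral UNIV (\<lambda>y. of_real (wgt m t (x - y)) * dens u0 x t y))
      \<longlongrightarrow> 4 * (of_real C * dens u0 x 0 x)) (at_right 0)"
    by (intro tendsto_mult_left approx_identity[OF bump V(1,2) S(1) V(3,4)]) (use z in \<open>simp add: dens_def\<close>)
  from tendsto_unique[OF _ J this] have "?J = 4 * (of_real C * dens u0 x 0 x)" by simp
  moreover have "dens u0 x 0 x = of_real (kappa m) * f x"
  proof -
    have "Ser (cf (kB2 m)) x 0 = cf (kB2 m) 0 x"
      using Ser_split_head[OF tame_k(6), of x 0] xS S(2) by auto
    then show ?thesis using x by (simp add: dens_def cf_def kB2_0)
  qed
  ultimately show ?thesis by simp
qed

subsection \<open>Holomorphy of the kernel integrals\<close>

lemma holo_on_add: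
  assumes "holo_on S F" "holo_on S K"
  shows "holo_on S (\<lambda>z. F z + K z)"
  unfolding holo_on_def
proof
  fix z assume "z \<in> S"
  then obtain D E where "(F has_derivative D) (at z)" "\<forall>c w. D (c *s w) = c * D w"
    "(K has_derivative E) (at z)" "\<forall>c w. E (c *s w) = c * E w" using assms unfolding holo_on_def by metis
  then show "\<exists>D. ((\<lambda>z. F z + K z) has_derivative D) (at z) \<and> (\<forall>c w. D (c *s w) = c * D w)"
    by (intro exI[of _ "\<lambda>w. D w + E w"]) (auto intro: has_derivative_add simp: distrib_left)
qed

lemma holo_on_mult:
  assumes "holo_on S F" "holo_on S K"
  shows "holo_on S (\<lambda>z. F z * K z)"
  unfolding holo_on_def
proof
  fix z assume "z \<in> S"
  then obtain D E where "(F has_derivative D) (at z)" "\<forall>c w. D (c *s w) = c * D w"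
    "(K has_derivative E) (at z)" "\<forall>c w. E (c *s w) = c * E w" using assms unfolding holo_on_def by metis
  then show "\<exists>D. ((\<lambda>z. F z * K z) has_derivative D) (at z) \<and> (\<forall>c w. D (c *s w) = c * D w)"
    by (intro exI[of _ "\<lambda>w. F z * E w + D w * K z"] conjI has_derivative_mult) (auto simp: algebra_simps)
qed

lemma holo_on_const: "holo_on S (\<lambda>_. c)"
  unfolding holo_on_def by (intro ballI exI[of _ "\<lambda>_. 0"]) auto

lemma jholo_imp_holo_on:
  assumes "jholo (S \<times> UNIV) (\<lambda>z (y::real). F z)"
  shows "holo_on S F"
  unfolding holo_on_def
proof
  fix z assume z: "z \<in> S"
  obtain g where "\<And>z y::real. (z, y) \<in> S \<times> UNIV \<Longrightarrow> (F has_derivative bil (g z y)) (at z)"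
    by (rule jholoE[OF assms]) blast
  then have "(F has_derivative bil (g z 0)) (at z)" using z by simp
  then show "\<exists>D. (F has_derivative D) (at z) \<and> (\<forall>c w. D (c *s w) = c * D w)"
    by (intro exI[of _ "bil (g z 0)"]) (simp add: bil_simps)
qed

lemma holo_on_subset: "holo_on S F \<Longrightarrow> T \<subseteq> S \<Longrightarrow> holo_on T F"
  by (auto simp: holo_on_def)

lemma holo_on_transform:
  assumes "holo_on S F" "open S" "\<And>z. z \<in> S \<Longrightarrow> K z = F z"
  shows "holo_on S K"
  unfolding holo_on_def
proof
  fix z assume z: "z \<in> S"
  then obtain D where "(F has_derivative D) (at z)" "\<forall>c w. D (c *s w) = c * D w"
    using assms(1) unfolding holo_on_def by blast
  then show "\<exists>D. (K has_derivative D) (at z) \<and> (\<forall>c w. D (c *s w) = c * D w)"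
    using has_derivative_transform_within_open[OF _ assms(2) z, of F D UNIV K] assms(3) by auto
qed

lemma holo_on_pointwise:
  "(\<And>z. z \<in> S \<Longrightarrow> \<exists>T. z \<in> T \<and> holo_on T F) \<Longrightarrow> holo_on S F"
  unfolding holo_on_def by blast

lemma jholo_qf: "jholo W (\<lambda>z y. qf z)"
  unfolding qf_def by (intro jholo_sum jholo_power jholo_coord)

lemma jholo_qf_diff: "jholo W (\<lambda>z y. qf (z - cembed y))"
proof -
  have "jholo W (\<lambda>z y. \<Sum>i\<in>UNIV. (z $ i - of_real (y $ i))\<^sup>2)"
    by (intro jholo_sum jholo_power jholo_diff jholo_coord jholo_fun continuous_intros)
  then show ?thesis by (simp add: qf_def cembed_def)
qed

lemma jholo_section:
  assumes "jholo (U \<times> V) K" "z \<in> U"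
  shows "continuous_on V (\<lambda>y. K z y)"
proof -
  have "continuous_on (U \<times> V) (\<lambda>p. K (fst p) (snd p))" using assms(1) by (simp add: jholo_def)
  moreover have "continuous_on V (\<lambda>y. (z, y))" by (intro continuous_intros)
  ultimately have "continuous_on V (\<lambda>y. (\<lambda>p. K (fst p) (snd p)) (z, y))"
    by (rule continuous_on_compose2) (use assms(2) in auto)
  then show ?thesis by simp
qed

lemma compact_shell: "compact {y :: real^'n::finite. a \<le> y \<bullet> y \<and> y \<bullet> y \<le> b}"
proof -
  have "closed {y :: real^'n. a \<le> y \<bullet> y \<and> y \<bullet> y \<le> b}"
    by (intro closed_Collect_conj closed_Collect_le continuous_intros)
  moreover have "{y :: real^'n. a \<le> y \<bullet> y \<and> y \<bullet> y \<le> b} \<subseteq> cball 0 (sqrt b)"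
    by (auto simp: norm_eq_sqrt_inner)
  ultimately show ?thesis
    using bounded_subset[OF bounded_cball] by (simp add: compact_eq_bounded_closed)
qed

lemma C2_step_outside:
  assumes "C2_step \<alpha> \<beta> u0 u1 u2" "t \<le> \<alpha> \<or> \<beta> \<le> t"
  shows "u1 t = 0 \<and> u2 t = 0"
  using assms by (auto simp: C2_step_def)

lemma (in polyharmonic) Ker_holo:
  assumes U: "open U" and V: "open V" "V \<subseteq> G"
    and \<sigma>: "C2_step a1 a2 u0 u1 u2" and SV: "{y. a1 \<le> y \<bullet> y \<and> y \<bullet> y \<le> a2} \<subseteq> V"
    and l: "jholo (U \<times> V) l"
    and b: "\<And>z y. z \<in> U \<Longrightarrow> y \<in> V \<Longrightarrow> qf (z - cembed y) \<noteq> 0 \<and> \<tau>\<^sup>2 * cmod (qf (z - cembed y)) < 1"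
  shows "holo_on U (\<lambda>z. integral UNIV (\<lambda>y. Ker u1 u2 z y (qf (z - cembed y)) (l z y)))"
proof -
  define S where "S = {y :: real^'n. a1 \<le> y \<bullet> y \<and> y \<bullet> y \<le> a2}"
  have S: "compact S" "S \<subseteq> V" using SV by (simp_all add: S_def compact_shell)
  have F: "C2_fun u0 u1 u2" "\<And>y. y \<notin> S \<Longrightarrow> u1 (y \<bullet> y) = 0 \<and> u2 (y \<bullet> y) = 0"
    using \<sigma> C2_step_outside[OF \<sigma>] by (auto simp: S_def C2_step_def)
  define s where "s z y = qf (z - cembed y)" for z and y :: "real^'n"
  have s: "jholo (U \<times> V) s" unfolding s_def[abs_def] by (rule jholo_qf_diff)
  note b = b[folded s_def]
  \<comment> \<open>The integrand is split into cutoff factors that do not depend on z and kernels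
    holomorphic in z, as \<open>jholo_integral\<close> requires.\<close>
  define w1 where "w1 y = complex_of_real (- 8 * u1 (y \<bullet> y))" for y :: "real^'n"
  define w2 where "w2 y = W2 u1 u2 y" for y :: "real^'n"
  define K1 where "K1 z y = bil (cembed y) (z - cembed y) * (inverse (s z y) ^ Suc m * (l z y * Ser (cf (kA1 m)) y (s z y) + Ser (cf (kB1 m)) y (s z y)))" for z y
  define K2 where "K2 z y = inverse (s z y) ^ m * (l z y * Ser (cf (kA m)) y (s z y) + Ser (cf (kB m)) y (s z y))" for z y
  have jS: "jholo (U \<times> V) (\<lambda>z y. Ser c y (s z y))" if "tame \<tau> G c" for c
    by (rule jholo_Ser[OF s that open_G]) (use b V(2) in auto)
  have ji: "jholo (U \<times> V) (\<lambda>z y. inverse (s z y))" by (rule jholo_inverse[OF s]) (use b in auto)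
  have "jholo (U \<times> V) (\<lambda>z y. \<Sum>i\<in>UNIV. of_real (y $ i) * (z $ i - of_real (y $ i)))"
    by (intro jholo_sum jholo_mult jholo_diff jholo_coord jholo_fun continuous_intros)
  then have jb: "jholo (U \<times> V) (\<lambda>z y. bil (cembed y) (z - cembed y))" by (simp add: bil_def cembed_def)
  have j1: "jholo (U \<times> V) K1" unfolding K1_def[abs_def]
    by (intro jholo_mult jholo_add jholo_power ji jb l jS tame_k)
  have j2: "jholo (U \<times> V) K2" unfolding K2_def[abs_def]
    by (intro jholo_mult jholo_add jholo_power ji l jS tame_k)
  have c1: "csupp S w1" unfolding csupp_def w1_def
    using F(2) by (auto intro!: continuous_intros C2_fun_continuous[OF F(1), THEN continuous_on_compose2])
  have c2: "csupp S w2" unfolding csupp_def w2_def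
    using F(2) continuous_on_W12(2)[OF F(1) continuous_on_id] by (auto simp: W2_def)
  have cs: "csupp S (\<lambda>y. w y * K z y)" if "csupp S w" "jholo (U \<times> V) K" "z \<in> U" for w K z
    by (rule csuppI[OF V(1) compact_imp_closed[OF S(1)] S(2)])
      (use that in \<open>auto simp: csupp_def intro!: continuous_intros jholo_section[OF that(2,3)] intro: continuous_on_subset\<close>)
  have "holo_on U (\<lambda>z. integral UNIV (\<lambda>y. w1 y * K1 z y) + integral UNIV (\<lambda>y. w2 y * K2 z y))"
    by (intro holo_on_add jholo_integral[OF U V(1) S] j1 j2 c1 c2)
  then show ?thesis unfolding s_def[symmetric]
  proof (rule holo_on_transform[OF _ U])
    fix z assume z: "z \<in> U"
    have "Ker u1 u2 z y (s z y) (l z y) = w1 y * K1 z y + w2 y * K2 z y" for y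
      by (simp add: Ker_def W1_def w1_def w2_def K1_def K2_def mult.assoc)
    then show "integral UNIV (\<lambda>y. Ker u1 u2 z y (s z y) (l z y))
      = integral UNIV (\<lambda>y. w1 y * K1 z y) + integral UNIV (\<lambda>y. w2 y * K2 z y)"
      using csupp_integrable[OF cs[OF c1 j1 z] S(1)] csupp_integrable[OF cs[OF c2 j2 z] S(1)]
      by (simp add: integral_add)
  qed
qed

subsection \<open>The two parts on an annulus\<close>

lemma norm_less_iff_inner: "0 \<le> r \<Longrightarrow> norm y < r \<longleftrightarrow> y \<bullet> y < r\<^sup>2"
  unfolding power2_norm_eq_inner[symmetric]
  by (metis norm_ge_zero pos2 power_less_imp_less_base power_strict_mono)

lemma less_norm_iff_inner: "0 \<le> r \<Longrightarrow> r < norm y \<longleftrightarrow> r\<^sup>2 < y \<bullet> y"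
  unfolding power2_norm_eq_inner[symmetric]
  by (metis norm_ge_zero pos2 power_less_imp_less_base power_strict_mono)

text \<open>The difference of two cutoffs has compact support, so by
  \<open>Ker_integral\<close> with \<open>c = 0\<close> its kernel integral vanishes.\<close>

lemma (in polyharmonic) Ker_indep:
  assumes V: "open V" "V \<subseteq> G"
    and \<sigma>: "C2_step b1 b2 u0 u1 u2" "b1 < b2" and \<rho>: "C2_step b1' b2' v0 v1 v2" "b1' < b2'"
    and SV: "{y. min b1 b1' \<le> y \<bullet> y \<and> y \<bullet> y \<le> max b2 b2'} \<subseteq> V"
    and b: "\<And>y. y \<in> V \<Longrightarrow> \<tau>\<^sup>2 * cmod (qf (z - cembed y)) < 1 \<and> qf (z - cembed y) \<noteq> 0"
    and l: "continuous_on V l"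
      "\<And>i y. y \<in> V \<Longrightarrow> has_pd i l (- 2 * (z $ i - of_real (y $ i)) / qf (z - cembed y)) y"
  shows "integral UNIV (\<lambda>y. Ker u1 u2 z y (qf (z - cembed y)) (l y))
    = integral UNIV (\<lambda>y. Ker v1 v2 z y (qf (z - cembed y)) (l y))"
proof -
  define S where "S = {y :: real^'n. min b1 b1' \<le> y \<bullet> y \<and> y \<bullet> y \<le> max b2 b2'}"
  have S: "compact S" "S \<subseteq> V" using SV by (simp_all add: S_def compact_shell)
  have C: "C2_fun u0 u1 u2" "C2_fun v0 v1 v2" using \<sigma> \<rho> by (auto simp: C2_step_def)
  have sc: "continuous_on V (\<lambda>y. qf (z - cembed y))" by (intro continuous_intros)
  have zero: "u0 (y \<bullet> y) - v0 (y \<bullet> y) = 0 \<and> u1 (y \<bullet> y) = 0 \<and> u2 (y \<bullet> y) = 0 \<and> v1 (y \<bullet> y) = 0 \<and> v2 (y \<bullet> y) = 0"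
    if "y \<notin> S" for y
    using that \<sigma> \<rho> by (auto simp: S_def C2_step_def not_le)
  have cs: "csupp S (\<lambda>y. Ker u1 u2 z y (qf (z - cembed y)) (l y))"
    "csupp S (\<lambda>y. Ker v1 v2 z y (qf (z - cembed y)) (l y))"
    by (rule Ker_csupp[OF C(1) V S _ sc l(1)] Ker_csupp[OF C(2) V S _ sc l(1)]; use zero b in blast)+
  have "integral UNIV (\<lambda>y. Ker (\<lambda>t. u1 t - v1 t) (\<lambda>t. u2 t - v2 t) z y (qf (z - cembed y)) (l y)) = 0"
    by (rule trans[OF Ker_integral[OF V S C2_fun_diff[OF C], where c=0]]) (use zero b l in auto)
  then show ?thesis unfolding Ker_diff
    using integral_diff[OF csupp_integrable[OF cs(1) S(1)] csupp_integrable[OF cs(2) S(1)]] by simp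
qed

locale annular = polyharmonic "annulus r0 (ereal R)" f \<tau> m
  for r0 R :: real and f :: "real^'n::finite \<Rightarrow> complex" and \<tau> m +
  assumes r0: "0 \<le> r0" "r0 < R" and type: "2 * \<tau> * R < 1"
begin

abbreviation Ann :: "(real^'n) set" where "Ann \<equiv> annulus r0 (ereal R)"

lemma mem_G: "y \<in> Ann \<longleftrightarrow> r0\<^sup>2 < y \<bullet> y \<and> y \<bullet> y < R\<^sup>2"
  using r0 norm_less_iff_inner[of R y] less_norm_iff_inner[of r0 y] by (auto simp: annulus_def)

lemma G_nz: "y \<in> Ann \<Longrightarrow> y \<noteq> 0"
  using r0 by (auto simp: mem_G)

lemma type_bound:
  assumes "y \<in> Ann" "2 * \<tau> * Lplus z < 1"
  shows "\<tau>\<^sup>2 * cmod (qf (z - cembed y)) < 1"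
proof -
  have "norm y < R" using assms(1) by (simp add: annulus_def)
  then have "2 * \<tau> * norm y < 1"
    using mult_left_mono[of "norm y" R "2 * \<tau>"] \<tau>_nonneg type by linarith
  then have "\<tau> * (norm y + Lplus z) < 1" using assms(2) by (simp add: algebra_simps)
  moreover have "\<tau> * (norm y + Lplus z) \<ge> 0" using \<tau>_nonneg Lplus_nonneg[of z] by simp
  ultimately have "(\<tau> * (norm y + Lplus z))\<^sup>2 < 1" by (simp add: power_less_one_iff abs_square_less_1)
  moreover have "\<tau>\<^sup>2 * cmod (qf (z - cembed y)) \<le> \<tau>\<^sup>2 * (norm y + Lplus z)\<^sup>2"
    using qf_diff_bound[OF G_nz[OF assms(1)]] by (intro mult_left_mono) auto
  ultimately show ?thesis by (simp add: power_mult_distrib)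
qed

lemma type_Lplus: "Lplus z \<le> R \<Longrightarrow> 2 * \<tau> * Lplus z < 1"
  using mult_left_mono[of "Lplus z" R "2 * \<tau>"] \<tau>_nonneg type by linarith

definition Outer :: "(real \<Rightarrow> real) \<Rightarrow> (real \<Rightarrow> real) \<Rightarrow> complex^'n \<Rightarrow> complex" where
  "Outer u1 u2 z = integral UNIV (\<lambda>y. Ker u1 u2 z y (qf (z - cembed y)) (Ln (qf (z - cembed y))))"

text \<open>The last argument is a logarithm of q(z - y) made of two principal branches. For y in
  the annulus with \<open>norm y < Lminus z\<close> the quotient avoids the negative axis, so only
  q(z) has to be kept off the slit.\<close>

definition Inner :: "(real \<Rightarrow> real) \<Rightarrow> (real \<Rightarrow> real) \<Rightarrow> complex^'n \<Rightarrow> complex" where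
  "Inner u1 u2 z = integral UNIV (\<lambda>y. Ker u1 u2 z y (qf (z - cembed y)) (Ln (qf z) + Ln (qf (z - cembed y) / qf z)))"

lemma open_qf_slit: "open {z :: complex^'n. qf z \<notin> \<real>\<^sub>\<le>\<^sub>0}"
  using open_vimage[of "-\<real>\<^sub>\<le>\<^sub>0" "qf :: complex^'n \<Rightarrow> complex"] continuous_on_qf[OF continuous_on_id, of UNIV]
  by (simp add: vimage_def open_Compl)

lemma open_annulus_part:
  assumes "open {y. P y}"
  shows "open {y \<in> Ann. P y}" "{y \<in> Ann. P y} \<subseteq> Ann"
  using open_Int[OF open_G assms] by (auto simp: Collect_conj_eq)

lemma outer_region:
  assumes "y \<in> Ann" "(Lplus z)\<^sup>2 < y \<bullet> y"
  shows "qf (z - cembed y) \<notin> \<real>\<^sub>\<le>\<^sub>0" "qf (z - cembed y) \<noteq> 0 \<and> \<tau>\<^sup>2 * cmod (qf (z - cembed y)) < 1"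
proof -
  have L: "Lplus z < norm y" using assms(2) by (simp add: less_norm_iff_inner[OF Lplus_nonneg])
  show q: "qf (z - cembed y) \<notin> \<real>\<^sub>\<le>\<^sub>0" by (rule qf_outer[OF L])
  have "Lplus z \<le> R" using L assms(1) by (simp add: annulus_def)
  then show "qf (z - cembed y) \<noteq> 0 \<and> \<tau>\<^sup>2 * cmod (qf (z - cembed y)) < 1"
    using q type_bound[OF assms(1) type_Lplus] by auto
qed

lemma inner_region:
  assumes "y \<in> Ann" "y \<bullet> y < (Lminus z)\<^sup>2"
  shows "qf z \<noteq> 0" "qf (z - cembed y) / qf z \<notin> \<real>\<^sub>\<le>\<^sub>0" "qf (z - cembed y) \<noteq> 0"
proof -
  have "norm y < Lminus z" using assms(2) by (simp add: norm_less_iff_inner[OF Lminus_nonneg])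
  from qf_inner[OF this G_nz[OF assms(1)]]
  show "qf z \<noteq> 0" "qf (z - cembed y) / qf z \<notin> \<real>\<^sub>\<le>\<^sub>0" "qf (z - cembed y) \<noteq> 0" by auto
qed

lemma Outer_holo:
  assumes \<sigma>: "C2_step b1 b2 u0 u1 u2" and g: "r0\<^sup>2 < b1" "b1 < b2" "b2 < R\<^sup>2"
  shows "holo_on {z. (Lplus z)\<^sup>2 < b1} (Outer u1 u2)"
proof (rule holo_on_pointwise)
  fix z0 :: "complex^'n" assume "z0 \<in> {z. (Lplus z)\<^sup>2 < b1}"
  \<comment> \<open>h separates z from the shell: U lies below this level and V above it, so the
    kernel is regular on a product U x V containing z0 and the support of the cutoff
    derivatives.\<close>
  then obtain h where h: "(Lplus z0)\<^sup>2 < h" "h < b1" using dense by auto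
  define U where "U = {z :: complex^'n. (Lplus z)\<^sup>2 < h}"
  define V where "V = {y \<in> Ann. h < y \<bullet> y}"
  have U: "open U" unfolding U_def by (intro open_Collect_less continuous_intros continuous_on_Lplus)
  have V: "open V" "V \<subseteq> Ann" unfolding V_def by (intro open_annulus_part open_Collect_less continuous_intros)+
  have reg: "y \<in> Ann" "(Lplus z)\<^sup>2 < y \<bullet> y" if "z \<in> U" "y \<in> V" for z y using that by (auto simp: U_def V_def)
  have "holo_on U (Outer u1 u2)"
    unfolding Outer_def[abs_def]
  proof (rule Ker_holo[OF U V \<sigma>])
    show "{y. b1 \<le> y \<bullet> y \<and> y \<bullet> y \<le> b2} \<subseteq> V" using g h by (auto simp: V_def mem_G)
    show "jholo (U \<times> V) (\<lambda>z y. Ln (qf (z - cembed y)))"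
      by (rule jholo_Ln[OF jholo_qf_diff]) (use outer_region(1)[OF reg] in auto)
  qed (rule outer_region(2)[OF reg])
  then show "\<exists>T. z0 \<in> T \<and> holo_on T (Outer u1 u2)" using h by (auto simp: U_def)
qed

lemma Inner_holo:
  assumes \<sigma>: "C2_step a1 a2 u0 u1 u2" and g: "r0\<^sup>2 < a1" "a1 < a2" "a2 < R\<^sup>2"
  shows "holo_on {z. a2 < (Lminus z)\<^sup>2 \<and> 2 * \<tau> * Lplus z < 1 \<and> qf z \<notin> \<real>\<^sub>\<le>\<^sub>0} (Inner u1 u2)"
proof (rule holo_on_pointwise)
  fix z0 :: "complex^'n" assume "z0 \<in> {z. a2 < (Lminus z)\<^sup>2 \<and> 2 * \<tau> * Lplus z < 1 \<and> qf z \<notin> \<real>\<^sub>\<le>\<^sub>0}"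
  then obtain h where h: "a2 < h" "h < (Lminus z0)\<^sup>2" and z0: "2 * \<tau> * Lplus z0 < 1" "qf z0 \<notin> \<real>\<^sub>\<le>\<^sub>0"
    using dense by auto
  define U where "U = {z :: complex^'n. h < (Lminus z)\<^sup>2 \<and> 2 * \<tau> * Lplus z < 1 \<and> qf z \<notin> \<real>\<^sub>\<le>\<^sub>0}"
  define V where "V = {y \<in> Ann. y \<bullet> y < h}"
  have U: "open U" unfolding U_def
    by (intro open_Collect_conj open_Collect_less continuous_intros continuous_on_Lplus continuous_on_Lminus open_qf_slit)
  have V: "open V" "V \<subseteq> Ann" unfolding V_def by (intro open_annulus_part open_Collect_less continuous_intros)+
  have reg: "y \<in> Ann" "y \<bullet> y < (Lminus z)\<^sup>2" if "z \<in> U" "y \<in> V" for z y using that by (auto simp: U_def V_def)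
  have "holo_on U (Inner u1 u2)"
    unfolding Inner_def[abs_def]
  proof (rule Ker_holo[OF U V \<sigma>])
    show "{y. a1 \<le> y \<bullet> y \<and> y \<bullet> y \<le> a2} \<subseteq> V" using g h by (auto simp: V_def mem_G)
    have "jholo (U \<times> V) (\<lambda>z y. qf (z - cembed y) / qf z)"
      unfolding divide_inverse by (intro jholo_mult jholo_qf_diff jholo_inverse jholo_qf) (use inner_region(1)[OF reg] in auto)
    then show "jholo (U \<times> V) (\<lambda>z y. Ln (qf z) + Ln (qf (z - cembed y) / qf z))"
      by (intro jholo_add jholo_Ln jholo_qf) (use inner_region(2)[OF reg] in \<open>auto simp: U_def\<close>)
    show "qf (z - cembed y) \<noteq> 0 \<and> \<tau>\<^sup>2 * cmod (qf (z - cembed y)) < 1" if "z \<in> U" "y \<in> V" for z y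
      using inner_region(3)[OF reg[OF that]] type_bound[OF reg(1)[OF that]] that(1) by (simp add: U_def)
  qed
  then show "\<exists>T. z0 \<in> T \<and> holo_on T (Inner u1 u2)"
    using h z0 by (intro exI[of _ U]) (simp add: U_def)
qed

lemma Outer_indep:
  assumes \<sigma>: "C2_step b1 b2 u0 u1 u2" and g: "r0\<^sup>2 < b1" "b1 < b2" "b2 < R\<^sup>2" "(Lplus z)\<^sup>2 < b1"
    and \<rho>: "C2_step b1' b2' v0 v1 v2" and g': "r0\<^sup>2 < b1'" "b1' < b2'" "b2' < R\<^sup>2" "(Lplus z)\<^sup>2 < b1'"
  shows "Outer u1 u2 z = Outer v1 v2 z"
proof -
  define V where "V = {y \<in> Ann. (Lplus z)\<^sup>2 < y \<bullet> y}"
  have V: "open V" "V \<subseteq> Ann" unfolding V_def by (intro open_annulus_part open_Collect_less continuous_intros)+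
  have reg: "y \<in> Ann" "(Lplus z)\<^sup>2 < y \<bullet> y" if "y \<in> V" for y using that by (auto simp: V_def)
  show ?thesis unfolding Outer_def
  proof (rule Ker_indep[OF V \<sigma> g(2) \<rho> g'(2)])
    show "{y. min b1 b1' \<le> y \<bullet> y \<and> y \<bullet> y \<le> max b2 b2'} \<subseteq> V" using g g' by (auto simp: V_def mem_G)
    show "continuous_on V (\<lambda>y. Ln (qf (z - cembed y)))"
      by (intro continuous_on_Ln' continuous_intros) (use outer_region(1)[OF reg] in auto)
    show "has_pd i (\<lambda>y. Ln (qf (z - cembed y))) (- 2 * (z $ i - of_real (y $ i)) / qf (z - cembed y)) y" if "y \<in> V" for i y
      using has_pd_Ln_qf[of z y 0 i] outer_region(1)[OF reg[OF that]] by simp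
  qed (use outer_region(2)[OF reg] in auto)
qed

lemma Inner_indep:
  assumes \<sigma>: "C2_step a1 a2 u0 u1 u2" and g: "r0\<^sup>2 < a1" "a1 < a2" "a2 < R\<^sup>2" "a2 < (Lminus z)\<^sup>2"
    and \<rho>: "C2_step a1' a2' v0 v1 v2" and g': "r0\<^sup>2 < a1'" "a1' < a2'" "a2' < R\<^sup>2" "a2' < (Lminus z)\<^sup>2"
    and z: "2 * \<tau> * Lplus z < 1"
  shows "Inner u1 u2 z = Inner v1 v2 z"
proof -
  define V where "V = {y \<in> Ann. y \<bullet> y < (Lminus z)\<^sup>2}"
  have V: "open V" "V \<subseteq> Ann" unfolding V_def by (intro open_annulus_part open_Collect_less continuous_intros)+
  have q: "qf z \<noteq> 0" "qf (z - cembed y) / qf z \<notin> \<real>\<^sub>\<le>\<^sub>0" "qf (z - cembed y) \<noteq> 0" if "y \<in> V" for y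
    using that inner_region[of y z] by (auto simp: V_def)
  show ?thesis unfolding Inner_def
  proof (rule Ker_indep[OF V \<sigma> g(2) \<rho> g'(2)])
    show "{y. min a1 a1' \<le> y \<bullet> y \<and> y \<bullet> y \<le> max a2 a2'} \<subseteq> V" using g g' by (auto simp: V_def mem_G)
    show "continuous_on V (\<lambda>y. Ln (qf z) + Ln (qf (z - cembed y) / qf z))"
      using q by (intro continuous_intros continuous_on_Ln) auto
    fix y assume y: "y \<in> V"
    show "\<tau>\<^sup>2 * cmod (qf (z - cembed y)) < 1 \<and> qf (z - cembed y) \<noteq> 0"
      using type_bound[OF _ z] V(2) y q[OF y] by auto
    have "((\<lambda>s. Ln (qf z) + Ln (s / qf z)) has_field_derivative 1 / qf (z - cembed y)) (at (qf (z - cembed y) + 0))"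
      using q[OF y] by (auto intro!: derivative_eq_intros simp: field_simps)
    from has_pd_chain[OF has_pd_qf this]
    show "has_pd i (\<lambda>y. Ln (qf z) + Ln (qf (z - cembed y) / qf z)) (- 2 * (z $ i - of_real (y $ i)) / qf (z - cembed y)) y" for i
      by simp
  qed
qed

end

text \<open>A cutoff chosen as a function of its two endpoints, so that the endpoints may move with
  z in \<open>f_out\<close> and \<open>f_in\<close>.\<close>

definition step_pair :: "real \<Rightarrow> real \<Rightarrow> (real \<Rightarrow> real) \<times> (real \<Rightarrow> real) \<times> (real \<Rightarrow> real)" where
  "step_pair a1 a2 = (SOME s. case s of (u0, u1, u2) \<Rightarrow> C2_step a1 a2 u0 u1 u2)"

definition st0 where "st0 a1 a2 = fst (step_pair a1 a2)"
definition st1 where "st1 a1 a2 = fst (snd (step_pair a1 a2))"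
definition st2 where "st2 a1 a2 = snd (snd (step_pair a1 a2))"

lemma st: 
  assumes "a1 < a2"
  shows "C2_step a1 a2 (st0 a1 a2) (st1 a1 a2) (st2 a1 a2)"
proof -
  obtain u0 u1 u2 where "C2_step a1 a2 u0 u1 u2" using C2_step_exists[OF assms] .
  then have "case (u0, u1, u2) of (u0, u1, u2) \<Rightarrow> C2_step a1 a2 u0 u1 u2" by simp
  then have "case step_pair a1 a2 of (u0, u1, u2) \<Rightarrow> C2_step a1 a2 u0 u1 u2"
    unfolding step_pair_def by (rule someI)
  then show ?thesis by (simp add: st0_def st1_def st2_def case_prod_unfold)
qed

context annular
begin

text \<open>The cutoffs are placed in the middle third of the interval of squared radii that is
  available at the given point.\<close>

definition f_out :: "complex^'n \<Rightarrow> complex" where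
  "f_out z = (let a = max ((Lplus z)\<^sup>2) (r0\<^sup>2); b1 = (2 * a + R\<^sup>2) / 3; b2 = (a + 2 * R\<^sup>2) / 3
     in Outer (st1 b1 b2) (st2 b1 b2) z)"

definition f_in :: "complex^'n \<Rightarrow> complex" where
  "f_in z = (let b = min ((Lminus z)\<^sup>2) (R\<^sup>2); a1 = (2 * r0\<^sup>2 + b) / 3; a2 = (r0\<^sup>2 + 2 * b) / 3
     in Inner (st1 a1 a2) (st2 a1 a2) z)"

lemma sq_less: "r0\<^sup>2 < R\<^sup>2"
  using r0 by (intro power_strict_mono) auto

lemma f_out_eq:
  assumes \<sigma>: "C2_step b1 b2 u0 u1 u2" and g: "r0\<^sup>2 < b1" "b1 < b2" "b2 < R\<^sup>2" "(Lplus z)\<^sup>2 < b1"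
  shows "f_out z = Outer u1 u2 z"
proof -
  define a where "a = max ((Lplus z)\<^sup>2) (r0\<^sup>2)"
  have a: "a < R\<^sup>2" "r0\<^sup>2 \<le> a" "(Lplus z)\<^sup>2 \<le> a" using g by (auto simp: a_def)
  show ?thesis unfolding f_out_def Let_def a_def[symmetric]
    by (rule Outer_indep[OF st _ _ _ _ \<sigma> g]) (use a in \<open>auto simp: field_simps\<close>)
qed

lemma f_in_eq:
  assumes \<sigma>: "C2_step a1 a2 u0 u1 u2" and g: "r0\<^sup>2 < a1" "a1 < a2" "a2 < R\<^sup>2" "a2 < (Lminus z)\<^sup>2"
    and z: "2 * \<tau> * Lplus z < 1"
  shows "f_in z = Inner u1 u2 z"
proof -
  define b where "b = min ((Lminus z)\<^sup>2) (R\<^sup>2)"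
  have b: "r0\<^sup>2 < b" "b \<le> R\<^sup>2" "b \<le> (Lminus z)\<^sup>2" using g by (auto simp: b_def)
  show ?thesis unfolding f_in_def Let_def b_def[symmetric]
    by (rule Inner_indep[OF st _ _ _ _ \<sigma> g z]) (use b in \<open>auto simp: field_simps\<close>)
qed

text \<open>Near z0 one fixed cutoff is admissible for all z; since the value does not depend on the
  cutoff, \<open>f_out\<close> coincides there with a single parameter integral.\<close>

lemma holo_f_out: "holo_on {z. Lplus z < R} f_out"
proof (rule holo_on_pointwise)
  fix z0 :: "complex^'n" assume "z0 \<in> {z. Lplus z < R}"
  then have "(Lplus z0)\<^sup>2 < R\<^sup>2" using Lplus_nonneg[of z0] by (auto intro: power_strict_mono)
  then have "max ((Lplus z0)\<^sup>2) (r0\<^sup>2) < R\<^sup>2" using sq_less by simp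
  then obtain b1 where b1: "max ((Lplus z0)\<^sup>2) (r0\<^sup>2) < b1" "b1 < R\<^sup>2" using dense by blast
  obtain b2 where b2: "b1 < b2" "b2 < R\<^sup>2" using dense[OF b1(2)] by blast
  have g: "r0\<^sup>2 < b1" using b1 by simp
  have "open {z :: complex^'n. (Lplus z)\<^sup>2 < b1}"
    by (intro open_Collect_less continuous_intros continuous_on_Lplus)
  then have "holo_on {z. (Lplus z)\<^sup>2 < b1} f_out"
    by (rule holo_on_transform[OF Outer_holo[OF st[OF b2(1)] g b2]])
      (use f_out_eq[OF st[OF b2(1)] g b2] in auto)
  then show "\<exists>T. z0 \<in> T \<and> holo_on T f_out" using b1(1) by auto
qed

text \<open>The shell only has to lie in the annulus and below \<open>Lminus z\<close>, so z itself
  may leave the region \<open>Lplus z < R\<close>; the bound on \<open>Lplus z\<close> comes from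
  the convergence of the series alone.\<close>

lemma holo_f_in: "holo_on {z. r0 < Lminus z \<and> 2 * \<tau> * Lplus z < 1 \<and> qf z \<notin> \<real>\<^sub>\<le>\<^sub>0} f_in"
proof (rule holo_on_pointwise)
  fix z0 :: "complex^'n" assume z0: "z0 \<in> {z. r0 < Lminus z \<and> 2 * \<tau> * Lplus z < 1 \<and> qf z \<notin> \<real>\<^sub>\<le>\<^sub>0}"
  then have "r0\<^sup>2 < (Lminus z0)\<^sup>2" using r0 by (auto intro: power_strict_mono)
  then have "r0\<^sup>2 < min ((Lminus z0)\<^sup>2) (R\<^sup>2)" using sq_less by simp
  then obtain a2 where a2: "r0\<^sup>2 < a2" "a2 < min ((Lminus z0)\<^sup>2) (R\<^sup>2)" using dense by blast
  obtain a1 where a1: "r0\<^sup>2 < a1" "a1 < a2" using dense[OF a2(1)] by blast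
  have b: "a2 < R\<^sup>2" using a2 by simp
  have "open {z :: complex^'n. a2 < (Lminus z)\<^sup>2 \<and> 2 * \<tau> * Lplus z < 1 \<and> qf z \<notin> \<real>\<^sub>\<le>\<^sub>0}"
    by (intro open_Collect_conj open_Collect_less continuous_intros continuous_on_Lplus continuous_on_Lminus open_qf_slit)
  then have "holo_on {z. a2 < (Lminus z)\<^sup>2 \<and> 2 * \<tau> * Lplus z < 1 \<and> qf z \<notin> \<real>\<^sub>\<le>\<^sub>0} f_in"
    by (rule holo_on_transform[OF Inner_holo[OF st[OF a1(2)] a1 b]])
      (use f_in_eq[OF st[OF a1(2)] a1 b] in auto)
  moreover have "z0 \<in> {z. a2 < (Lminus z)\<^sup>2 \<and> 2 * \<tau> * Lplus z < 1 \<and> qf z \<notin> \<real>\<^sub>\<le>\<^sub>0}"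
    using z0 a2 by simp
  ultimately show "\<exists>T. z0 \<in> T \<and> holo_on T f_in"
    by (intro exI[of _ "{z. a2 < (Lminus z)\<^sup>2 \<and> 2 * \<tau> * Lplus z < 1 \<and> qf z \<notin> \<real>\<^sub>\<le>\<^sub>0}"] conjI)
qed

text \<open>The inner step minus the outer step equals 1 at x and is supported in the annulus, so it
  is a cutoff for \<open>Ker_representation\<close>; by linearity of \<open>Ker\<close> in the
  cutoff, its kernel integral is the inner minus the outer one. At real points both branches of the
  logarithm reduce to the real logarithm.\<close>

lemma f_in_minus_f_out:
  obtains C :: complex where "C \<noteq> 0" "\<And>x. x \<in> Ann \<Longrightarrow> f_in (cembed x) - f_out (cembed x) = C * f x"
proof -
  obtain C and b :: "real^'n \<Rightarrow> real" where b: "bump_limit m C b" by (rule bump_mass[OF dim])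
  have C: "C > 0" using b by (simp add: bump_limit_def)
  have "f_in (cembed x) - f_out (cembed x) = of_real (4 * kappa m * C) * f x" if xG: "x \<in> Ann" for x
  proof -
    have x: "r0\<^sup>2 < x \<bullet> x" "x \<bullet> x < R\<^sup>2" using xG by (simp_all add: mem_G)
    obtain a2 where a2: "r0\<^sup>2 < a2" "a2 < x \<bullet> x" using dense[OF x(1)] by blast
    obtain a1 where a1: "r0\<^sup>2 < a1" "a1 < a2" using dense[OF a2(1)] by blast
    obtain b1 where b1: "x \<bullet> x < b1" "b1 < R\<^sup>2" using dense[OF x(2)] by blast
    obtain b2 where b2: "b1 < b2" "b2 < R\<^sup>2" using dense[OF b1(2)] by blast
    obtain v0 v1 v2 where \<rho>: "C2_step a1 a2 v0 v1 v2" using C2_step_exists[OF a1(2)] .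
    obtain u0 u1 u2 where \<sigma>: "C2_step b1 b2 u0 u1 u2" using C2_step_exists[OF b2(1)] .
    have F: "C2_fun v0 v1 v2" "C2_fun u0 u1 u2" using \<rho> \<sigma> by (auto simp: C2_step_def)
    define S where "S = {y :: real^'n. a1 \<le> y \<bullet> y \<and> y \<bullet> y \<le> b2}"
    define A where "A = {y :: real^'n. a1 \<le> y \<bullet> y \<and> y \<bullet> y \<le> a2}"
    define B where "B = {y :: real^'n. b1 \<le> y \<bullet> y \<and> y \<bullet> y \<le> b2}"
    have SG: "S \<subseteq> Ann" using a1 b2 by (auto simp: S_def mem_G)
    have comp: "compact S" "compact A" "compact B" unfolding S_def A_def B_def by (rule compact_shell)+
    have sub: "A \<subseteq> S - {x}" "B \<subseteq> S - {x}" using a1 a2 b1 b2 by (auto simp: S_def A_def B_def)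
    have zA: "v1 (y \<bullet> y) = 0 \<and> v2 (y \<bullet> y) = 0" if "y \<notin> A" for y
      using that by (intro C2_step_outside[OF \<rho>]) (auto simp: A_def)
    have zB: "u1 (y \<bullet> y) = 0 \<and> u2 (y \<bullet> y) = 0" if "y \<notin> B" for y
      using that by (intro C2_step_outside[OF \<sigma>]) (auto simp: B_def)
    have tb: "\<tau>\<^sup>2 * ((x - y) \<bullet> (x - y)) < 1" if "y \<in> Ann" for y
    proof -
      have "Lplus (cembed x) \<le> R" using xG by (simp add: Lplus_cembed annulus_def)
      from type_bound[OF that type_Lplus[OF this]] show ?thesis by (simp add: qf_cembed_diff)
    qed
    define s where "s y = complex_of_real ((x - y) \<bullet> (x - y))" for y
    define l where "l y = complex_of_real (ln ((x - y) \<bullet> (x - y)))" for y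
    define V where "V = Ann - {x}"
    have V: "open V" "V \<subseteq> Ann" using open_G by (auto simp: V_def)
    have sV: "s y \<noteq> 0" "\<tau>\<^sup>2 * cmod (s y) < 1" if "y \<in> V" for y
      using that tb by (auto simp: V_def s_def)
    have sc: "continuous_on V s" unfolding s_def[abs_def] by (intro continuous_intros)
    have lc: "continuous_on V l" unfolding l_def[abs_def] by (intro continuous_intros) (auto simp: V_def)
    have cA: "csupp A (\<lambda>y. Ker v1 v2 (cembed x) y (s y) (l y))"
      by (rule Ker_csupp[OF F(1) V comp(2) _ zA sc lc]) (use sub SG sV in \<open>auto simp: V_def\<close>)
    have cB: "csupp B (\<lambda>y. Ker u1 u2 (cembed x) y (s y) (l y))"
      by (rule Ker_csupp[OF F(2) V comp(3) _ zB sc lc]) (use sub SG sV in \<open>auto simp: V_def\<close>)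
    have rep: "integral UNIV (\<lambda>y. Ker (\<lambda>t. v1 t - u1 t) (\<lambda>t. v2 t - u2 t) (cembed x) y (s y) (l y))
      = of_real (4 * kappa m * C) * f x"
      unfolding s_def l_def
    proof (rule Ker_representation[OF b comp(1) SG C2_fun_diff[OF F], where ?S1.0="A \<union> B"])
      show "v0 (x \<bullet> x) - u0 (x \<bullet> x) = 1" using \<rho> \<sigma> a2 b1 by (simp add: C2_step_def)
      show "v0 (y \<bullet> y) - u0 (y \<bullet> y) = 0 \<and> v1 (y \<bullet> y) - u1 (y \<bullet> y) = 0 \<and> v2 (y \<bullet> y) - u2 (y \<bullet> y) = 0"
        if "y \<notin> S" for y
        using that \<rho> \<sigma> a1 a2 b1 b2 by (auto simp: S_def C2_step_def not_le)
    qed (use comp sub zA zB tb SG in auto)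
    have nz: "0 < (x - y) \<bullet> (x - y)" if "y \<noteq> x" for y using that by simp
    have o: "f_out (cembed x) = integral UNIV (\<lambda>y. Ker u1 u2 (cembed x) y (s y) (l y))"
    proof -
      have "f_out (cembed x) = Outer u1 u2 (cembed x)"
        by (rule f_out_eq[OF \<sigma>]) (use x b1 b2 in \<open>auto simp: Lplus_cembed power2_norm_eq_inner\<close>)
      also have "\<dots> = integral UNIV (\<lambda>y. Ker u1 u2 (cembed x) y (s y) (l y))"
        unfolding Outer_def
      proof (intro arg_cong[where f="integral UNIV"] ext)
        fix y show "Ker u1 u2 (cembed x) y (qf (cembed x - cembed y)) (Ln (qf (cembed x - cembed y)))
          = Ker u1 u2 (cembed x) y (s y) (l y)"
        proof (cases "y = x")
          case True
          then have "y \<notin> B" using sub by auto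
          then show ?thesis using zB by (simp add: Ker_zero)
        next
          case False
          show ?thesis unfolding qf_cembed_diff s_def l_def Ln_of_real[OF nz[OF False]] ..
        qed
      qed
      finally show ?thesis .
    qed
    have i: "f_in (cembed x) = integral UNIV (\<lambda>y. Ker v1 v2 (cembed x) y (s y) (l y))"
    proof -
      have "2 * \<tau> * Lplus (cembed x) < 1"
        by (rule type_Lplus) (use xG in \<open>simp add: Lplus_cembed annulus_def\<close>)
      then have "f_in (cembed x) = Inner v1 v2 (cembed x)"
        using x a1 a2 by (intro f_in_eq[OF \<rho>]) (auto simp: Lminus_cembed power2_norm_eq_inner)
      also have "\<dots> = integral UNIV (\<lambda>y. Ker v1 v2 (cembed x) y (s y) (l y))"
        unfolding Inner_def
      proof (intro arg_cong[where f="integral UNIV"] ext)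
        fix y show "Ker v1 v2 (cembed x) y (qf (cembed x - cembed y)) (Ln (qf (cembed x)) + Ln (qf (cembed x - cembed y) / qf (cembed x)))
          = Ker v1 v2 (cembed x) y (s y) (l y)"
        proof (cases "y = x")
          case True
          then have "y \<notin> A" using sub by auto
          then show ?thesis using zA by (simp add: Ker_zero)
        next
          case False
          have xx: "x \<bullet> x > 0" using x(1) by (meson le_less_trans zero_le_power2)
          have "Ln (of_real (x \<bullet> x)) + Ln (of_real ((x - y) \<bullet> (x - y) / (x \<bullet> x))) = l y"
            using xx nz[OF False] unfolding l_def
            by (simp only: Ln_of_real divide_pos_pos ln_div flip: of_real_add) simp
          then show ?thesis
            by (simp only: qf_cembed_diff qf_cembed power2_norm_eq_inner s_def flip: of_real_divide)
        qed
      qed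
      finally show ?thesis .
    qed
    show ?thesis unfolding i o rep[symmetric] Ker_diff
      by (rule integral_diff[symmetric, OF csupp_integrable[OF cA comp(2)] csupp_integrable[OF cB comp(3)]])
  qed
  then show ?thesis using that[of "of_real (4 * kappa m * C)"] C kappa_nz by simp
qed

lemma exists_decomposition:
  "\<exists>f1 f2.
     holo_on {z. ereal (Lplus z) < ereal R} f1 \<and>
     holo_on {z. r0 < Lminus z \<and> ereal (Lplus z) < inv2 \<tau> \<and> qf z \<notin> negaxis} f2 \<and>
     holo_on (cannulus r0 (ereal R) - qf -` negaxis)
        (\<lambda>z. f1 z + qf z powi ((2 - int CARD('n)) div 2) * f2 z) \<and>
     (\<forall>x\<in>Ann. f1 (cembed x) + qf (cembed x) powi ((2 - int CARD('n)) div 2) * f2 (cembed x) = f x)"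
proof -
  have ex: "(2 - int CARD('n)) div 2 = - int m" unfolding dim by simp
  obtain C where C: "C \<noteq> 0"
    "\<And>x. x \<in> Ann \<Longrightarrow> f_in (cembed x) - f_out (cembed x) = C * f x"
    by (rule f_in_minus_f_out) blast
  \<comment> \<open>The factor q^m in f2 offsets q^((2-d)/2) = q^(-m), so the extension is (f_in -
    f_out) / C.\<close>
  define f1 where "f1 z = (- inverse C) * f_out z" for z
  define f2 where "f2 z = inverse C * qf z ^ m * f_in z" for z
  have neg: "negaxis = \<real>\<^sub>\<le>\<^sub>0" by (auto simp: negaxis_def complex_nonpos_Reals_iff)
  \<comment> \<open>For \<tau> = 0 both sides are true.\<close>
  have inv2: "ereal L < inv2 \<tau> \<longleftrightarrow> 2 * \<tau> * L < 1" for L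
    using \<tau>_nonneg by (auto simp: inv2_def field_simps)
  have h1: "holo_on {z. ereal (Lplus z) < ereal R} f1"
    unfolding f1_def[abs_def]
    using holo_on_mult[OF holo_on_const[of _ "- inverse C"] holo_f_out] by (simp only: less_ereal.simps)
  have q: "holo_on T (\<lambda>z. qf z ^ j)" for T :: "(complex^'n) set" and j
    by (rule jholo_imp_holo_on[OF jholo_power[OF jholo_qf]])
  have h2: "holo_on {z. r0 < Lminus z \<and> ereal (Lplus z) < inv2 \<tau> \<and> qf z \<notin> negaxis} f2"
    unfolding f2_def[abs_def] inv2 neg
    by (intro holo_on_mult holo_on_const q holo_f_in)
  have h3: "holo_on (cannulus r0 (ereal R) - qf -` negaxis) (\<lambda>z. f1 z + qf z powi ((2 - int CARD('n)) div 2) * f2 z)"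
    unfolding ex power_int_minus power_int_of_nat
  proof (intro holo_on_add holo_on_mult)
    show "holo_on (cannulus r0 (ereal R) - qf -` negaxis) f1"
      by (rule holo_on_subset[OF h1]) (auto simp: cannulus_def)
    show "holo_on (cannulus r0 (ereal R) - qf -` negaxis) f2"
      by (rule holo_on_subset[OF h2]) (auto simp: cannulus_def inv2 intro: type_Lplus)
    show "holo_on (cannulus r0 (ereal R) - qf -` negaxis) (\<lambda>z. inverse (qf z ^ m))"
      by (intro jholo_imp_holo_on jholo_inverse jholo_power jholo_qf) (auto simp: neg)
  qed
  have "f1 (cembed x) + qf (cembed x) powi ((2 - int CARD('n)) div 2) * f2 (cembed x) = f x"
    if x: "x \<in> Ann" for x
  proof -
    have nz: "qf (cembed x) \<noteq> 0" using G_nz[OF x] by (simp add: qf_cembed)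
    then have "f1 (cembed x) + inverse (qf (cembed x) ^ m) * f2 (cembed x)
        = inverse C * (f_in (cembed x) - f_out (cembed x))"
      by (simp add: f1_def f2_def algebra_simps)
    also have "\<dots> = f x" unfolding C(2)[OF x] using C(1) by simp
    finally show ?thesis unfolding ex power_int_minus power_int_of_nat .
  qed
  with h1 h2 h3 show ?thesis by blast
qed

end

theorem mainTheorem17:
  fixes f :: "real^'n::finite \<Rightarrow> complex" and r0 :: real and r1 :: ereal and \<tau> :: real
  assumes "CARD('n) \<ge> 2" and "even CARD('n)"
    and "0 \<le> r0" and "ereal r0 < r1"
    and "\<tau> \<ge> 0" and "ereal \<tau> < inverse (2 * r1)"
    and "polyharmonic_inf (annulus r0 r1) \<tau> f"
  shows "\<exists>f1 f2.
     holo_on {z. ereal (Lplus z) < r1} f1 \<and>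
     holo_on {z. r0 < Lminus z \<and> ereal (Lplus z) < inv2 \<tau> \<and> qf z \<notin> negaxis} f2 \<and>
     holo_on (cannulus r0 r1 - qf -` negaxis)
        (\<lambda>z. f1 z + qf z powi ((2 - int CARD('n)) div 2) * f2 z) \<and>
     (\<forall>x\<in>annulus r0 r1.
        f1 (cembed x) + qf (cembed x) powi ((2 - int CARD('n)) div 2) * f2 (cembed x) = f x)"
proof -
  \<comment> \<open>For infinite r1 the type bound would read \<tau> < 0, so r1 is a real
    number.\<close>
  obtain R where R: "r1 = ereal R" and R0: "r0 < R"
    using assms(4,5,6) by (cases r1) auto
  have Rpos: "R > 0" using R0 assms(3) by simp
  have "ereal \<tau> < ereal (inverse (2 * R))" using assms(6) Rpos unfolding R by simp
  then have type: "2 * \<tau> * R < 1" using Rpos by (simp add: field_simps)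
  obtain k where k: "CARD('n) = 2 * k" using assms(2) by (elim evenE)
  define m where "m = k - 1"
  have dim: "CARD('n) = 2 * m + 2" using k assms(1) by (simp add: m_def)
  have G: "open (annulus r0 (ereal R) :: (real^'n) set)"
    unfolding annulus_def by (simp, intro open_Collect_conj open_Collect_less continuous_intros)
  have "annular r0 R f \<tau> m"
    by unfold_locales (use G assms(3,5,7) R0 type dim R in auto)
  then show ?thesis unfolding R by (rule annular.exists_decomposition)
qed

end
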